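(* Let $d\ge 1$ and let $A=\limsup_{n\to\infty}A(n)\subset[0,1]^d$ be a limsup random fractal associated to $\{Z_n(Q): n\ge 1, Q\in\mathcal{Q}_n\}$, with indices $\gamma_1,\gamma_2$, and satisfying the Correlation Condition with constant $\delta=0$. Then for any analytic set $G\subset[0,1]^d$, \[ \mathbb{P}(A\cap G\ne\varnothing)= \begin{cases} 0 & \text{if } \dim_{\mathrm P}(G)<\gamma_1,\\ 1 & \text{if } \dim_{\mathrm H}(G)>\gamma_2, \end{cases} \] and \[ \max\{0,\dim_{\mathrm H}(G)-\gamma_2\}\le\dim_{\mathrm H}(A\cap G)\le\max\{0,\dim_{\mathrm P}(G)-\gamma_1\}\quad\text{almost surely.} \] In particular, if $\gamma_1=\gamma_2$, then $\dim_{\mathrm H}(A)=\max\{0,d-\gamma_1\}$ almost surely.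
   Context: $\dim_{\mathrm H}$ and $\dim_{\mathrm P}$ denote Hausdorff and packing dimension in $\mathbb{R}^d$, with the usual convention that the empty set has dimension $0$. For $n\ge 0$, $\mathcal{Q}_n$ is the collection of closed dyadic hyper-cubes of order $n$ in $[0,1]^d$: \[\mathcal{Q}_n=\{[k_12^{-n},(k_1+1)2^{-n}]\times\dots\times[k_d2^{-n},(k_d+1)2^{-n}] : k_i\in\mathbb{Z},\ 0\le k_i\le 2^n-1,\ 1\le i\le d\}.\] Limsup random fractal: for $n\ge 1$ let $\{Z_n(Q): Q\in\mathcal{Q}_n\}$ be random variables, all defined on one probability space $(\Omega,\mathscr{B},\mathbb{P})$ and taking values in $\{0,1\}$ (no independence is assumed). Put $A(n)=\bigcup_{Q\in\mathcal{Q}_n,\ Z_n(Q)=1}Q$ and $A=\limsup_{n\to\infty}A(n)=\bigcap_{k\ge1}\bigcup_{n\ge k}A(n)$. The random set $A$ is called the limsup random fractal associated to $\{Z_n(Q): n\ge1, Q\in\mathcal{Q}_n\}$. Indices: with $P_n(Q)=\mathbb{P}(Z_n(Q)=1)$ and the convention $\log_2 0=-\infty$, \[\gamma_1=-\limsup_{n\to\infty}\frac{\log_2(\max_{Q\in\mathcal{Q}_n}P_n(Q))}{n},\qquad \gamma_2=-\limsup_{n\to\infty}\frac{\log_2(\min_{Q\in\mathcal{Q}_n}P_n(Q))}{n}\] (these may equal $+\infty$). Correlation Condition with constant $\delta\ge0$: for all $\epsilon>0$, $\limsup_{n\to\infty}\frac1n\log_2 f(n,\epsilon)\le\delta$, where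 \[f(n,\epsilon)=\max_{Q\in\mathcal{Q}_n}\#\{Q'\in\mathcal{Q}_n : \mathrm{Cov}(Z_n(Q),Z_n(Q'))\ge\epsilon P_n(Q)P_n(Q')\}\] and $\mathrm{Cov}$ denotes covariance. *)

theory Defs
  imports "HOL-Probability.Probability"
begin

section \<open>Hausdorff and packing dimension\<close>

(* The s-th power of the diameter with the measure-theoretic conventions: the empty set contributes 0,
   also for s = 0, and a singleton contributes 1 for s = 0 (whereas 0 powr 0 = 0). *)
definition diam_pow :: "real \<Rightarrow> 'a::metric_space set \<Rightarrow> ennreal" where
  "diam_pow s U = (if U = {} then 0 else if s = 0 then 1 else ennreal (diameter U powr s))"

(* The covering sets are required to be bounded because the library's diameter is a real number
   and carries no information for unbounded sets. Finite covers are padded with empty sets. *)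
definition hausdorff_premeasure :: "real \<Rightarrow> real \<Rightarrow> 'a::metric_space set \<Rightarrow> ennreal" where
  "hausdorff_premeasure s \<delta> E =
     (INF U \<in> {U :: nat \<Rightarrow> 'a set. (\<forall>i. bounded (U i) \<and> diameter (U i) \<le> \<delta>) \<and> E \<subseteq> (\<Union>i. U i)}.
        \<Sum>i. diam_pow s (U i))"

definition hausdorff_measure :: "real \<Rightarrow> 'a::metric_space set \<Rightarrow> ennreal" where
  "hausdorff_measure s E = (SUP \<delta> \<in> {0<..}. hausdorff_premeasure s \<delta> E)"

definition hausdorff_dim :: "'a::metric_space set \<Rightarrow> ereal" where
  "hausdorff_dim E = Inf (ereal ` {s. 0 \<le> s \<and> hausdorff_measure s E = 0})"

(* A packing is a countable set of centre-radius pairs. *)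
definition packings :: "real \<Rightarrow> 'a::metric_space set \<Rightarrow> ('a \<times> real) set set" where
  "packings \<delta> E =
     {F. countable F \<and> F \<subseteq> E \<times> {0<..\<delta>} \<and> disjoint_family_on (\<lambda>(x, r). cball x r) F}"

definition packing_premeasure :: "real \<Rightarrow> 'a::metric_space set \<Rightarrow> ennreal" where
  "packing_premeasure s E =
     (INF \<delta> \<in> {0<..}. SUP F \<in> packings \<delta> E. \<Sum>\<^sub>\<infinity>(x, r)\<in>F. ennreal ((2 * r) powr s))"

(* The packing premeasure is not countably subadditive; hence the second step. *)
definition packing_measure :: "real \<Rightarrow> 'a::metric_space set \<Rightarrow> ennreal" where
  "packing_measure s E =
     (INF U \<in> {U :: nat \<Rightarrow> 'a set. E \<subseteq> (\<Union>i. U i)}. \<Sum>i. packing_premeasure s (U i))"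

definition packing_dim :: "'a::metric_space set \<Rightarrow> ereal" where
  "packing_dim E = Inf (ereal ` {s. 0 \<le> s \<and> packing_measure s E = 0})"

section \<open>Analytic sets\<close>

(* Continuous images of the Baire space: the function type carries the product topology
   of the discrete topology on nat. *)
definition analytic_set :: "'a::polish_space set \<Rightarrow> bool" where
  "analytic_set S \<longleftrightarrow>
     S = {} \<or> (\<exists>f :: (nat \<Rightarrow> nat) \<Rightarrow> 'a. continuous_on UNIV f \<and> range f = S)"

section \<open>Limsup random fractals\<close>

definition dyadic_cubes :: "nat \<Rightarrow> (real ^ 'n) set set" where
  "dyadic_cubes n =
     {cbox (\<chi> i. of_int (k i) / 2 ^ n) (\<chi> i. of_int (k i + 1) / 2 ^ n) |
        k :: 'n \<Rightarrow> int. \<forall>i. 0 \<le> k i \<and> k i \<le> 2 ^ n - 1}"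

lemma finite_dyadic_cubes: "finite (dyadic_cubes n :: (real ^ 'n) set set)"
proof -
  let ?K = "PiE UNIV (\<lambda>_::'n. {0..2 ^ n - 1 :: int})"
  let ?c = "\<lambda>k :: 'n \<Rightarrow> int. cbox (\<chi> i. of_int (k i) / 2 ^ n) (\<chi> i. of_int (k i + 1) / 2 ^ n) :: (real ^ 'n) set"
  have "dyadic_cubes n \<subseteq> ?c ` ?K"
    by (auto simp: dyadic_cubes_def PiE_UNIV_domain)
  moreover have "finite (?c ` ?K)"
    by (intro finite_imageI finite_PiE) auto
  ultimately show ?thesis
    by (rule finite_subset)
qed

lemma dyadic_cubes_nonempty: "dyadic_cubes n \<noteq> ({} :: (real ^ 'n) set set)"
  by (auto simp: dyadic_cubes_def intro!: exI[of _ "\<lambda>_. 0"])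

(* Z n Q is only constrained for n >= 1 and dyadic cubes Q of order n. *)
definition limsup_fractal_family ::
    "'w measure \<Rightarrow> (nat \<Rightarrow> (real ^ 'n) set \<Rightarrow> 'w \<Rightarrow> real) \<Rightarrow> bool" where
  "limsup_fractal_family M Z \<longleftrightarrow> prob_space M \<and>
     (\<forall>n\<ge>1. \<forall>Q\<in>dyadic_cubes n.
        Z n Q \<in> borel_measurable M \<and> (\<forall>\<omega>\<in>space M. Z n Q \<omega> \<in> {0, 1}))"

definition level_set ::
    "(nat \<Rightarrow> (real ^ 'n) set \<Rightarrow> 'w \<Rightarrow> real) \<Rightarrow> nat \<Rightarrow> 'w \<Rightarrow> (real ^ 'n) set" where
  "level_set Z n \<omega> = \<Union>{Q \<in> dyadic_cubes n. Z n Q \<omega> = 1}"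

definition limsup_fractal ::
    "(nat \<Rightarrow> (real ^ 'n) set \<Rightarrow> 'w \<Rightarrow> real) \<Rightarrow> 'w \<Rightarrow> (real ^ 'n) set" where
  "limsup_fractal Z \<omega> = (\<Inter>k\<in>{1..}. \<Union>n\<in>{k..}. level_set Z n \<omega>)"

definition cube_prob ::
    "'w measure \<Rightarrow> (nat \<Rightarrow> (real ^ 'n) set \<Rightarrow> 'w \<Rightarrow> real) \<Rightarrow> nat \<Rightarrow> (real ^ 'n) set \<Rightarrow> real" where
  "cube_prob M Z n Q = measure M {\<omega> \<in> space M. Z n Q \<omega> = 1}"

(* Binary logarithm of a nonnegative real with log2 0 = -infinity. *)
definition elog2 :: "real \<Rightarrow> ereal" where
  "elog2 x = (if x = 0 then -\<infinity> else ereal (log 2 x))"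

definition index1 :: "'w measure \<Rightarrow> (nat \<Rightarrow> (real ^ 'n) set \<Rightarrow> 'w \<Rightarrow> real) \<Rightarrow> ereal" where
  "index1 M Z =
     - limsup (\<lambda>n. elog2 (MAX Q \<in> dyadic_cubes n. cube_prob M Z n Q) / ereal (real n))"

definition index2 :: "'w measure \<Rightarrow> (nat \<Rightarrow> (real ^ 'n) set \<Rightarrow> 'w \<Rightarrow> real) \<Rightarrow> ereal" where
  "index2 M Z =
     - limsup (\<lambda>n. elog2 (MIN Q \<in> dyadic_cubes n. cube_prob M Z n Q) / ereal (real n))"

definition covariance :: "'w measure \<Rightarrow> ('w \<Rightarrow> real) \<Rightarrow> ('w \<Rightarrow> real) \<Rightarrow> real" where
  "covariance M X Y =
     (\<integral>\<omega>. (X \<omega> - (\<integral>\<omega>'. X \<omega>' \<partial>M)) * (Y \<omega> - (\<integral>\<omega>'. Y \<omega>' \<partial>M)) \<partial>M)"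

definition correlated_count ::
    "'w measure \<Rightarrow> (nat \<Rightarrow> (real ^ 'n) set \<Rightarrow> 'w \<Rightarrow> real) \<Rightarrow> nat \<Rightarrow> real \<Rightarrow> nat" where
  "correlated_count M Z n \<epsilon> =
     (MAX Q \<in> dyadic_cubes n.
        card {Q' \<in> dyadic_cubes n.
          covariance M (Z n Q) (Z n Q') \<ge> \<epsilon> * cube_prob M Z n Q * cube_prob M Z n Q'})"

definition correlation_condition ::
    "'w measure \<Rightarrow> (nat \<Rightarrow> (real ^ 'n) set \<Rightarrow> 'w \<Rightarrow> real) \<Rightarrow> real \<Rightarrow> bool" where
  "correlation_condition M Z \<delta> \<longleftrightarrow>
     (\<forall>\<epsilon>>0. limsup (\<lambda>n. elog2 (real (correlated_count M Z n \<epsilon>)) / ereal (real n)) \<le> ereal \<delta>)"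

(* For analytic G this event is in general only measurable with respect to the completion of M. *)
definition hitting_event ::
    "'w measure \<Rightarrow> (nat \<Rightarrow> (real ^ 'n) set \<Rightarrow> 'w \<Rightarrow> real) \<Rightarrow> (real ^ 'n) set \<Rightarrow> 'w set" where
  "hitting_event M Z G = {\<omega> \<in> space M. limsup_fractal Z \<omega> \<inter> G \<noteq> {}}"

end

theory Submission
  imports Defs
begin

text \<open>
  Upper bounds: a set of finite packing premeasure of order \<open>t\<close> meets \<open>O(2 ^ (n t))\<close> dyadic cubes of
  order \<open>n\<close>, so for \<open>t - s < \<gamma>\<^sub>1\<close> the expected \<open>s\<close>-weight of the retained cubes that meet it is summable
  in \<open>n\<close> and these cubes are covers of arbitrarily small weight (for \<open>s = 0\<close>: eventually there are none).

  Lower bounds: let \<open>\<mu>\<close> be a Frostman measure of exponent \<open>s > \<gamma>\<^sub>2 + t\<close> on a compact subset of \<open>G\<close>. Replacing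
  \<open>\<mu>\<close> by the measure with density \<open>Z\<^sub>n(Q) / P\<^sub>n(Q)\<close> on each cube of order \<open>n\<close> changes it little in \<open>t\<close>-energy: by
  the correlation condition the expected energy of the difference tends to 0 along the \<open>n\<close> that realise
  \<open>\<gamma>\<^sub>2\<close>. Iterating along a random sequence of levels keeps the mass bounded below and the energy bounded
  above on a decreasing sequence of compact sets, whose intersection lies in \<open>A \<inter> G\<close> and hence has dimension at least
  \<open>t\<close>. Only countably many measures can occur, so one null set suffices. Measures are encoded by their
  values on the dyadic cells, as additive functions on the tree of cell indices.
\<close>

section \<open>Dyadic cells and cubes\<close>

text \<open>The condition \<open>s > t + index2\<close> comes from one variance: thinning at order
  \<open>n\<close> multiplies masses by up to \<open>2 powr (n * \<gamma>)\<close> with \<gamma>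
  just above \<open>index2\<close>, so the variance of the mass of a cell of that order is about
  this factor times the squared mass. One Frostman factor \<open>2 powr - (n * s)\<close> has to
  beat this together with the energy weight \<open>2 powr (n * t)\<close>; the subexponential number
  of correlated cubes fits into the remaining gap. A Frostman bound alone would not survive the
  iteration, since each thinning multiplies its constant by an uncontrolled factor. The energy does
  survive: it is quadratic, so its expected change is governed by second moments, and one small
  number controls both the total mass and the energy at the next stage. The closed cubes of the
  statement overlap on their faces. Masses therefore live on disjoint cells, where additivity is
  exact, while the carriers are cut by the closed cubes, which keeps them compact.\<close>

definition index_set :: "nat \<Rightarrow> ('n::finite \<Rightarrow> int) set" where
  "index_set m = {k. \<forall>i. 0 \<le> k i \<and> k i < 2 ^ m}"

definition ancestor :: "nat \<Rightarrow> ('n::finite \<Rightarrow> int) \<Rightarrow> 'n \<Rightarrow> int" where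
  "ancestor j k = (\<lambda>i. k i div 2 ^ j)"

text \<open>The \<open>min\<close> assigns the upper faces of the unit cube to the last cells, so
  that at each order the cells, unlike the closed cubes, partition \<open>cbox 0 1\<close>.\<close>

definition cube_index :: "nat \<Rightarrow> real ^ 'n \<Rightarrow> 'n \<Rightarrow> int" where
  "cube_index m x = (\<lambda>i. min \<lfloor>2 ^ m * x $ i\<rfloor> (2 ^ m - 1))"

definition dyadic_cube :: "nat \<Rightarrow> ('n::finite \<Rightarrow> int) \<Rightarrow> (real ^ 'n) set" where
  "dyadic_cube m k = cbox (\<chi> i. of_int (k i) / 2 ^ m) (\<chi> i. of_int (k i + 1) / 2 ^ m)"

lemma finite_index_set [simp]: "finite (index_set m :: ('n::finite \<Rightarrow> int) set)"
proof -
  have "index_set m = PiE UNIV (\<lambda>_::'n. {0..<2 ^ m :: int})"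
    by (auto simp: index_set_def PiE_UNIV_domain)
  then show ?thesis
    by (auto intro!: finite_PiE)
qed

lemma card_index_set: "card (index_set m :: ('n::finite \<Rightarrow> int) set) = 2 ^ (m * CARD('n))"
proof -
  have "index_set m = PiE UNIV (\<lambda>_::'n. {0..<2 ^ m :: int})"
    by (auto simp: index_set_def PiE_UNIV_domain)
  then show ?thesis
    by (simp add: card_PiE power_mult nat_power_eq)
qed

lemma index_set_0: "index_set 0 = {\<lambda>_. 0}"
  by (auto simp: index_set_def fun_eq_iff) (metis order_antisym zle_iff_zadd zless_add1_eq add_0 order_le_less)

lemma ancestor_0 [simp]: "ancestor 0 k = k"
  by (simp add: ancestor_def)

lemma ancestor_ancestor: "ancestor a (ancestor b k) = ancestor (a + b) k"
  by (simp add: ancestor_def fun_eq_iff power_add zdiv_zmult2_eq mult.commute[of "2 ^ a"])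

lemma ancestor_in_index_set: "k \<in> index_set (m + j) \<Longrightarrow> ancestor j k \<in> index_set m"
  unfolding index_set_def ancestor_def mem_Collect_eq
proof (intro allI conjI)
  fix i assume "\<forall>i. 0 \<le> k i \<and> k i < 2 ^ (m + j)"
  then have k: "0 \<le> k i" "k i < 2 ^ m * 2 ^ j"
    by (auto simp: power_add)
  then show "0 \<le> k i div 2 ^ j"
    by (simp add: pos_imp_zdiv_nonneg_iff)
  have "k i div 2 ^ j * 2 ^ j \<le> k i"
    by (simp add: mult.commute minus_mod_eq_mult_div[symmetric])
  with k(2) have "k i div 2 ^ j * 2 ^ j < 2 ^ m * 2 ^ j"
    by linarith
  then show "k i div 2 ^ j < 2 ^ m"
    by simp
qed

lemma dyadic_cubes_eq: "dyadic_cubes m = dyadic_cube m ` index_set m"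
  by (auto simp: dyadic_cubes_def dyadic_cube_def index_set_def image_iff)

lemma inj_dyadic_cube: "inj (dyadic_cube m :: ('n::finite \<Rightarrow> int) \<Rightarrow> _)"
proof (rule injI)
  fix k l :: "'n \<Rightarrow> int"
  assume eq: "dyadic_cube m k = dyadic_cube m l"
  have "dyadic_cube m k \<noteq> {}"
    by (auto simp: dyadic_cube_def interval_ne_empty_cart divide_right_mono)
  with eq have "(\<chi> i. real_of_int (k i) / 2 ^ m) = (\<chi> i. real_of_int (l i) / 2 ^ m)"
    by (simp add: dyadic_cube_def eq_cbox)
  then show "k = l"
    by (simp add: vec_eq_iff fun_eq_iff)
qed

text \<open>Nesting survives the truncation at the upper faces: integer division is monotone, hence
  commutes with \<open>min\<close>, and it sends the last index \<open>2 ^ (m + j) - 1\<close> to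
  the last index \<open>2 ^ m - 1\<close>.\<close>

lemma ancestor_cube_index: "ancestor j (cube_index (m + j) x) = cube_index m x"
proof
  fix i
  have mono: "mono (\<lambda>a::int. a div 2 ^ j)"
    by (intro monoI zdiv_mono1) auto
  have fl: "\<lfloor>2 ^ (m + j) * x $ i\<rfloor> div 2 ^ j = \<lfloor>2 ^ m * x $ i\<rfloor>"
  proof -
    have "\<lfloor>(2 ^ (m + j) * x $ i) / of_int (2 ^ j)\<rfloor> = \<lfloor>2 ^ (m + j) * x $ i\<rfloor> div 2 ^ j"
      by (rule floor_divide_real_eq_div) simp
    then show ?thesis
      by (simp add: power_add)
  qed
  have "(2 ^ m * 2 ^ j - 1 :: int) div 2 ^ j = 2 ^ m - 1"
    by (rule int_div_pos_eq[of _ _ _ "2 ^ j - 1"]) (auto simp: algebra_simps)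
  then have "(2 ^ (m + j) - 1 :: int) div 2 ^ j = 2 ^ m - 1"
    by (simp add: power_add)
  with fl show "ancestor j (cube_index (m + j) x) i = cube_index m x i"
    by (simp add: ancestor_def cube_index_def min_of_mono[OF mono, symmetric])
qed

lemma ancestor_cube_index': "m \<le> l \<Longrightarrow> ancestor (l - m) (cube_index l x) = cube_index m x"
  using ancestor_cube_index[of "l - m" m x] by simp

lemma cube_index_in_index_set:
  assumes "x \<in> cbox 0 1"
  shows "cube_index m x \<in> index_set m"
  using assms by (auto simp: cube_index_def index_set_def mem_box_cart min_def)

lemma in_dyadic_cube_cube_index:
  assumes "x \<in> cbox 0 1"
  shows "x \<in> dyadic_cube m (cube_index m x)"
proof -
  have "of_int (cube_index m x i) / 2 ^ m \<le> x $ i \<and> x $ i \<le> of_int (cube_index m x i + 1) / 2 ^ m" for i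
  proof -
    have x: "0 \<le> x $ i" "x $ i \<le> 1"
      using assms by (auto simp: mem_box_cart)
    have "of_int (cube_index m x i) \<le> 2 ^ m * x $ i"
      unfolding cube_index_def by linarith
    moreover have "2 ^ m * x $ i \<le> 2 ^ m * 1"
      using x by (intro mult_left_mono) auto
    then have "2 ^ m * x $ i \<le> of_int (cube_index m x i + 1)"
      unfolding cube_index_def min_def by (simp split: if_splits, linarith?)
    ultimately show ?thesis
      by (simp add: field_simps)
  qed
  then show ?thesis
    by (simp add: dyadic_cube_def mem_box_cart)
qed

lemma dyadic_cube_subset: "k \<in> index_set m \<Longrightarrow> dyadic_cube m k \<subseteq> cbox 0 1"
proof -
  assume k: "k \<in> index_set m"
  have "0 \<le> real_of_int (k i)" "real_of_int (k i + 1) \<le> 2 ^ m" for i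
  proof -
    have "0 \<le> k i" "k i < 2 ^ m"
      using k by (auto simp: index_set_def)
    then have "0 \<le> k i" "k i + 1 \<le> 2 ^ m"
      by linarith+
    then show "0 \<le> real_of_int (k i)" "real_of_int (k i + 1) \<le> 2 ^ m"
      by (simp, metis of_int_le_iff of_int_numeral of_int_power)
  qed
  then show ?thesis
    unfolding dyadic_cube_def by (intro subset_box_imp) (auto simp: Basis_vec_def inner_axis)
qed

lemma dyadic_cube_component_dist:
  assumes "x \<in> dyadic_cube m k" "y \<in> dyadic_cube m k"
  shows "\<bar>x $ i - y $ i\<bar> \<le> 1 / 2 ^ m"
proof -
  have "of_int (k i) / 2 ^ m \<le> x $ i" "x $ i \<le> of_int (k i + 1) / 2 ^ m"
       "of_int (k i) / 2 ^ m \<le> y $ i" "y $ i \<le> of_int (k i + 1) / 2 ^ m"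
    using assms by (auto simp: dyadic_cube_def mem_box_cart)
  moreover have "real_of_int (k i + 1) / 2 ^ m = of_int (k i) / 2 ^ m + 1 / 2 ^ m"
    by (simp add: field_simps)
  ultimately show ?thesis
    by linarith
qed

lemma bounded_dyadic_cube [simp]: "bounded (dyadic_cube m k)"
  by (simp add: dyadic_cube_def)

lemma dyadic_cube_diameter: 
  "diameter (dyadic_cube m k :: (real ^ 'n) set) \<le> real CARD('n) / 2 ^ m"
proof (rule diameter_le)
  show "dyadic_cube m k \<noteq> {} \<or> 0 \<le> real CARD('n) / 2 ^ m"
    by simp
  fix x y :: "real ^ 'n"
  assume "x \<in> dyadic_cube m k" "y \<in> dyadic_cube m k"
  then have "\<bar>(x - y) $ i\<bar> \<le> 1 / 2 ^ m" for i
    using dyadic_cube_component_dist by auto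
  then have "(\<Sum>i\<in>UNIV. \<bar>(x - y) $ i\<bar>) \<le> real CARD('n) * (1 / 2 ^ m)"
    by (intro order_trans[OF sum_bounded_above]) auto
  then show "norm (x - y) \<le> real CARD('n) / 2 ^ m"
    using norm_le_l1_cart[of "x - y"] by simp
qed

text \<open>Two points of the box differ by less than 4 sides in each coordinate, so their floors
  differ by at most 4, and \<open>min\<close> does not increase this. Around the index of any point
  of the box this leaves 4 + 1 + 4 = 9 values per coordinate.\<close>

lemma box_meets_few_cells:
  fixes x :: "real ^ 'n"
  obtains F where "finite F" "card F \<le> 9 ^ CARD('n)" "F \<subseteq> {m} \<times> index_set m"
    "\<And>y. y \<in> cbox 0 1 \<Longrightarrow> (\<And>i. \<bar>y $ i - x $ i\<bar> < 2 / 2 ^ m) \<Longrightarrow> (m, cube_index m y) \<in> F"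
proof -
  define V where "V = {y \<in> cbox 0 1. \<forall>i. \<bar>y $ i - x $ i\<bar> < 2 / 2 ^ m}"
  define F where "F = (\<lambda>y. (m, cube_index m y)) ` V"
  have sub: "F \<subseteq> {m} \<times> index_set m"
    using cube_index_in_index_set by (auto simp: F_def V_def)
  then have fin: "finite F"
    by (rule finite_subset) auto
  have "card F \<le> 9 ^ CARD('n)"
  proof (cases "V = {}")
    case True
    then show ?thesis
      by (simp add: F_def)
  next
    case False
    then obtain z where z: "z \<in> V"
      by auto
    let ?B = "PiE UNIV (\<lambda>i. {cube_index m z i - 4..cube_index m z i + 4})"
    have "cube_index m y i \<in> {cube_index m z i - 4..cube_index m z i + 4}" if "y \<in> V" for y i
    proof -
      have "\<bar>y $ i - x $ i\<bar> < 2 / 2 ^ m" "\<bar>z $ i - x $ i\<bar> < 2 / 2 ^ m"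
        using that z by (auto simp: V_def)
      then have "\<bar>y $ i - z $ i\<bar> < 4 / 2 ^ m"
        by auto
      then have "\<bar>2 ^ m * (y $ i - z $ i)\<bar> < 4"
        by (subst abs_mult) (simp add: field_simps)
      then have "\<bar>2 ^ m * y $ i - 2 ^ m * z $ i\<bar> < 4"
        by (simp only: right_diff_distrib)
      then have "\<bar>\<lfloor>2 ^ m * y $ i\<rfloor> - \<lfloor>2 ^ m * z $ i\<rfloor>\<bar> \<le> 4"
        by linarith
      then show ?thesis
        by (auto simp: cube_index_def min_def)
    qed
    then have "F \<subseteq> {m} \<times> ?B"
      by (auto simp: F_def)
    then have "card F \<le> card ({m} \<times> ?B)"
      by (intro card_mono finite_cartesian_product finite_PiE) auto
    also have "\<dots> = 9 ^ CARD('n)"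
      by (simp add: card_cartesian_product card_PiE)
    finally show ?thesis .
  qed
  with sub fin show ?thesis
    by (intro that[of F]) (auto simp: F_def V_def)
qed

section \<open>Net content\<close>

text \<open>A family of cells is a set of nodes and its weight the measure of that set.
  Inclusion-exclusion and continuity along monotone sequences then come from measure theory.\<close>

definition node_measure :: "real \<Rightarrow> (nat \<times> ('n::finite \<Rightarrow> int)) measure" where
  "node_measure s = point_measure UNIV (\<lambda>(m, k). ennreal (2 powr - (real m * s)))"

definition covers :: "(nat \<times> ('n::finite \<Rightarrow> int)) set \<Rightarrow> (real ^ 'n) set \<Rightarrow> bool" where
  "covers C E \<longleftrightarrow> (\<forall>x\<in>E. \<exists>m. (m, cube_index m x) \<in> C)"

text \<open>The dyadic Hausdorff content of order \<open>s\<close>: the mesh is unrestricted, so the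
  value is at most 1 on the unit cube, which permits cancellation.\<close>

definition net_content :: "real \<Rightarrow> (real ^ 'n) set \<Rightarrow> ennreal" where
  "net_content s E = (INF C\<in>{C. covers C E}. emeasure (node_measure s) C)"

definition outermost :: "(nat \<times> ('n::finite \<Rightarrow> int)) set \<Rightarrow> (nat \<times> ('n \<Rightarrow> int)) set" where
  "outermost C = {(m, k) \<in> C. \<forall>j<m. (j, ancestor (m - j) k) \<notin> C}"

lemma sets_node_measure [simp]: "sets (node_measure s) = UNIV"
  by (simp add: node_measure_def sets_point_measure)

lemma space_node_measure [simp]: "space (node_measure s) = UNIV"
  by (simp add: node_measure_def space_point_measure)

lemma emeasure_node_measure_finite:
  "finite F \<Longrightarrow> emeasure (node_measure s) F = (\<Sum>(m, k)\<in>F. ennreal (2 powr - (real m * s)))"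
  unfolding node_measure_def by (subst emeasure_point_measure_finite2) (auto intro!: sum.cong)

lemma emeasure_node_measure_singleton:
  "emeasure (node_measure s) {(m, k)} = ennreal (2 powr - (real m * s))"
  by (simp add: emeasure_node_measure_finite)

lemma emeasure_node_measure_mono: "C \<subseteq> D \<Longrightarrow> emeasure (node_measure s) C \<le> emeasure (node_measure s) D"
  by (rule emeasure_mono) auto

lemma net_content_le: "covers C E \<Longrightarrow> net_content s E \<le> emeasure (node_measure s) C"
  by (auto simp: net_content_def intro: INF_lower)

lemma covers_mono: "covers C E \<Longrightarrow> E' \<subseteq> E \<Longrightarrow> C \<subseteq> C' \<Longrightarrow> covers C' E'"
  by (fastforce simp: covers_def)

lemma net_content_mono: "E \<subseteq> E' \<Longrightarrow> net_content s E \<le> net_content s E'"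
  unfolding net_content_def by (rule INF_superset_mono) (auto intro: covers_mono)

lemma net_content_lessD:
  assumes "net_content s E < c"
  obtains C where "covers C E" "emeasure (node_measure s) C < c"
  using assms by (auto simp: net_content_def INF_less_iff)

lemma net_content_cell_le: "net_content s (E \<inter> {x. cube_index m x = k}) \<le> ennreal (2 powr - (real m * s))"
  using net_content_le[of "{(m, k)}" _ s] by (auto simp: covers_def emeasure_node_measure_singleton)

lemma net_content_le_1: "E \<subseteq> cbox 0 1 \<Longrightarrow> net_content s E \<le> 1"
proof -
  assume "E \<subseteq> cbox 0 1"
  then have "cube_index 0 x \<in> {\<lambda>_. 0}" if "x \<in> E" for x
    using that cube_index_in_index_set[of x 0] by (auto simp: index_set_0)
  then have "covers {(0, \<lambda>_. 0)} E"
    by (auto simp: covers_def)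
  from net_content_le[OF this, of s] show ?thesis
    by (simp add: emeasure_node_measure_singleton)
qed

lemma net_content_empty [simp]: "net_content s {} = 0"
  using net_content_le[of "{}" "{}" s] by (simp add: covers_def)

lemma net_content_Un_le: "net_content s (A \<union> B) \<le> net_content s A + net_content s B"
proof (rule ennreal_le_epsilon)
  fix e :: real
  assume fin: "net_content s A + net_content s B < top" and e: "0 < e"
  have "net_content s A < net_content s A + ennreal (e / 2)"
    using fin e by (simp add: ennreal_less_top less_top[symmetric])
  then obtain C where C: "covers C A" "emeasure (node_measure s) C < net_content s A + ennreal (e / 2)"
    by (rule net_content_lessD)
  have "net_content s B < net_content s B + ennreal (e / 2)"
    using fin e by (simp add: ennreal_less_top less_top[symmetric])
  then obtain D where D: "covers D B" "emeasure (node_measure s) D < net_content s B + ennreal (e / 2)"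
    by (rule net_content_lessD)
  have "net_content s (A \<union> B) \<le> emeasure (node_measure s) (C \<union> D)"
    using C D by (intro net_content_le) (fastforce simp: covers_def)
  also have "\<dots> \<le> emeasure (node_measure s) C + emeasure (node_measure s) D"
    by (intro emeasure_subadditive) auto
  also have "\<dots> \<le> (net_content s A + ennreal (e / 2)) + (net_content s B + ennreal (e / 2))"
    using C D by (intro add_mono) auto
  also have "\<dots> = net_content s A + net_content s B + (ennreal (e / 2) + ennreal (e / 2))"
    by (simp add: ac_simps)
  also have "ennreal (e / 2) + ennreal (e / 2) = ennreal e"
    using e by (subst ennreal_plus[symmetric]) auto
  finally show "net_content s (A \<union> B) \<le> net_content s A + net_content s B + ennreal e" .
qed

lemma net_content_UN_le:
  "finite I \<Longrightarrow> net_content s (\<Union>i\<in>I. A i) \<le> (\<Sum>i\<in>I. net_content s (A i))"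
proof (induction I rule: finite_induct)
  case (insert i I)
  then show ?case
    using net_content_Un_le[of s "A i" "\<Union>i\<in>I. A i"] by (auto intro: order_trans add_left_mono)
qed auto

lemma outermost_least:
  assumes "(m, cube_index m x) \<in> C"
  obtains m' where "m' \<le> m" "(m', cube_index m' x) \<in> outermost C"
proof -
  define m' where "m' = (LEAST m. (m, cube_index m x) \<in> C)"
  have "(m', cube_index m' x) \<in> C" "m' \<le> m"
    using assms unfolding m'_def by (auto intro: LeastI Least_le)
  moreover have "(j, ancestor (m' - j) (cube_index m' x)) \<notin> C" if "j < m'" for j
    using not_less_Least[of j "\<lambda>m. (m, cube_index m x) \<in> C"] that
    by (simp add: m'_def[symmetric] ancestor_cube_index')
  ultimately show ?thesis
    by (intro that[of m']) (auto simp: outermost_def)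
qed

lemma covers_outermost: "covers C E \<Longrightarrow> covers (outermost C) E"
  unfolding covers_def by (meson outermost_least)

text \<open>Two cells with a common point are nested; discarding the nested ones from the union of two
  covers leaves enough cells to cover the intersection. This makes the content strongly subadditive.\<close>

lemma strong_subadditivity:
  assumes "covers C A" "covers D B"
  shows "emeasure (node_measure s) (outermost (C \<union> D)) + net_content s (A \<inter> B)
    \<le> emeasure (node_measure s) C + emeasure (node_measure s) D"
proof -
  let ?N = "node_measure s" and ?U = "C \<union> D"
  let ?R = "(C \<inter> D) \<union> (?U - outermost ?U)"
  have "covers ?R (A \<inter> B)"
    unfolding covers_def
  proof
    fix x assume "x \<in> A \<inter> B"
    then obtain m l where ml: "(m, cube_index m x) \<in> C" "(l, cube_index l x) \<in> D"
      using assms unfolding covers_def by blast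
    consider "m = l" | "m < l" | "l < m"
      by linarith
    then show "\<exists>m. (m, cube_index m x) \<in> ?R"
    proof cases
      case 1
      then show ?thesis
        using ml by auto
    next
      case 2
      then have "(l, cube_index l x) \<in> ?U - outermost ?U"
        using ml by (auto simp: outermost_def ancestor_cube_index' intro!: exI[of _ m])
      then show ?thesis
        by blast
    next
      case 3
      then have "(m, cube_index m x) \<in> ?U - outermost ?U"
        using ml by (auto simp: outermost_def ancestor_cube_index' intro!: exI[of _ l])
      then show ?thesis
        by blast
    qed
  qed
  then have "net_content s (A \<inter> B) \<le> emeasure ?N ?R"
    by (rule net_content_le)
  also have "\<dots> \<le> emeasure ?N (C \<inter> D) + emeasure ?N (?U - outermost ?U)"
    by (intro emeasure_subadditive) auto
  finally have "emeasure ?N (outermost ?U) + net_content s (A \<inter> B)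
      \<le> emeasure ?N (outermost ?U) + (emeasure ?N (C \<inter> D) + emeasure ?N (?U - outermost ?U))"
    by (rule add_left_mono)
  also have "\<dots> = (emeasure ?N (outermost ?U) + emeasure ?N (?U - outermost ?U)) + emeasure ?N (C \<inter> D)"
    by (simp add: ac_simps)
  also have "emeasure ?N (outermost ?U) + emeasure ?N (?U - outermost ?U) = emeasure ?N ?U"
    by (subst plus_emeasure) (auto simp: outermost_def intro!: arg_cong[where f = "emeasure ?N"])
  also have "emeasure ?N ?U + emeasure ?N (C \<inter> D) = emeasure ?N C + emeasure ?N D"
    by (rule emeasure_Un_Int[symmetric]) auto
  finally show ?thesis .
qed

text \<open>Continuity from below for arbitrary increasing sets is the property of a capacity on
  which the treatment of analytic sets rests. Near-optimal covers are merged one at a time; strong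
  subadditivity, applied with \<open>E i \<inter> E (Suc i) = E i\<close>, makes only the errors add
  up. At a fixed point the order of the covering cell can be kept from rising, so it stabilises, and
  the cells present from some stage on already cover the union.\<close>

lemma net_content_incseq:
  fixes E :: "nat \<Rightarrow> (real ^ 'n) set"
  assumes inc: "incseq E" and sub: "\<And>i. E i \<subseteq> cbox 0 1"
  shows "net_content s (\<Union>i. E i) \<le> (SUP i. net_content s (E i))"
proof (rule ennreal_le_epsilon)
  fix e :: real
  assume e: "0 < e"
  let ?N = "node_measure s :: (nat \<times> ('n \<Rightarrow> int)) measure"
  have fin: "net_content s (E i) < top" for i
    using net_content_le_1[OF sub, of s i] by (simp add: order_le_less_trans)
  have "\<exists>C. covers C (E i) \<and> emeasure ?N C < net_content s (E i) + ennreal (e / 2 ^ Suc i)" for i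
    by (rule net_content_lessD[of s "E i" "net_content s (E i) + ennreal (e / 2 ^ Suc i)"])
       (use fin[of i] e in auto)
  then obtain C where C: "\<And>i. covers (C i) (E i)"
      "\<And>i. emeasure ?N (C i) < net_content s (E i) + ennreal (e / 2 ^ Suc i)"
    by metis
  define D where "D = rec_nat (C 0) (\<lambda>i D. outermost (D \<union> C (Suc i)))"
  have D0: "D 0 = C 0" and DSuc: "\<And>i. D (Suc i) = outermost (D i \<union> C (Suc i))"
    by (simp_all add: D_def)
  \<comment> \<open>\<open>e * (1 - 1 / 2 ^ Suc i)\<close> is the sum of the errors
    \<open>e / 2 ^ Suc j\<close> over \<open>j \<le> i\<close>.\<close>
  have D: "covers (D i) (E i) \<and> emeasure ?N (D i) \<le> net_content s (E i) + ennreal (e * (1 - 1 / 2 ^ Suc i))" for i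
  proof (induction i)
    case 0
    then show ?case
      using C[of 0] by (auto simp: D0)
  next
    case (Suc i)
    have cov: "covers (D (Suc i)) (E (Suc i))"
      unfolding DSuc by (intro covers_outermost covers_mono[OF C(1)]) auto
    have "E i \<inter> E (Suc i) = E i"
      using incseqD[OF inc, of i "Suc i"] by auto
    then have "emeasure ?N (D (Suc i)) + net_content s (E i) \<le> emeasure ?N (D i) + emeasure ?N (C (Suc i))"
      using strong_subadditivity[of "D i" "E i" "C (Suc i)" "E (Suc i)" s] Suc C(1) by (simp add: DSuc)
    also have "\<dots> \<le> (net_content s (E i) + ennreal (e * (1 - 1 / 2 ^ Suc i)))
        + (net_content s (E (Suc i)) + ennreal (e / 2 ^ Suc (Suc i)))"
      using Suc C(2)[of "Suc i"] by (intro add_mono) auto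
    also have "\<dots> = (net_content s (E (Suc i)) + (ennreal (e * (1 - 1 / 2 ^ Suc i)) + ennreal (e / 2 ^ Suc (Suc i))))
        + net_content s (E i)"
      by (simp add: ac_simps)
    also have "ennreal (e * (1 - 1 / 2 ^ Suc i)) + ennreal (e / 2 ^ Suc (Suc i)) = ennreal (e * (1 - 1 / 2 ^ Suc (Suc i)))"
      using e one_le_power[of "2::real" "Suc i"] by (subst ennreal_plus[symmetric]) (auto simp: field_simps)
    \<comment> \<open>\<open>net_content s (E i)\<close> stands on both sides and is cancelled
      because it is finite.\<close>
    finally have "emeasure ?N (D (Suc i)) \<le> net_content s (E (Suc i)) + ennreal (e * (1 - 1 / 2 ^ Suc (Suc i)))"
      using fin[of i] by (auto simp: less_top[symmetric])
    with cov show ?case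
      by simp
  qed
  define L where "L = (\<Union>i. \<Inter>j\<in>{i..}. D j)"
  have "covers L (\<Union>i. E i)"
    unfolding covers_def
  proof
    fix x assume "x \<in> (\<Union>i. E i)"
    then obtain i where i: "x \<in> E i"
      by auto
    define R where "R m j \<longleftrightarrow> (m, cube_index m x) \<in> D j" for m j
    have step: "\<exists>m'\<le>m. R m' (Suc j)" if R: "R m j" for m j
    proof -
      have "(m, cube_index m x) \<in> D j \<union> C (Suc j)"
        using R by (simp add: R_def)
      then obtain m' where "m' \<le> m" "(m', cube_index m' x) \<in> outermost (D j \<union> C (Suc j))"
        by (rule outermost_least)
      then show ?thesis
        by (auto simp: R_def DSuc)
    qed
    \<comment> \<open>The least order ever attained from stage \<open>i\<close> on: afterwards
      \<open>step\<close> forbids a larger one and minimality a smaller one.\<close>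
    define m where "m = (LEAST m. \<exists>j\<ge>i. R m j)"
    have "\<exists>m. \<exists>j\<ge>i. R m j"
      using D[of i] i unfolding covers_def R_def by blast
    then have "\<exists>j\<ge>i. R m j"
      unfolding m_def by (rule LeastI_ex)
    then obtain j where j: "j \<ge> i" "R m j"
      by auto
    have "R m l" if "l \<ge> j" for l
      using that
    proof (induction l rule: dec_induct)
      case base
      then show ?case by (rule j(2))
    next
      case (step l)
      obtain m' where m': "m' \<le> m" "R m' (Suc l)"
        using \<open>\<And>m j. R m j \<Longrightarrow> \<exists>m'\<le>m. R m' (Suc j)\<close> step.IH by blast
      moreover have "m \<le> m'"
        unfolding m_def using m' step j by (intro Least_le exI[of _ "Suc l"]) auto
      ultimately show ?case
        by simp
    qed
    then show "\<exists>m. (m, cube_index m x) \<in> L"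
      unfolding L_def R_def by blast
  qed
  then have "net_content s (\<Union>i. E i) \<le> emeasure ?N L"
    by (rule net_content_le)
  also have "\<dots> = (SUP i. emeasure ?N (\<Inter>j\<in>{i..}. D j))"
    unfolding L_def by (rule SUP_emeasure_incseq[symmetric]) (auto simp: incseq_def le_fun_def)
  also have "\<dots> \<le> (SUP i. net_content s (E i)) + ennreal e"
  proof (rule SUP_least)
    fix i
    have "emeasure ?N (\<Inter>j\<in>{i..}. D j) \<le> emeasure ?N (D i)"
      by (rule emeasure_node_measure_mono) auto
    also have "\<dots> \<le> net_content s (E i) + ennreal (e * (1 - 1 / 2 ^ Suc i))"
      using D by blast
    also have "\<dots> \<le> (SUP i. net_content s (E i)) + ennreal e"
      using e by (intro add_mono SUP_upper ennreal_leI) (auto intro!: mult_left_le)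
    finally show "emeasure ?N (\<Inter>j\<in>{i..}. D j) \<le> (SUP i. net_content s (E i)) + ennreal e" .
  qed
  finally show "net_content s (\<Union>i. E i) \<le> (SUP i. net_content s (E i)) + ennreal e" .
qed

section \<open>Compact subsets of analytic sets and Hausdorff measure\<close>

lemma cube_index_dist:
  assumes "x \<in> cbox 0 1" "cube_index m x = k"
  shows "\<bar>x $ i - of_int (k i) / 2 ^ m\<bar> \<le> 1 / 2 ^ m"
proof -
  have "x \<in> dyadic_cube m k"
    using in_dyadic_cube_cube_index[OF assms(1), of m] assms(2) by simp
  then have "of_int (k i) / 2 ^ m \<le> x $ i" "x $ i \<le> (of_int (k i) + 1) / 2 ^ m"
    by (auto simp: dyadic_cube_def mem_box_cart)
  moreover have "(of_int (k i) + 1 :: real) / 2 ^ m = of_int (k i) / 2 ^ m + 1 / 2 ^ m"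
    by (simp add: field_simps)
  ultimately show ?thesis
    by linarith
qed

text \<open>The radius exceeds the side \<open>1 / 2 ^ m\<close>, so this is an open neighbourhood
  of the closed cube of order \<open>m\<close> with lower corner \<open>x\<close>. Covers by cells
  become open covers, and returning to cells costs only the factor
  \<open>9 ^ CARD('n)\<close>.\<close>

definition open_cube :: "nat \<Rightarrow> real ^ 'n \<Rightarrow> (real ^ 'n) set" where
  "open_cube m x = {y. \<forall>i. \<bar>y $ i - x $ i\<bar> < 2 / 2 ^ m}"

lemma open_open_cube: "open (open_cube m x)"
proof -
  have "open_cube m x = (\<Inter>i\<in>UNIV. {y. \<bar>y $ i - x $ i\<bar> < 2 / 2 ^ m})"
    by (auto simp: open_cube_def)
  also have "open \<dots>"
    by (intro open_INT finite open_Collect_less continuous_intros ballI)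
  finally show ?thesis .
qed

lemma open_cube_cover:
  fixes x :: "real ^ 'n"
  obtains F where "finite F" "covers F (cbox 0 1 \<inter> open_cube m x)"
    "emeasure (node_measure s) F \<le> ennreal (9 ^ CARD('n) * 2 powr - (real m * s))"
proof -
  obtain F where F: "finite F" "card F \<le> 9 ^ CARD('n)" "F \<subseteq> {m} \<times> index_set m"
    "\<And>y. y \<in> cbox 0 1 \<Longrightarrow> (\<And>i. \<bar>y $ i - x $ i\<bar> < 2 / 2 ^ m) \<Longrightarrow> (m, cube_index m y) \<in> F"
    by (rule box_meets_few_cells[of m x]) blast
  have "emeasure (node_measure s) F = (\<Sum>(m', k)\<in>F. ennreal (2 powr - (real m * s)))"
    unfolding emeasure_node_measure_finite[OF F(1)] by (rule sum.cong) (use F(3) in auto)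
  also have "\<dots> = ennreal (real (card F) * 2 powr - (real m * s))"
    by (simp add: split_beta ennreal_mult' ennreal_of_nat_eq_real_of_nat)
  also have "\<dots> \<le> ennreal (9 ^ CARD('n) * 2 powr - (real m * s))"
  proof (intro ennreal_leI mult_right_mono)
    have "real (card F) \<le> real (9 ^ CARD('n))"
      using F(2) by (simp only: of_nat_le_iff)
    then show "real (card F) \<le> 9 ^ CARD('n)"
      by simp
  qed simp
  finally show ?thesis
    using F by (intro that[of F]) (auto simp: covers_def open_cube_def)
qed

text \<open>If every \<open>k\<close> failed, there would be points \<open>x k\<close> that obey the
  first \<open>k\<close> bounds and are sent outside \<open>V\<close>. They lie in one compact
  product of finite sets, and the finite intersection property yields a point that obeys all bounds
  and is still sent outside \<open>V\<close>.\<close>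

lemma analytic_inner_approximation:
  fixes f :: "(nat \<Rightarrow> nat) \<Rightarrow> 'a::topological_space"
  assumes f: "continuous_on UNIV f" and V: "open V" "f ` {x. \<forall>i. x i \<le> b i} \<subseteq> V"
  obtains k where "f ` {x. \<forall>i<k. x i \<le> b i} \<subseteq> V"
proof (rule ccontr)
  assume "\<not> thesis"
  then have "\<exists>x. (\<forall>i<k. x i \<le> b i) \<and> f x \<notin> V" for k
    using that by blast
  then obtain x where x: "\<And>k i. i < k \<Longrightarrow> x k i \<le> b i" "\<And>k. f (x k) \<notin> V"
    by metis
  \<comment> \<open>In coordinate \<open>i\<close> only the points \<open>x k\<close> with
    \<open>k \<le> i\<close> can exceed \<open>b i\<close>; adding these finitely many values bounds
    the whole sequence.\<close>
  define c where "c i = b i + (\<Sum>k\<le>i. x k i)" for i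
  have xc: "x k i \<le> c i" for k i
  proof (cases "i < k")
    case True
    then show ?thesis
      using x(1)[of i k] by (simp add: c_def)
  next
    case False
    then have "x k i \<le> (\<Sum>k\<le>i. x k i)"
      by (intro member_le_sum) auto
    then show ?thesis
      by (simp add: c_def)
  qed
  have coord: "continuous_on UNIV (\<lambda>x::nat \<Rightarrow> nat. x i)" for i
    by (rule continuous_on_product_coordinates)
  have "compactin (product_topology (\<lambda>_. euclidean) UNIV) (PiE UNIV (\<lambda>i. {..c i}))"
    by (subst compactin_PiE) (auto simp: finite_imp_compact)
  then have cpt: "compact (PiE UNIV (\<lambda>i. {..c i}))"
    by (simp add: euclidean_product_topology)
  define T where "T k = {y. (\<forall>i<k. y i \<le> b i) \<and> f y \<notin> V}" for k
  have "PiE UNIV (\<lambda>i. {..c i}) \<inter> (\<Inter>k\<in>UNIV. T k) \<noteq> {}"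
  proof (rule compact_imp_fip_image[OF cpt])
    fix k
    have "closed (f -` (- V))"
      using f V(1) by (intro closed_vimage) (auto simp: closed_def)
    moreover have "T k = (\<Inter>i\<in>{..<k}. {y. y i \<le> b i}) \<inter> f -` (- V)"
      by (auto simp: T_def)
    moreover have "closed (\<Inter>i\<in>{..<k}. {y. y i \<le> b i})"
      by (intro closed_INT ballI closed_Collect_le coord continuous_intros)
    ultimately show "closed (T k)"
      by auto
  next
    fix I :: "nat set" assume I: "finite I"
    \<comment> \<open>The sum serves as an upper bound of \<open>I\<close> that also makes sense for
      empty \<open>I\<close>.\<close>
    define K where "K = (\<Sum>i\<in>I. i)"
    have "k \<le> K" if "k \<in> I" for k
      using that I by (auto simp: K_def intro: member_le_sum)
    then have "x K \<in> PiE UNIV (\<lambda>i. {..c i}) \<inter> (\<Inter>k\<in>I. T k)"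
      using x xc by (fastforce simp: T_def PiE_UNIV_domain)
    then show "PiE UNIV (\<lambda>i. {..c i}) \<inter> (\<Inter>k\<in>I. T k) \<noteq> {}"
      by blast
  qed
  then obtain y where "\<And>k. y \<in> T k"
    by blast
  then have "\<forall>i. y i \<le> b i" "f y \<notin> V"
    by (auto simp: T_def)
  with V(2) show False
    by blast
qed

text \<open>Besicovitch--Davies for the net content, by Choquet's capacitability argument.\<close>

lemma analytic_compact_subset:
  fixes G :: "(real ^ 'n) set"
  assumes G: "analytic_set G" "G \<subseteq> cbox 0 1" and pos: "0 < net_content s G"
  obtains K where "compact K" "K \<subseteq> G" "0 < net_content s K"
proof -
  obtain f :: "(nat \<Rightarrow> nat) \<Rightarrow> real ^ 'n" where f: "continuous_on UNIV f" "range f = G"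
    using G pos by (auto simp: analytic_set_def)
  obtain c where c: "0 < c" "c < net_content s G"
    using dense[OF pos] by auto
  define B where "B b k = {x::nat \<Rightarrow> nat. \<forall>i<k. x i \<le> b i}" for b and k :: nat
  \<comment> \<open>Stage \<open>k\<close> chooses the bound for coordinate \<open>k\<close> and
    leaves the earlier ones untouched. As this bound grows, the images increase to the previous
    image, so by \<open>net_content_incseq\<close> some finite bound keeps the content above
    \<open>c\<close>.\<close>
  have "\<exists>bb. \<forall>k. c < net_content s (f ` B (bb k) k) \<and> (\<exists>n. bb (Suc k) = (bb k)(k := n))"
  proof (rule dependent_nat_choice)
    show "\<exists>b. c < net_content s (f ` B b 0)"
      using c f by (simp add: B_def)
  next
    fix b k assume IH: "c < net_content s (f ` B b k)"
    have eq: "f ` B b k = (\<Union>n. f ` B (b(k := n)) (Suc k))"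
    proof -
      have "B b k = (\<Union>n. B (b(k := n)) (Suc k))"
        by (auto simp: B_def less_Suc_eq)
      then show ?thesis
        by (simp only: image_UN)
    qed
    have "net_content s (\<Union>n. f ` B (b(k := n)) (Suc k)) \<le> (SUP n. net_content s (f ` B (b(k := n)) (Suc k)))"
    proof (rule net_content_incseq)
      have "B (b(k := n)) (Suc k) \<subseteq> B (b(k := n')) (Suc k)" if "n \<le> n'" for n n'
        using that by (fastforce simp: B_def less_Suc_eq)
      then show "incseq (\<lambda>n. f ` B (b(k := n)) (Suc k))"
        by (simp add: incseq_def image_mono)
      show "f ` B (b(k := n)) (Suc k) \<subseteq> cbox 0 1" for n
        using f(2) G(2) by blast
    qed
    with IH eq have "c < (SUP n. net_content s (f ` B (b(k := n)) (Suc k)))"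
      by auto
    then obtain n where "c < net_content s (f ` B (b(k := n)) (Suc k))"
      by (auto simp: less_SUP_iff)
    then show "\<exists>b'. c < net_content s (f ` B b' (Suc k)) \<and> (\<exists>n. b' = b(k := n))"
      by blast
  qed
  then obtain bb where bb: "\<And>k. c < net_content s (f ` B (bb k) k)" "\<And>k. \<exists>n. bb (Suc k) = (bb k)(k := n)"
    by blast
  define b where "b i = bb (Suc i) i" for i
  have "bb k i = b i" if "i < k" for i k
    using that
  proof (induction k)
    case (Suc k)
    then show ?case
      using bb(2)[of k] by (cases "i = k") (auto simp: b_def)
  qed simp
  then have "B (bb k) k = B b k" for k
    by (auto simp: B_def)
  with bb(1) have big: "c < net_content s (f ` B b k)" for k
    by simp
  define K where "K = f ` {x. \<forall>i. x i \<le> b i}"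
  have "{x. \<forall>i. x i \<le> b i} = PiE UNIV (\<lambda>i. {..b i})"
    by (auto simp: PiE_UNIV_domain)
  moreover have "compactin (product_topology (\<lambda>_. euclidean) UNIV) (PiE UNIV (\<lambda>i. {..b i}))"
    by (subst compactin_PiE) (auto simp: finite_imp_compact)
  ultimately have "compact {x. \<forall>i. x i \<le> b i}"
    by (simp add: euclidean_product_topology)
  then have K: "compact K" "K \<subseteq> G"
    using f by (auto simp: K_def intro!: compact_continuous_image continuous_on_subset[OF f(1)])
  have "0 < net_content s K"
  proof (rule ccontr)
    assume "\<not> 0 < net_content s K"
    \<comment> \<open>A cover of \<open>K\<close> below this weight, enlarged to open cubes and
      covered by cells again, would weigh at most \<open>c\<close>. By compactness and
      \<open>analytic_inner_approximation\<close> it would also cover the image of some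
      \<open>B b k\<close>, whose content exceeds \<open>c\<close>.\<close>
    moreover have "0 < c / ennreal (9 ^ CARD('n))"
      using c by (simp add: ennreal_zero_less_divide)
    ultimately have "net_content s K < c / ennreal (9 ^ CARD('n))"
      by (simp add: not_less)
    then obtain C where C: "covers C K" "emeasure (node_measure s) C < c / ennreal (9 ^ CARD('n))"
      by (rule net_content_lessD)
    define p :: "nat \<times> ('n \<Rightarrow> int) \<Rightarrow> real ^ 'n" where "p = (\<lambda>(m, k). \<chi> i. of_int (k i) / 2 ^ m)"
    have "\<exists>F. finite F \<and> covers F (cbox 0 1 \<inter> open_cube (fst q) (p q)) \<and>
        emeasure (node_measure s) F \<le> ennreal (9 ^ CARD('n) * 2 powr - (real (fst q) * s))" for q
      by (rule open_cube_cover[of "fst q" "p q" s]) blast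
    then obtain F where F: "\<And>q. finite (F q)" "\<And>q. covers (F q) (cbox 0 1 \<inter> open_cube (fst q) (p q))"
        "\<And>q. emeasure (node_measure s) (F q) \<le> ennreal (9 ^ CARD('n) * 2 powr - (real (fst q) * s))"
      by metis
    have "K \<subseteq> (\<Union>q\<in>C. open_cube (fst q) (p q))"
    proof
      fix x assume x: "x \<in> K"
      then obtain m where m: "(m, cube_index m x) \<in> C"
        using C(1) unfolding covers_def by blast
      have "\<bar>x $ i - p (m, cube_index m x) $ i\<bar> < 2 / 2 ^ m" for i
      proof -
        have "\<bar>x $ i - of_int (cube_index m x i) / 2 ^ m\<bar> \<le> 1 / 2 ^ m"
          using x K G(2) by (intro cube_index_dist) auto
        also have "\<dots> < 2 / 2 ^ m"
          by (simp add: divide_strict_right_mono)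
        finally show ?thesis
          by (simp add: p_def)
      qed
      then show "x \<in> (\<Union>q\<in>C. open_cube (fst q) (p q))"
        using m by (auto simp: open_cube_def intro!: bexI[OF _ m])
    qed
    with K(1) open_open_cube
    obtain C' where C': "C' \<subseteq> C" "finite C'" "K \<subseteq> (\<Union>q\<in>C'. open_cube (fst q) (p q))"
      by (metis (no_types, lifting) compactE_image)
    have op: "open (\<Union>q\<in>C'. open_cube (fst q) (p q))"
      by (auto simp: open_open_cube)
    obtain k where k: "f ` B b k \<subseteq> (\<Union>q\<in>C'. open_cube (fst q) (p q))"
      using analytic_inner_approximation[OF f(1) op C'(3)[unfolded K_def]] unfolding B_def by blast
    have "covers (\<Union>q\<in>C'. F q) (f ` B b k)"
      unfolding covers_def
    proof
      fix x assume x: "x \<in> f ` B b k"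
      then obtain q where q: "q \<in> C'" "x \<in> open_cube (fst q) (p q)"
        using k by blast
      moreover have "x \<in> cbox 0 1"
        using x f G(2) by auto
      ultimately obtain m where "(m, cube_index m x) \<in> F q"
        using F(2)[of q] unfolding covers_def by blast
      with q show "\<exists>m. (m, cube_index m x) \<in> (\<Union>q\<in>C'. F q)"
        by blast
    qed
    then have "net_content s (f ` B b k) \<le> emeasure (node_measure s) (\<Union>q\<in>C'. F q)"
      by (rule net_content_le)
    also have "\<dots> \<le> (\<Sum>q\<in>C'. emeasure (node_measure s) (F q))"
      using C' by (intro emeasure_subadditive_finite) auto
    also have "\<dots> \<le> (\<Sum>q\<in>C'. ennreal (9 ^ CARD('n)) * ennreal (2 powr - (real (fst q) * s)))"
      using F(3) by (intro sum_mono) (simp add: ennreal_mult)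
    also have "\<dots> = ennreal (9 ^ CARD('n)) * emeasure (node_measure s) C'"
      using C' by (simp add: emeasure_node_measure_finite sum_distrib_left split_beta del: sum_ennreal)
    also have "\<dots> \<le> ennreal (9 ^ CARD('n)) * emeasure (node_measure s) C"
      using C' by (intro mult_left_mono emeasure_node_measure_mono) auto
    also have "\<dots> \<le> ennreal (9 ^ CARD('n)) * (c / ennreal (9 ^ CARD('n)))"
      using C by (intro mult_left_mono) auto
    also have "\<dots> = c"
      by (simp add: ennreal_times_divide mult.commute[of _ c] ennreal_mult_divide_eq)
    finally show False
      using big[of k] by simp
  qed
  with K that show ?thesis
    by blast
qed

section \<open>Hausdorff null sets from dyadic covers\<close>

lemma diam_pow_empty: "diam_pow s {} = 0"
  by (simp add: diam_pow_def)

text \<open>Cubes of order at least \<open>N\<close> have diameter at most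
  \<open>CARD('n) / 2 ^ N\<close>, so a high starting order takes care of the mesh. The ratio of
  diameter to side enters only through the constant \<open>c\<close>.\<close>

lemma hausdorff_measure_eq_0I:
  fixes E :: "(real ^ 'n) set"
  assumes s: "0 \<le> s"
    and cov: "\<And>N e. 0 < e \<Longrightarrow> \<exists>C. (\<forall>(m, k)\<in>C. N \<le> m) \<and> E \<subseteq> (\<Union>(m, k)\<in>C. dyadic_cube m k) \<and>
        emeasure (node_measure s) C < ennreal e"
  shows "hausdorff_measure s E = 0"
proof -
  define c where "c = real CARD('n) powr s"
  have c: "0 < c"
    by (simp add: c_def)
  have diam: "diam_pow s (dyadic_cube m k :: (real ^ 'n) set) \<le> ennreal c * ennreal (2 powr - (real m * s))" for m k
  proof -
    have "(real CARD('n) / 2 ^ m) powr s = c / (2 ^ m) powr s"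
      by (simp add: c_def powr_divide)
    also have "(2 ^ m :: real) powr s = 2 powr (real m * s)"
      by (simp add: powr_realpow[symmetric] powr_powr)
    finally have "(real CARD('n) / 2 ^ m) powr s = c * 2 powr - (real m * s)"
      by (simp add: powr_minus divide_inverse)
    moreover have "diam_pow s (dyadic_cube m k :: (real ^ 'n) set) \<le> ennreal ((real CARD('n) / 2 ^ m) powr s)"
      using s dyadic_cube_diameter[of m k]
      by (auto simp: diam_pow_def diameter_ge_0 intro!: ennreal_leI powr_mono2)
    ultimately show ?thesis
      using c by (simp add: ennreal_mult')
  qed
  have "hausdorff_premeasure s d E = 0" if d: "0 < d" for d
  proof -
    have "hausdorff_premeasure s d E \<le> 0 + ennreal e" if e: "0 < e" for e
    proof -
      obtain N where N: "real CARD('n) / d < 2 ^ N"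
        using real_arch_pow[of 2 "real CARD('n) / d"] by auto
      obtain C where C: "\<And>m k. (m, k) \<in> C \<Longrightarrow> N \<le> m" "E \<subseteq> (\<Union>(m, k)\<in>C. dyadic_cube m k)"
          "emeasure (node_measure s) C < ennreal (e / c)"
        using cov[of "e / c" N] e c by fastforce
      define U where "U i = (if i \<in> to_nat ` C then case from_nat i of (m, k :: 'n \<Rightarrow> int) \<Rightarrow> dyadic_cube m k else {})" for i
      have "bounded (U i) \<and> diameter (U i) \<le> d" for i
      proof (cases "i \<in> to_nat ` C")
        case True
        then obtain m k where mk: "(m, k) \<in> C" "i = to_nat (m, k)"
          by auto
        have "real CARD('n) / 2 ^ m \<le> real CARD('n) / 2 ^ N"
          using C(1)[OF mk(1)] by (intro divide_left_mono) auto
        also have "\<dots> \<le> d"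
          using N d by (simp add: field_simps)
        finally show ?thesis
          using mk True dyadic_cube_diameter[of m k] by (simp add: U_def)
      qed (use d in \<open>simp add: U_def\<close>)
      moreover have "E \<subseteq> (\<Union>i. U i)"
      proof
        fix x assume "x \<in> E"
        then obtain m k where "(m, k) \<in> C" "x \<in> dyadic_cube m k"
          using C(2) by auto
        then have "x \<in> U (to_nat (m, k))"
          by (simp add: U_def)
        then show "x \<in> (\<Union>i. U i)"
          by blast
      qed
      ultimately have "hausdorff_premeasure s d E \<le> (\<Sum>i. diam_pow s (U i))"
        unfolding hausdorff_premeasure_def by (intro INF_lower) auto
      also have "\<dots> = (\<integral>\<^sup>+ i. diam_pow s (U i) \<partial>count_space UNIV)"
        by (rule nn_integral_count_space_nat[symmetric])
      also have "\<dots> \<le> (\<integral>\<^sup>+ i. (case from_nat i of (m, k :: 'n \<Rightarrow> int) \<Rightarrow> ennreal c * ennreal (2 powr - (real m * s))) * indicator (to_nat ` C) i \<partial>count_space UNIV)"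
        using diam by (intro nn_integral_mono) (auto simp: U_def diam_pow_empty split: prod.split)
      also have "\<dots> = (\<integral>\<^sup>+ i. (case from_nat i of (m, k :: 'n \<Rightarrow> int) \<Rightarrow> ennreal c * ennreal (2 powr - (real m * s))) \<partial>count_space (to_nat ` C))"
        by (rule nn_integral_count_space_indicator[symmetric]) simp
      also have "\<dots> = (\<integral>\<^sup>+ q. (case from_nat (to_nat q) of (m, k :: 'n \<Rightarrow> int) \<Rightarrow> ennreal c * ennreal (2 powr - (real m * s))) \<partial>count_space C)"
        by (rule nn_integral_bij_count_space[symmetric]) (simp add: bij_betw_def inj_on_def)
      also have "\<dots> = ennreal c * (\<integral>\<^sup>+ q. (case q of (m, k) \<Rightarrow> ennreal (2 powr - (real m * s))) \<partial>count_space C)"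
        by (subst nn_integral_cmult[symmetric]) (auto simp: split_beta)
      also have "(\<integral>\<^sup>+ q. (case q of (m, k) \<Rightarrow> ennreal (2 powr - (real m * s))) \<partial>count_space C) = emeasure (node_measure s) C"
        by (simp add: node_measure_def point_measure_def emeasure_density nn_integral_count_space_indicator)
      also have "ennreal c * emeasure (node_measure s) C \<le> ennreal c * ennreal (e / c)"
        using C by (intro mult_left_mono) auto
      also have "\<dots> = ennreal e"
        using c e by (simp add: ennreal_mult'[symmetric])
      finally show ?thesis
        by simp
    qed
    then show ?thesis
      by (meson ennreal_le_epsilon le_zero_eq)
  qed
  then show ?thesis
    unfolding hausdorff_measure_def by (intro antisym SUP_least) auto
qed

text \<open>Since \<open>s > 0\<close>, a single cell of order below \<open>N\<close> weighs at
  least \<open>2 powr - (N * s)\<close>. A cover of smaller weight thus uses only orders at least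
  \<open>N\<close>, so zero content already provides covers of arbitrarily fine mesh.\<close>

lemma net_content_pos:
  fixes E :: "(real ^ 'n) set"
  assumes s: "0 < s" and E: "E \<subseteq> cbox 0 1" and ne: "hausdorff_measure s E \<noteq> 0"
  shows "0 < net_content s E"
proof (rule ccontr)
  assume "\<not> 0 < net_content s E"
  then have z: "net_content s E = 0"
    by simp
  have "hausdorff_measure s E = 0"
  proof (rule hausdorff_measure_eq_0I)
    fix N :: nat and e :: real
    assume e: "0 < e"
    define e' where "e' = min e (2 powr - (real N * s))"
    have "net_content s E < ennreal e'"
      using e by (simp add: z e'_def)
    then obtain C where C: "covers C E" "emeasure (node_measure s) C < ennreal e'"
      by (rule net_content_lessD)
    have "N \<le> m" if "(m, k) \<in> C" for m k
    proof (rule ccontr)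
      assume "\<not> N \<le> m"
      then have "2 powr - (real N * s) \<le> 2 powr - (real m * s)"
        using s by (intro powr_mono) (auto intro!: mult_right_mono)
      then have "ennreal e' \<le> ennreal (2 powr - (real m * s))"
        unfolding e'_def by (intro ennreal_leI min.coboundedI2)
      also have "\<dots> = emeasure (node_measure s) {(m, k)}"
        by (simp add: emeasure_node_measure_singleton)
      also have "\<dots> \<le> emeasure (node_measure s) C"
        using that by (intro emeasure_node_measure_mono) auto
      finally show False
        using C(2) by simp
    qed
    moreover have "E \<subseteq> (\<Union>(m, k)\<in>C. dyadic_cube m k)"
    proof
      fix x assume x: "x \<in> E"
      then obtain m where "(m, cube_index m x) \<in> C"
        using C(1) unfolding covers_def by blast
      moreover have "x \<in> dyadic_cube m (cube_index m x)"
        using x E by (intro in_dyadic_cube_cube_index) auto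
      ultimately show "x \<in> (\<Union>(m, k)\<in>C. dyadic_cube m k)"
        by blast
    qed
    moreover have "emeasure (node_measure s) C < ennreal e"
      using C(2) by (rule order_less_le_trans) (auto simp: e'_def intro: ennreal_leI)
    ultimately show "\<exists>C. (\<forall>(m, k)\<in>C. N \<le> m) \<and> E \<subseteq> (\<Union>(m, k)\<in>C. dyadic_cube m k) \<and>
        emeasure (node_measure s) C < ennreal e"
      by blast
  qed (use s in auto)
  with ne show False
    by simp
qed

section \<open>Mass distributions on the tree of cells\<close>

definition children :: "nat \<Rightarrow> ('n::finite \<Rightarrow> int) \<Rightarrow> ('n \<Rightarrow> int) set" where
  "children m k = {j \<in> index_set (Suc m). ancestor 1 j = k}"

definition mass_distribution :: "(nat \<Rightarrow> ('n::finite \<Rightarrow> int) \<Rightarrow> real) \<Rightarrow> bool" where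
  "mass_distribution \<mu> \<longleftrightarrow> (\<forall>m k. 0 \<le> \<mu> m k) \<and>
     (\<forall>m. \<forall>k\<in>index_set m. \<mu> m k = sum (\<mu> (Suc m)) (children m k))"

text \<open>The substitute for being concentrated on \<open>X\<close>. It suffices because masses
  are only ever compared with finite covers of \<open>X\<close> by cells.\<close>

definition carried_by :: "(nat \<Rightarrow> ('n::finite \<Rightarrow> int) \<Rightarrow> real) \<Rightarrow> (real ^ 'n) set \<Rightarrow> bool" where
  "carried_by \<mu> X \<longleftrightarrow> (\<forall>m. \<forall>k\<in>index_set m. 0 < \<mu> m k \<longrightarrow> (\<exists>x\<in>X. cube_index m x = k))"

text \<open>For \<open>t > 0\<close> this is the Riesz energy of order \<open>t\<close> up to
  constants, with distance replaced by the side of the smallest common cell. Being a weighted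
  squared norm over the cells, it also makes sense for differences of mass distributions.\<close>

definition energy :: "real \<Rightarrow> (nat \<Rightarrow> ('n::finite \<Rightarrow> int) \<Rightarrow> real) \<Rightarrow> ennreal" where
  "energy t \<mu> = (\<Sum>m. \<Sum>k\<in>index_set m. ennreal (2 powr (real m * t) * (\<mu> m k)\<^sup>2))"

lemma mass_distribution_nonneg: "mass_distribution \<mu> \<Longrightarrow> 0 \<le> \<mu> m k"
  by (simp add: mass_distribution_def)

lemma mass_distribution_children:
  "mass_distribution \<mu> \<Longrightarrow> k \<in> index_set m \<Longrightarrow> \<mu> m k = sum (\<mu> (Suc m)) (children m k)"
  by (simp add: mass_distribution_def)

lemma mass_distribution_descendants:
  assumes \<mu>: "mass_distribution \<mu>" and "m \<le> l" and k: "k \<in> index_set m"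
  shows "\<mu> m k = sum (\<mu> l) {j \<in> index_set l. ancestor (l - m) j = k}"
  using \<open>m \<le> l\<close>
proof (induction l rule: dec_induct)
  case base
  have "{j \<in> index_set m. ancestor (m - m) j = k} = {k}"
    using k by auto
  then show ?case
    by (simp del: diff_self_eq_0)
next
  case (step l)
  let ?A = "{j \<in> index_set l. ancestor (l - m) j = k}"
  let ?B = "{j \<in> index_set (Suc l). ancestor (Suc l - m) j = k}"
  have anc: "ancestor (l - m) (ancestor 1 j) = ancestor (Suc l - m) j" for j :: "'a \<Rightarrow> int"
    using step by (simp add: ancestor_ancestor Suc_diff_le)
  have sub: "ancestor 1 ` ?B \<subseteq> ?A"
    using anc ancestor_in_index_set[of _ l 1] by auto
  have "sum (\<mu> l) ?A = (\<Sum>i\<in>?A. sum (\<mu> (Suc l)) (children l i))"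
    using \<mu> by (intro sum.cong) (auto simp: mass_distribution_children)
  also have "\<dots> = (\<Sum>i\<in>?A. sum (\<mu> (Suc l)) {j \<in> ?B. ancestor 1 j = i})"
    using anc by (intro sum.cong arg_cong2[where f = sum]) (auto simp: children_def)
  also have "\<dots> = sum (\<mu> (Suc l)) ?B"
    using sub by (intro sum.group) auto
  finally show ?case
    using step by simp
qed

lemma total_mass:
  assumes \<mu>: "mass_distribution \<mu>"
  shows "sum (\<mu> l) (index_set l) = \<mu> 0 (\<lambda>_. 0)"
proof -
  have "\<mu> 0 (\<lambda>_. 0) = sum (\<mu> l) {j \<in> index_set l. ancestor (l - 0) j = (\<lambda>_. 0)}"
    by (rule mass_distribution_descendants[OF \<mu>]) (auto simp: index_set_0)
  also have "{j \<in> index_set l. ancestor (l - 0) j = (\<lambda>_. 0)} = index_set l"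
    using ancestor_in_index_set[of _ 0 l] by (auto simp: index_set_0)
  finally show ?thesis
    by simp
qed

text \<open>All masses are compared at the finest order \<open>L\<close> occurring in the cover: a
  cell of order \<open>L\<close> with positive mass contains a point of \<open>X\<close>, and the
  cell of \<open>F\<close> that covers this point is an ancestor of it.\<close>

lemma mass_le_cover:
  fixes X :: "(real ^ 'n) set"
  assumes \<mu>: "mass_distribution \<mu>" "carried_by \<mu> X" and F: "finite F" "covers F X"
    and X: "X \<subseteq> cbox 0 1"
  shows "\<mu> 0 (\<lambda>_. 0) \<le> (\<Sum>(m, k)\<in>{(m, k) \<in> F. k \<in> index_set m}. \<mu> m k)"
proof -
  let ?F = "{(m, k) \<in> F. k \<in> index_set m}"
  have fin: "finite ?F"
    using F(1) by (rule finite_subset[rotated]) auto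
  define L where "L = Max (insert 0 (fst ` F))"
  have L: "m \<le> L" if "(m, k) \<in> F" for m k
    using that F(1) unfolding L_def by (intro Max_ge) (auto intro: rev_image_eqI)
  have "\<mu> 0 (\<lambda>_. 0) = (\<Sum>j\<in>index_set L. \<mu> L j)"
    by (rule total_mass[OF \<mu>(1), symmetric])
  also have "\<dots> \<le> (\<Sum>j\<in>index_set L. \<Sum>(m, k)\<in>?F. if ancestor (L - m) j = k then \<mu> L j else 0)"
  proof (rule sum_mono)
    fix j :: "'n \<Rightarrow> int"
    assume j: "j \<in> index_set L"
    have nn: "0 \<le> (case q of (m, k) \<Rightarrow> if ancestor (L - m) j = k then \<mu> L j else 0)" for q :: "nat \<times> ('n \<Rightarrow> int)"
      by (simp add: mass_distribution_nonneg[OF \<mu>(1)] split: prod.split)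
    show "\<mu> L j \<le> (\<Sum>(m, k)\<in>?F. if ancestor (L - m) j = k then \<mu> L j else 0)"
    proof (cases "0 < \<mu> L j")
      case True
      then obtain x where x: "x \<in> X" "cube_index L x = j"
        using \<mu>(2) j by (auto simp: carried_by_def)
      then obtain m where m: "(m, cube_index m x) \<in> F"
        using F(2) unfolding covers_def by blast
      then have "(m, cube_index m x) \<in> ?F"
        using x X cube_index_in_index_set by auto
      then have "(case (m, cube_index m x) of (m, k) \<Rightarrow> if ancestor (L - m) j = k then \<mu> L j else 0)
          \<le> (\<Sum>(m, k)\<in>?F. if ancestor (L - m) j = k then \<mu> L j else 0)"
        using fin nn by (intro member_le_sum) auto
      then show ?thesis
        using L[OF m] by (simp add: ancestor_cube_index' x(2)[symmetric])
    next
      case False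
      then have "\<mu> L j \<le> 0"
        by simp
      also have "0 \<le> (\<Sum>(m, k)\<in>?F. if ancestor (L - m) j = k then \<mu> L j else 0)"
        by (rule sum_nonneg) (rule nn)
      finally show ?thesis .
    qed
  qed
  also have "\<dots> = (\<Sum>(m, k)\<in>?F. \<Sum>j\<in>index_set L. if ancestor (L - m) j = k then \<mu> L j else 0)"
    by (subst sum.swap) (simp add: split_beta)
  also have "\<dots> = (\<Sum>(m, k)\<in>?F. \<mu> m k)"
  proof (intro sum.cong refl, safe)
    fix m k assume mk: "(m, k) \<in> F" "k \<in> index_set m"
    then have "\<mu> m k = sum (\<mu> L) {j \<in> index_set L. ancestor (L - m) j = k}"
      using L \<mu>(1) by (intro mass_distribution_descendants) auto
    also have "\<dots> = (\<Sum>j\<in>index_set L. if ancestor (L - m) j = k then \<mu> L j else 0)"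
      by (rule sum.inter_filter) simp
    finally show "(\<Sum>j\<in>index_set L. if ancestor (L - m) j = k then \<mu> L j else 0) = \<mu> m k"
      by simp
  qed
  finally show ?thesis .
qed

lemma sum_le_energy:
  assumes F: "finite F" "F \<subseteq> {(m, k). k \<in> index_set m}"
  shows "(\<Sum>(m, k)\<in>F. ennreal (2 powr (real m * t) * (\<mu> m k)\<^sup>2)) \<le> energy t \<mu>"
proof -
  define N where "N = Suc (Max (insert 0 (fst ` F)))"
  have N: "m < N" if "(m, k) \<in> F" for m k
    using that F(1) unfolding N_def less_Suc_eq_le by (intro Max_ge) (auto intro: rev_image_eqI)
  have "(\<Sum>(m, k)\<in>F. ennreal (2 powr (real m * t) * (\<mu> m k)\<^sup>2))
      \<le> (\<Sum>(m, k)\<in>Sigma {..<N} index_set. ennreal (2 powr (real m * t) * (\<mu> m k)\<^sup>2))"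
    using F N by (intro sum_mono2) auto
  also have "\<dots> = (\<Sum>m<N. \<Sum>k\<in>index_set m. ennreal (2 powr (real m * t) * (\<mu> m k)\<^sup>2))"
    by (rule sum.Sigma[symmetric]) auto
  also have "\<dots> \<le> energy t \<mu>"
    unfolding energy_def by (rule sum_le_suminf) auto
  finally show ?thesis .
qed

text \<open>The slack \<open>e\<close> pays for sets of diameter 0, whose weight may vanish although
  any neighbourhood has positive cost; this cost becomes small because \<open>t > 0\<close>.
  Otherwise an open cube of side comparable to the diameter is used, and a diameter of at most 1
  permits replacing the exponent \<open>t\<close> by the smaller \<open>r\<close>.\<close>

lemma open_neighbourhood_cover:
  fixes U :: "(real ^ 'n) set"
  assumes U: "bounded U" "diameter U \<le> 1" and rt: "0 \<le> r" "r \<le> t" "0 < t" and e: "0 < e"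
  obtains V F where "open V" "U \<subseteq> V" "finite F" "covers F (cbox 0 1 \<inter> V)"
    "emeasure (node_measure t) F \<le> ennreal (9 ^ CARD('n)) * diam_pow r U + ennreal e"
proof (cases "U = {}")
  case True
  then show ?thesis
    by (intro that[of "{}" "{}"]) (auto simp: covers_def)
next
  case False
  then obtain x where x: "x \<in> U"
    by auto
  define D where "D = diameter U"
  have D: "0 \<le> D" "D \<le> 1"
    using U by (auto simp: D_def diameter_ge_0)
  have "\<exists>m. D < 2 / 2 ^ m \<and>
      ennreal (9 ^ CARD('n) * 2 powr - (real m * t)) \<le> ennreal (9 ^ CARD('n)) * diam_pow r U + ennreal e"
  proof (cases "D = 0")
    case True
    have "2 powr - t < 1"
      using rt by (simp add: powr_less_one)
    then obtain m where m: "(2 powr - t) ^ m < e / 9 ^ CARD('n)"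
      using real_arch_pow_inv[of "e / 9 ^ CARD('n)" "2 powr - t"] e by auto
    have "2 powr - (real m * t) = (2 powr - t) ^ m"
      by (simp add: powr_realpow[symmetric] powr_powr mult.commute)
    with m have "9 ^ CARD('n) * 2 powr - (real m * t) \<le> e"
      by (simp add: field_simps)
    then have "ennreal (9 ^ CARD('n) * 2 powr - (real m * t)) \<le> 0 + ennreal e"
      by (simp add: ennreal_leI)
    also have "\<dots> \<le> ennreal (9 ^ CARD('n)) * diam_pow r U + ennreal e"
      by (intro add_right_mono) simp
    finally show ?thesis
      using True by (intro exI[of _ m]) simp
  next
    case False
    obtain N where "2 / D < 2 ^ N"
      using real_arch_pow[of 2 "2 / D"] by auto
    then have "2 / 2 ^ N \<le> D"
      using D False by (simp add: field_simps)
    \<comment> \<open>\<open>D \<le> 1\<close> excludes \<open>n = 0\<close>; the predecessor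
      \<open>m\<close> of the least such \<open>n\<close> then satisfies
      \<open>1 / 2 ^ m \<le> D < 2 / 2 ^ m\<close>.\<close>
    define n where "n = (LEAST n. 2 / 2 ^ n \<le> D)"
    have n: "2 / 2 ^ n \<le> D"
      unfolding n_def using \<open>2 / 2 ^ N \<le> D\<close> by (rule LeastI)
    moreover have "n \<noteq> 0"
      using n D by (cases n) auto
    then obtain m where m: "n = Suc m"
      using not0_implies_Suc by blast
    moreover have "\<not> 2 / 2 ^ m \<le> D"
      using not_less_Least[of m "\<lambda>n. 2 / 2 ^ n \<le> D"] m by (simp add: n_def)
    ultimately have mD: "1 / 2 ^ m \<le> D" "D < 2 / 2 ^ m"
      by auto
    have "(2 ^ m :: real) powr t = 2 powr (real m * t)"
      by (simp add: powr_realpow[symmetric] powr_powr)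
    then have "2 powr - (real m * t) = (1 / 2 ^ m) powr t"
      by (simp add: powr_divide powr_minus_divide)
    also have "\<dots> \<le> D powr t"
      using mD rt by (intro powr_mono2) auto
    also have "\<dots> \<le> D powr r"
      using D rt by (intro powr_mono') auto
    finally have "ennreal (2 powr - (real m * t)) \<le> ennreal (D powr r)"
      by (rule ennreal_leI)
    also have "ennreal (D powr r) \<le> diam_pow r U"
      using \<open>U \<noteq> {}\<close> False by (auto simp: diam_pow_def D_def)
    finally have "ennreal (9 ^ CARD('n)) * ennreal (2 powr - (real m * t)) \<le> ennreal (9 ^ CARD('n)) * diam_pow r U"
      by (intro mult_left_mono) auto
    then have "ennreal (9 ^ CARD('n)) * ennreal (2 powr - (real m * t)) \<le> ennreal (9 ^ CARD('n)) * diam_pow r U + ennreal e"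
      by (rule order_trans) simp
    with mD(2) show ?thesis
      by (intro exI[of _ m]) (simp add: ennreal_mult)
  qed
  then obtain m where m: "D < 2 / 2 ^ m"
    "ennreal (9 ^ CARD('n) * 2 powr - (real m * t)) \<le> ennreal (9 ^ CARD('n)) * diam_pow r U + ennreal e"
    by blast
  have "U \<subseteq> open_cube m x"
  proof
    fix y assume y: "y \<in> U"
    have "\<bar>y $ i - x $ i\<bar> < 2 / 2 ^ m" for i
    proof -
      have "\<bar>(y - x) $ i\<bar> \<le> dist y x"
        unfolding dist_norm by (rule component_le_norm_cart)
      also have "\<dots> \<le> D"
        unfolding D_def by (rule diameter_bounded_bound[OF U(1) y x])
      finally show ?thesis
        using m(1) by simp
    qed
    then show "y \<in> open_cube m x"
      by (simp add: open_cube_def)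
  qed
  moreover obtain F where F: "finite F" "covers F (cbox 0 1 \<inter> open_cube m x)"
    "emeasure (node_measure t) F \<le> ennreal (9 ^ CARD('n) * 2 powr - (real m * t))"
    by (rule open_cube_cover)
  ultimately show ?thesis
    using that[OF open_open_cube _ F(1,2) order_trans[OF F(3) m(2)]] by blast
qed

text \<open>This is \<open>(u * v - l)\<^sup>2 \<ge> 0\<close> divided by \<open>2 * l * u\<close>.
  With \<open>v\<close> the mass of a cell and \<open>u = 2 powr (m * t)\<close>, the free parameter
  \<open>l\<close> balances the weight of a cover against the energy.\<close>

lemma weighted_am_gm:
  fixes u v l :: real
  assumes "0 < u" "0 < l"
  shows "v \<le> l / 2 * (1 / u) + 1 / (2 * l) * (u * v\<^sup>2)"
proof -
  have "v * (2 * l * u) \<le> l\<^sup>2 + u\<^sup>2 * v\<^sup>2"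
    using zero_le_power2[of "u * v - l"] by (simp add: power2_eq_square algebra_simps)
  also have "\<dots> = (l / 2 * (1 / u) + 1 / (2 * l) * (u * v\<^sup>2)) * (2 * l * u)"
    using assms by (simp add: distrib_right power2_eq_square)
  finally show ?thesis
    using assms by (simp only: mult_le_cancel_right_pos mult_pos_pos zero_less_numeral)
qed

text \<open>The mass distribution principle along a decreasing sequence of compact sets: no limit of the
  mass distributions is needed, since a cover of the intersection already covers some \<open>X k\<close>, where
  AM-GM bounds the mass by the weight of the cover and the energy.\<close>

lemma hausdorff_measure_Inter_nonzero:
  fixes X :: "nat \<Rightarrow> (real ^ 'n) set"
  assumes X: "\<And>k. compact (X k)" "\<And>k. X (Suc k) \<subseteq> X k" "\<And>k. X k \<subseteq> cbox 0 1"
    and \<mu>: "\<And>k. mass_distribution (\<mu> k)" "\<And>k. carried_by (\<mu> k) (X k)"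
    and bounds: "\<And>k. a < \<mu> k 0 (\<lambda>_. 0)" "\<And>k. energy t (\<mu> k) < ennreal b"
    and a: "0 < a" and rt: "0 \<le> r" "r \<le> t" "0 < t"
    and E: "(\<Inter>k. X k) \<subseteq> E"
  shows "hausdorff_measure r E \<noteq> 0"
proof
  assume zero: "hausdorff_measure r E = 0"
  have b: "0 < b"
  proof (rule ccontr)
    assume "\<not> 0 < b"
    then show False
      using bounds(2)[of 0] by (simp add: ennreal_neg)
  qed
  define c :: real where "c = 9 ^ CARD('n)"
  \<comment> \<open>With weight at most \<open>(c + 1) * p\<close> and energy at most
    \<open>b\<close>, these choices make each of the two AM-GM terms equal to \<open>a / 2\<close>,
    in conflict with a mass strictly above \<open>a\<close>.\<close>
  define l where "l = b / a"
  define p where "p = a / (l * (c + 1))"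
  have c: "0 < c" and l: "0 < l"
    using a b by (auto simp: c_def l_def)
  have p: "0 < p"
    using a c l by (simp add: p_def)
  have "hausdorff_premeasure r 1 E \<le> hausdorff_measure r E"
    unfolding hausdorff_measure_def by (rule SUP_upper) simp
  with zero p have "hausdorff_premeasure r 1 E < ennreal p"
    by simp
  then obtain U :: "nat \<Rightarrow> (real ^ 'n) set" where U: "\<And>i. bounded (U i)" "\<And>i. diameter (U i) \<le> 1" "E \<subseteq> (\<Union>i. U i)"
      "(\<Sum>i. diam_pow r (U i)) < ennreal p"
    unfolding hausdorff_premeasure_def INF_less_iff by auto
  have "\<exists>V F. open V \<and> U i \<subseteq> V \<and> finite F \<and> covers F (cbox 0 1 \<inter> V) \<and>
      emeasure (node_measure t) F \<le> ennreal c * diam_pow r (U i) + ennreal (p / 2 ^ Suc i)" for i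
    by (rule open_neighbourhood_cover[OF U(1,2) rt, of "p / 2 ^ Suc i" i]) (use p in \<open>auto simp: c_def\<close>)
  then obtain V F where VF: "\<And>i. open (V i)" "\<And>i. U i \<subseteq> V i" "\<And>i. finite (F i)"
      "\<And>i. covers (F i) (cbox 0 1 \<inter> V i)"
      "\<And>i. emeasure (node_measure t) (F i) \<le> ennreal c * diam_pow r (U i) + ennreal (p / 2 ^ Suc i)"
    by metis
  have "\<exists>k. X k \<subseteq> (\<Union>i. V i)"
  proof (rule ccontr)
    assume "\<not> ?thesis"
    then have ne: "X k - (\<Union>i. V i) \<noteq> {}" for k
      by auto
    have "compact (X k - (\<Union>i. V i))" for k
      using X(1) VF(1) by (intro compact_diff open_UN) auto
    moreover note ne
    moreover have "X n - (\<Union>i. V i) \<subseteq> X m - (\<Union>i. V i)" if "m \<le> n" for m n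
      using lift_Suc_antimono_le[of X, OF X(2) that] by auto
    ultimately have "(\<Inter>k. X k - (\<Union>i. V i)) \<noteq> {}"
      by (rule compact_nest)
    moreover have "(\<Inter>k. X k) \<subseteq> (\<Union>i. V i)"
    proof -
      have "(\<Union>i. U i) \<subseteq> (\<Union>i. V i)"
        using VF(2) by (intro UN_mono) auto
      with E U(3) show ?thesis
        by (meson order_trans)
    qed
    ultimately show False
      by blast
  qed
  then obtain k where k: "X k \<subseteq> (\<Union>i. V i)"
    by blast
  with X(1)[of k] VF(1) obtain I where I: "finite I" "X k \<subseteq> (\<Union>i\<in>I. V i)"
    by (metis (no_types, lifting) compactE_image)
  define H where "H = (\<Union>i\<in>I. F i)"
  have fH: "finite H"
    using I VF(3) by (auto simp: H_def)
  have "covers H (X k)"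
    unfolding covers_def
  proof
    fix x assume x: "x \<in> X k"
    then obtain i where i: "i \<in> I" "x \<in> V i"
      using I(2) by blast
    then have "x \<in> cbox 0 1 \<inter> V i"
      using x X(3)[of k] by blast
    then obtain m where "(m, cube_index m x) \<in> F i"
      using VF(4)[of i] unfolding covers_def by blast
    then show "\<exists>m. (m, cube_index m x) \<in> H"
      using i(1) by (auto simp: H_def)
  qed
  \<comment> \<open>Covers may contain nodes outside the unit cube, which the energy does not count;
    they are discarded.\<close>
  define H' where "H' = {(m, k) \<in> H. k \<in> index_set m}"
  have H': "finite H'" "H' \<subseteq> H"
    using fH by (auto simp: H'_def intro: finite_subset[of _ H])
  have "(\<Sum>(m, k)\<in>H'. ennreal (2 powr - (real m * t))) = emeasure (node_measure t) H'"
    using H' by (simp add: emeasure_node_measure_finite)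
  also have "\<dots> \<le> emeasure (node_measure t) H"
    using H' by (intro emeasure_node_measure_mono)
  also have "\<dots> \<le> (\<Sum>i\<in>I. emeasure (node_measure t) (F i))"
    unfolding H_def using I by (intro emeasure_subadditive_finite) auto
  also have "\<dots> \<le> (\<Sum>i\<in>I. ennreal c * diam_pow r (U i) + ennreal (p / 2 ^ Suc i))"
    by (intro sum_mono VF)
  also have "\<dots> \<le> (\<Sum>i. ennreal c * diam_pow r (U i) + ennreal (p / 2 ^ Suc i))"
    using I by (intro sum_le_suminf) auto
  also have "\<dots> = ennreal c * (\<Sum>i. diam_pow r (U i)) + (\<Sum>i. ennreal (p / 2 ^ Suc i))"
    by (subst suminf_add[symmetric]) auto
  also have "(\<Sum>i. ennreal (p / 2 ^ Suc i)) = ennreal p"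
  proof -
    have "(\<lambda>i. p * (1 / 2) ^ Suc i) sums (p * 1)"
      by (intro sums_mult power_half_series)
    then show ?thesis
      using p by (intro sums_unique[symmetric]) (simp add: sums_ennreal power_divide)
  qed
  also have "ennreal c * (\<Sum>i. diam_pow r (U i)) + ennreal p \<le> ennreal c * ennreal p + ennreal p"
    using U(4) by (intro add_right_mono mult_left_mono) auto
  also have "\<dots> = ennreal ((c + 1) * p)"
    using c p by (simp add: ennreal_mult'[symmetric] ennreal_plus[symmetric] algebra_simps del: ennreal_plus)
  finally have "ennreal (\<Sum>(m, k)\<in>H'. 2 powr - (real m * t)) \<le> ennreal ((c + 1) * p)"
    by (subst sum_ennreal[symmetric]) (auto simp: split_beta)
  then have weight: "(\<Sum>(m, k)\<in>H'. 2 powr - (real m * t)) \<le> (c + 1) * p"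
    using c p by (subst (asm) ennreal_le_iff) auto
  have "ennreal (\<Sum>(m, j)\<in>H'. 2 powr (real m * t) * (\<mu> k m j)\<^sup>2)
      = (\<Sum>(m, j)\<in>H'. ennreal (2 powr (real m * t) * (\<mu> k m j)\<^sup>2))"
    by (subst sum_ennreal[symmetric]) (auto simp: split_beta)
  also have "\<dots> \<le> energy t (\<mu> k)"
    using H' by (intro sum_le_energy) (auto simp: H'_def)
  also have "\<dots> \<le> ennreal b"
    using bounds(2)[of k] by simp
  finally have en: "(\<Sum>(m, j)\<in>H'. 2 powr (real m * t) * (\<mu> k m j)\<^sup>2) \<le> b"
    using b by (subst (asm) ennreal_le_iff) auto
  have amgm: "\<mu> k m j \<le> l / 2 * 2 powr - (real m * t) + 1 / (2 * l) * (2 powr (real m * t) * (\<mu> k m j)\<^sup>2)" for m j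
  proof -
    have "\<mu> k m j \<le> l / 2 * (1 / 2 powr (real m * t)) + 1 / (2 * l) * (2 powr (real m * t) * (\<mu> k m j)\<^sup>2)"
      by (rule weighted_am_gm) (use l in auto)
    then show ?thesis
      by (simp only: powr_minus_divide)
  qed
  have "a < \<mu> k 0 (\<lambda>_. 0)"
    by (rule bounds)
  also have "\<dots> \<le> (\<Sum>(m, j)\<in>H'. \<mu> k m j)"
    unfolding H'_def by (rule mass_le_cover[OF \<mu> fH \<open>covers H (X k)\<close> X(3)])
  also have "\<dots> \<le> (\<Sum>(m, j)\<in>H'. l / 2 * 2 powr - (real m * t) + 1 / (2 * l) * (2 powr (real m * t) * (\<mu> k m j)\<^sup>2))"
    using amgm by (intro sum_mono) (simp add: split_beta)
  also have "\<dots> = l / 2 * (\<Sum>(m, j)\<in>H'. 2 powr - (real m * t)) + 1 / (2 * l) * (\<Sum>(m, j)\<in>H'. 2 powr (real m * t) * (\<mu> k m j)\<^sup>2)"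
    by (simp add: split_beta sum.distrib sum_distrib_left)
  also have "\<dots> \<le> l / 2 * ((c + 1) * p) + 1 / (2 * l) * b"
    using l weight en by (intro add_mono mult_left_mono) auto
  also have "\<dots> = a"
    using a b c l by (simp add: p_def) (simp add: l_def field_simps)
  finally show False
    by simp
qed

section \<open>Frostman distributions and reweighting\<close>

primrec flow :: "(nat \<Rightarrow> ('n::finite \<Rightarrow> int) \<Rightarrow> real) \<Rightarrow> nat \<Rightarrow> ('n \<Rightarrow> int) \<Rightarrow> real" where
  "flow f 0 = f 0"
| "flow f (Suc m) = (\<lambda>k. flow f m (ancestor 1 k) * f (Suc m) k / sum (f (Suc m)) (children m (ancestor 1 k)))"

lemma finite_children [simp]: "finite (children m k)"
  by (simp add: children_def)

text \<open>Splitting the mass of a cell among its children proportionally to a subadditive capacity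
  never exceeds the capacity of a cell; this replaces the usual weak limit in Frostman's lemma.\<close>

lemma flow_mass_distribution:
  assumes nonneg: "\<And>m k. 0 \<le> f m k" and zero: "\<And>m k. k \<notin> index_set m \<Longrightarrow> f m k = 0"
    and sub: "\<And>m k. k \<in> index_set m \<Longrightarrow> f m k \<le> sum (f (Suc m)) (children m k)"
  shows "mass_distribution (flow f)" and "flow f m k \<le> f m k"
proof -
  have *: "0 \<le> flow f m k \<and> flow f m k \<le> f m k" for m k
  proof (induction m arbitrary: k)
    case 0
    then show ?case
      using nonneg by simp
  next
    case (Suc m)
    let ?s = "sum (f (Suc m)) (children m (ancestor 1 k))"
    have s: "0 \<le> ?s"
      using nonneg by (intro sum_nonneg) auto
    show ?case
    proof (cases "k \<in> index_set (Suc m)")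
      case True
      then have "ancestor 1 k \<in> index_set m"
        by (intro ancestor_in_index_set) simp
      then have "flow f m (ancestor 1 k) \<le> ?s"
        using Suc sub order_trans by blast
      then have "flow f m (ancestor 1 k) / ?s \<le> 1"
        using s by (cases "?s = 0") auto
      then have "flow f m (ancestor 1 k) / ?s * f (Suc m) k \<le> 1 * f (Suc m) k"
        by (rule mult_right_mono) (rule nonneg)
      then show ?thesis
        using Suc nonneg s by simp
    next
      case False
      then show ?thesis
        using zero by simp
    qed
  qed
  then show "flow f m k \<le> f m k"
    by blast
  show "mass_distribution (flow f)"
    unfolding mass_distribution_def
  proof (intro conjI allI ballI)
    show "0 \<le> flow f m k" for m k
      using * by blast
    fix m :: nat and k :: "'a \<Rightarrow> int"
    assume k: "k \<in> index_set m"
    let ?s = "sum (f (Suc m)) (children m k)"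
    have "sum (flow f (Suc m)) (children m k) = (\<Sum>j\<in>children m k. flow f m k / ?s * f (Suc m) j)"
      by (intro sum.cong) (auto simp: children_def)
    also have "\<dots> = flow f m k / ?s * ?s"
      by (rule sum_distrib_left[symmetric])
    also have "\<dots> = flow f m k"
    \<comment> \<open>If the children have total capacity 0, subadditivity forces the mass of the
      cell to vanish, so the value 0 of the division is the right one.\<close>
    proof (cases "?s = 0")
      case True
      have "flow f m k \<le> 0"
        using * sub[OF k] True by (metis order_trans)
      then show ?thesis
        using True *[of m k] by simp
    qed simp
    finally show "flow f m k = sum (flow f (Suc m)) (children m k)"
      by simp
  qed
qed

text \<open>The capacity given to \<open>flow\<close> is the content of the part of \<open>K\<close>
  in a cell. It is subadditive since the children partition that part, it is at most the weight of
  the cell since a cell covers itself, and at the root it is the whole content of \<open>K\<close>,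
  which becomes the total mass.\<close>

lemma frostman:
  fixes K :: "(real ^ 'n) set"
  assumes K: "K \<subseteq> cbox 0 1" "0 < net_content s K"
  obtains \<mu> where "mass_distribution \<mu>" "carried_by \<mu> K" "0 < \<mu> 0 (\<lambda>_. 0)"
    "\<And>m k. \<mu> m k \<le> 2 powr - (real m * s)"
proof -
  define f where "f m k = enn2real (net_content s (K \<inter> {x. cube_index m x = k}))" for m k
  have fin: "net_content s (K \<inter> A) < top" for A
  proof -
    have "net_content s (K \<inter> A) \<le> 1"
      using K(1) by (intro net_content_le_1) auto
    then show ?thesis
      by (rule order_le_less_trans) simp
  qed
  have f: "ennreal (f m k) = net_content s (K \<inter> {x. cube_index m x = k})" for m k
    using fin by (simp add: f_def)
  have nonneg: "0 \<le> f m k" for m k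
    by (simp add: f_def)
  have empty: "K \<inter> {x. cube_index m x = k} = {}" if "k \<notin> index_set m" for m k
    using that K(1) cube_index_in_index_set by fastforce
  have sub: "f m k \<le> sum (f (Suc m)) (children m k)" for m k
  proof -
    have "K \<inter> {x. cube_index m x = k} \<subseteq> (\<Union>j\<in>children m k. K \<inter> {x. cube_index (Suc m) x = j})"
    proof
      fix x assume x: "x \<in> K \<inter> {x. cube_index m x = k}"
      then have "cube_index (Suc m) x \<in> index_set (Suc m)"
        using K(1) by (intro cube_index_in_index_set) auto
      moreover have "ancestor 1 (cube_index (Suc m) x) = k"
        using x ancestor_cube_index[of 1 m x] by simp
      ultimately show "x \<in> (\<Union>j\<in>children m k. K \<inter> {x. cube_index (Suc m) x = j})"
        using x by (auto simp: children_def)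
    qed
    then have "net_content s (K \<inter> {x. cube_index m x = k})
        \<le> net_content s (\<Union>j\<in>children m k. K \<inter> {x. cube_index (Suc m) x = j})"
      by (rule net_content_mono)
    also have "\<dots> \<le> (\<Sum>j\<in>children m k. net_content s (K \<inter> {x. cube_index (Suc m) x = j}))"
      by (rule net_content_UN_le) simp
    finally have "ennreal (f m k) \<le> ennreal (sum (f (Suc m)) (children m k))"
      using nonneg by (simp add: f[symmetric] sum_ennreal)
    then show ?thesis
      using nonneg by (subst (asm) ennreal_le_iff) (auto intro: sum_nonneg)
  qed
  have zero: "f m k = 0" if "k \<notin> index_set m" for m k
    using empty[OF that] by (simp add: f_def)
  have le: "flow f m k \<le> f m k" for m k
    by (rule flow_mass_distribution) (use nonneg zero sub in auto)
  have "mass_distribution (flow f)"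
    by (rule flow_mass_distribution) (use nonneg zero sub in auto)
  moreover have "carried_by (flow f) K"
    unfolding carried_by_def
  proof (intro allI ballI impI)
    fix m and k :: "'n \<Rightarrow> int"
    assume "0 < flow f m k"
    with le[of m k] have "f m k \<noteq> 0"
      by linarith
    then have "K \<inter> {x. cube_index m x = k} \<noteq> {}"
      by (auto simp: f_def)
    then show "\<exists>x\<in>K. cube_index m x = k"
      by blast
  qed
  moreover have "0 < flow f 0 (\<lambda>_. 0)"
  proof -
    have "cube_index 0 x = (\<lambda>_. 0)" if "x \<in> K" for x
      using that K(1) cube_index_in_index_set[of x 0] by (auto simp: index_set_0)
    then have "K \<inter> {x. cube_index 0 x = (\<lambda>_. 0)} = K"
      by auto
    then have "ennreal (f 0 (\<lambda>_. 0)) = net_content s K"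
      by (simp add: f)
    with K(2) have "0 < ennreal (f 0 (\<lambda>_. 0))"
      by simp
    then show ?thesis
      by simp
  qed
  moreover have "flow f m k \<le> 2 powr - (real m * s)" for m k
  proof -
    have "ennreal (f m k) \<le> ennreal (2 powr - (real m * s))"
      unfolding f by (rule net_content_cell_le)
    then have "f m k \<le> 2 powr - (real m * s)"
      by (subst (asm) ennreal_le_iff) auto
    with le[of m k] show ?thesis
      by linarith
  qed
  ultimately show ?thesis
    by (rule that)
qed

section \<open>Densities that are constant on the cells of one order\<close>

definition reweight :: "nat \<Rightarrow> (('n::finite \<Rightarrow> int) \<Rightarrow> real) \<Rightarrow> (nat \<Rightarrow> ('n \<Rightarrow> int) \<Rightarrow> real) \<Rightarrow>
    nat \<Rightarrow> ('n \<Rightarrow> int) \<Rightarrow> real" where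
  "reweight n w \<mu> m k = (if n \<le> m then w (ancestor (m - n) k) * \<mu> m k
     else \<Sum>j\<in>{j \<in> index_set n. ancestor (n - m) j = k}. w j * \<mu> n j)"

lemma reweight_coarse:
  assumes "m \<le> n" "k \<in> index_set m"
  shows "reweight n w \<mu> m k = (\<Sum>j\<in>{j \<in> index_set n. ancestor (n - m) j = k}. w j * \<mu> n j)"
proof (cases "m = n")
  case True
  have "{j \<in> index_set n. ancestor 0 j = k} = {k}"
    using assms True by auto
  then have "(\<Sum>j\<in>{j \<in> index_set n. ancestor (n - m) j = k}. w j * \<mu> n j) = w k * \<mu> n k"
    unfolding True diff_self_eq_0 by simp
  then show ?thesis
    using True by (simp add: reweight_def)
qed (use assms in \<open>simp add: reweight_def\<close>)

lemma mass_distribution_reweight: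
  assumes \<mu>: "mass_distribution \<mu>" and w: "\<And>j. 0 \<le> w j"
  shows "mass_distribution (reweight n w \<mu>)"
  unfolding mass_distribution_def
proof (intro conjI allI ballI)
  note nn = mass_distribution_nonneg[OF \<mu>]
  show "0 \<le> reweight n w \<mu> m k" for m k
    using w nn by (auto simp: reweight_def intro!: sum_nonneg)
  fix m :: nat and k :: "'a \<Rightarrow> int"
  assume k: "k \<in> index_set m"
  show "reweight n w \<mu> m k = sum (reweight n w \<mu> (Suc m)) (children m k)"
  proof (cases "n \<le> m")
    case True
    have "sum (reweight n w \<mu> (Suc m)) (children m k) = (\<Sum>j\<in>children m k. w (ancestor (m - n) k) * \<mu> (Suc m) j)"
    proof (rule sum.cong)
      fix j assume j: "j \<in> children m k"
      then have "ancestor (Suc m - n) j = ancestor (m - n) k"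
        using True by (auto simp: children_def ancestor_ancestor Suc_diff_le)
      then show "reweight n w \<mu> (Suc m) j = w (ancestor (m - n) k) * \<mu> (Suc m) j"
        using True by (simp add: reweight_def)
    qed simp
    also have "\<dots> = w (ancestor (m - n) k) * \<mu> m k"
      by (simp add: sum_distrib_left[symmetric] mass_distribution_children[OF \<mu> k])
    finally show ?thesis
      using True by (simp add: reweight_def)
  next
    case False
    let ?B = "{j \<in> index_set n. ancestor (n - m) j = k}"
    have anc: "ancestor 1 (ancestor (n - Suc m) j) = ancestor (n - m) j" for j :: "'a \<Rightarrow> int"
      using False by (simp add: ancestor_ancestor Suc_diff_Suc)
    have ch: "ancestor (n - Suc m) j \<in> index_set (Suc m)" if "j \<in> index_set n" for j :: "'a \<Rightarrow> int"
      using that False by (intro ancestor_in_index_set) simp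
    have "sum (reweight n w \<mu> (Suc m)) (children m k)
        = (\<Sum>c\<in>children m k. \<Sum>j\<in>{j \<in> ?B. ancestor (n - Suc m) j = c}. w j * \<mu> n j)"
    proof (rule sum.cong)
      fix c assume c: "c \<in> children m k"
      then have "reweight n w \<mu> (Suc m) c = (\<Sum>j\<in>{j \<in> index_set n. ancestor (n - Suc m) j = c}. w j * \<mu> n j)"
        using False by (intro reweight_coarse) (auto simp: children_def)
      also have "{j \<in> index_set n. ancestor (n - Suc m) j = c} = {j \<in> ?B. ancestor (n - Suc m) j = c}"
        using c anc by (auto simp: children_def)
      finally show "reweight n w \<mu> (Suc m) c = (\<Sum>j\<in>{j \<in> ?B. ancestor (n - Suc m) j = c}. w j * \<mu> n j)" .
    qed simp
    also have "\<dots> = (\<Sum>j\<in>?B. w j * \<mu> n j)"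
      using anc ch by (intro sum.group) (auto simp: children_def)
    finally show ?thesis
      using False by (simp add: reweight_def)
  qed
qed

text \<open>A cell of positive new mass has, at the finer of the orders \<open>m\<close> and
  \<open>n\<close>, itself or a descendant of positive old mass whose order \<open>n\<close> cell
  has nonzero weight. Its point of \<open>X\<close> lies in the closed cube of that order
  \<open>n\<close> cell, hence in \<open>Y\<close>.\<close>

lemma carried_by_reweight:
  fixes X :: "(real ^ 'n) set"
  assumes \<mu>: "mass_distribution \<mu>" "carried_by \<mu> X" and X: "X \<subseteq> cbox 0 1"
    and w: "\<And>j. 0 \<le> w j" "\<And>j. j \<in> index_set n \<Longrightarrow> w j \<noteq> 0 \<Longrightarrow> dyadic_cube n j \<subseteq> Y"
  shows "carried_by (reweight n w \<mu>) (X \<inter> Y)"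
  unfolding carried_by_def
proof (intro allI ballI impI)
  note nn = mass_distribution_nonneg[OF \<mu>(1)]
  fix m and k :: "'n \<Rightarrow> int"
  assume k: "k \<in> index_set m" and pos: "0 < reweight n w \<mu> m k"
  have Y: "x \<in> Y" if "x \<in> X" "w (cube_index n x) \<noteq> 0" for x
    using w(2)[of "cube_index n x"] that X in_dyadic_cube_cube_index[of x n] cube_index_in_index_set[of x n]
    by blast
  show "\<exists>x\<in>X \<inter> Y. cube_index m x = k"
  proof (cases "n \<le> m")
    case True
    then have "0 < w (ancestor (m - n) k) * \<mu> m k"
      using pos by (simp add: reweight_def)
    then have "w (ancestor (m - n) k) \<noteq> 0" "0 < \<mu> m k"
      using w(1)[of "ancestor (m - n) k"] nn[of m k] by (auto simp: zero_less_mult_iff)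
    then obtain x where "x \<in> X" "cube_index m x = k"
      using \<mu>(2) k unfolding carried_by_def by blast
    then show ?thesis
      using Y[of x] \<open>w _ \<noteq> 0\<close> ancestor_cube_index'[OF True, of x] by auto
  next
    case False
    have "\<exists>j\<in>{j \<in> index_set n. ancestor (n - m) j = k}. w j * \<mu> n j \<noteq> 0"
    proof (rule ccontr)
      assume "\<not> ?thesis"
      then have "reweight n w \<mu> m k = 0"
        using False by (auto simp: reweight_def intro!: sum.neutral)
      with pos show False
        by simp
    qed
    then obtain j where j: "j \<in> index_set n" "ancestor (n - m) j = k" "w j \<noteq> 0" "\<mu> n j \<noteq> 0"
      by auto
    then have "0 < \<mu> n j"
      using nn[of n j] by linarith
    then obtain x where "x \<in> X" "cube_index n x = j"
      using \<mu>(2) j(1) unfolding carried_by_def by blast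
    then show ?thesis
      using Y[of x] j ancestor_cube_index'[of m n x] False by auto
  qed
qed

lemma reweight_le:
  assumes \<mu>: "mass_distribution \<mu>" and w: "\<And>j. w j \<le> W" and k: "k \<in> index_set m"
  shows "reweight n w \<mu> m k \<le> W * \<mu> m k"
proof -
  note nn = mass_distribution_nonneg[OF \<mu>]
  show ?thesis
  proof (cases "n \<le> m")
    case True
    then show ?thesis
      using w nn by (auto simp: reweight_def intro: mult_right_mono)
  next
    case False
    then have "reweight n w \<mu> m k \<le> (\<Sum>j\<in>{j \<in> index_set n. ancestor (n - m) j = k}. W * \<mu> n j)"
      using w nn by (auto simp: reweight_def intro!: sum_mono mult_right_mono)
    also have "\<dots> = W * \<mu> m k"
      using mass_distribution_descendants[OF \<mu> _ k, of n] False by (simp add: sum_distrib_left)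
    finally show ?thesis .
  qed
qed

text \<open>Expanding the square gives covariances with weights
  \<open>v i * v j / (P i * P j)\<close>. Pairs below the threshold contribute at most
  \<open>\<epsilon> * (v i * v j)\<close>. For the others the covariance is at most
  \<open>P j\<close>, because \<open>\<zeta> i \<le> 1\<close>; so only one of the two probabilities
  stays in the denominator, and each \<open>i\<close> has at most \<open>b\<close> such partners,
  each costing at most \<open>v i * (c / p)\<close>.\<close>

lemma second_moment:
  fixes \<zeta> :: "'i \<Rightarrow> 'w \<Rightarrow> real"
  assumes M: "prob_space M" and A: "finite A"
    and meas: "\<And>j. j \<in> A \<Longrightarrow> \<zeta> j \<in> borel_measurable M"
    and range: "\<And>j \<omega>. j \<in> A \<Longrightarrow> \<omega> \<in> space M \<Longrightarrow> \<zeta> j \<omega> \<in> {0..1}"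
    and P: "\<And>j. j \<in> A \<Longrightarrow> P j = (\<integral>\<omega>. \<zeta> j \<omega> \<partial>M)" "\<And>j. j \<in> A \<Longrightarrow> p \<le> P j" "0 < p"
    and b: "\<And>j. j \<in> A \<Longrightarrow> real (card {j' \<in> A. \<epsilon> * P j * P j' \<le> covariance M (\<zeta> j) (\<zeta> j')}) \<le> b"
    and v: "\<And>j. j \<in> A \<Longrightarrow> 0 \<le> v j" "\<And>j. j \<in> A \<Longrightarrow> v j \<le> c" and c: "0 \<le> c" and \<epsilon>: "0 \<le> \<epsilon>"
  shows "integrable M (\<lambda>\<omega>. (\<Sum>j\<in>A. (\<zeta> j \<omega> / P j - 1) * v j)\<^sup>2)"
    and "(\<integral>\<omega>. (\<Sum>j\<in>A. (\<zeta> j \<omega> / P j - 1) * v j)\<^sup>2 \<partial>M) \<le> \<epsilon> * (sum v A)\<^sup>2 + sum v A * (b * c / p)"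
proof -
  interpret prob_space M
    by (rule M)
  have Ppos: "0 < P j" if "j \<in> A" for j
    using P(2)[OF that] P(3) by linarith
  have int: "integrable M (\<zeta> j)" if "j \<in> A" for j
    by (rule integrable_const_bound[of _ 1]) (use that meas range in \<open>auto intro!: AE_I2\<close>)
  have int2: "integrable M (\<lambda>\<omega>. \<zeta> i \<omega> * \<zeta> j \<omega>)" if "i \<in> A" "j \<in> A" for i j
  proof (rule integrable_const_bound[of _ 1])
    show "AE \<omega> in M. norm (\<zeta> i \<omega> * \<zeta> j \<omega>) \<le> 1"
      using range[OF that(1)] range[OF that(2)] by (intro AE_I2) (auto simp: abs_mult intro: mult_le_one)
  qed (use that meas in auto)
  have cov_int: "integrable M (\<lambda>\<omega>. (\<zeta> i \<omega> - P i) * (\<zeta> j \<omega> - P j))" if "i \<in> A" "j \<in> A" for i j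
    using int[OF that(1)] int[OF that(2)] int2[OF that] by (simp add: algebra_simps)
  have cov: "covariance M (\<zeta> i) (\<zeta> j) = (\<integral>\<omega>. (\<zeta> i \<omega> - P i) * (\<zeta> j \<omega> - P j) \<partial>M)" if "i \<in> A" "j \<in> A" for i j
    using that by (simp add: covariance_def P(1))
  have cov_le: "covariance M (\<zeta> i) (\<zeta> j) \<le> P j" if ij: "i \<in> A" "j \<in> A" for i j
  proof -
    have "covariance M (\<zeta> i) (\<zeta> j) = (\<integral>\<omega>. \<zeta> i \<omega> * \<zeta> j \<omega> - P i * \<zeta> j \<omega> - P j * \<zeta> i \<omega> + P i * P j \<partial>M)"
      unfolding cov[OF ij] by (intro Bochner_Integration.integral_cong) (auto simp: algebra_simps)
    also have "\<dots> = (\<integral>\<omega>. \<zeta> i \<omega> * \<zeta> j \<omega> \<partial>M) - P i * P j"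
      using int[OF ij(1)] int[OF ij(2)] int2[OF ij] by (simp add: prob_space P(1)[OF ij(1)] P(1)[OF ij(2)])
    also have "\<dots> \<le> (\<integral>\<omega>. \<zeta> i \<omega> * \<zeta> j \<omega> \<partial>M)"
      using Ppos[OF ij(1)] Ppos[OF ij(2)] by simp
    also have "\<dots> \<le> (\<integral>\<omega>. \<zeta> j \<omega> \<partial>M)"
      using int2[OF ij] int[OF ij(2)] range[OF ij(1)] range[OF ij(2)]
      by (intro integral_mono) (auto intro: mult_left_le_one_le)
    finally show ?thesis
      using P(1)[OF ij(2)] by simp
  qed
  have sq: "(\<Sum>j\<in>A. (\<zeta> j \<omega> / P j - 1) * v j)\<^sup>2
      = (\<Sum>i\<in>A. \<Sum>j\<in>A. v i / P i * (v j / P j) * ((\<zeta> i \<omega> - P i) * (\<zeta> j \<omega> - P j)))" for \<omega>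
  proof -
    have "(\<zeta> j \<omega> / P j - 1) * v j = v j / P j * (\<zeta> j \<omega> - P j)" if "j \<in> A" for j
      using Ppos[OF that] by (simp add: field_simps)
    then have "(\<Sum>j\<in>A. (\<zeta> j \<omega> / P j - 1) * v j) = (\<Sum>j\<in>A. v j / P j * (\<zeta> j \<omega> - P j))"
      by (rule sum.cong[OF refl])
    then show ?thesis
      by (simp add: power2_eq_square sum_product ac_simps)
  qed
  show "integrable M (\<lambda>\<omega>. (\<Sum>j\<in>A. (\<zeta> j \<omega> / P j - 1) * v j)\<^sup>2)"
    unfolding sq using cov_int by (intro Bochner_Integration.integrable_sum integrable_mult_right) auto
  have "(\<integral>\<omega>. (\<Sum>j\<in>A. (\<zeta> j \<omega> / P j - 1) * v j)\<^sup>2 \<partial>M)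
      = (\<Sum>i\<in>A. \<Sum>j\<in>A. v i / P i * (v j / P j) * covariance M (\<zeta> i) (\<zeta> j))"
    unfolding sq using cov_int
    by (subst Bochner_Integration.integral_sum, force)
       (auto intro!: sum.cong simp: cov Bochner_Integration.integral_sum)
  also have "\<dots> \<le> (\<Sum>i\<in>A. \<Sum>j\<in>A. \<epsilon> * (v i * v j) +
      (if \<epsilon> * P i * P j \<le> covariance M (\<zeta> i) (\<zeta> j) then v i * (c / p) else 0))"
  proof (intro sum_mono)
    fix i j assume ij: "i \<in> A" "j \<in> A"
    let ?cov = "covariance M (\<zeta> i) (\<zeta> j)"
    note pos = Ppos[OF ij(1)] Ppos[OF ij(2)] v(1)[OF ij(1)] v(1)[OF ij(2)]
    show "v i / P i * (v j / P j) * ?cov \<le> \<epsilon> * (v i * v j) + (if \<epsilon> * P i * P j \<le> ?cov then v i * (c / p) else 0)"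
    proof (cases "\<epsilon> * P i * P j \<le> ?cov")
      case True
      have "v i / P i * (v j / P j) * ?cov \<le> v i / P i * (v j / P j) * P j"
        using pos cov_le[OF ij] by (intro mult_left_mono) auto
      also have "\<dots> = v i * (v j / P i)"
        using pos by simp
      also have "\<dots> \<le> v i * (c / p)"
        using pos v(2)[OF ij(2)] P(2)[OF ij(1)] P(3) c by (intro mult_left_mono frac_le) auto
      also have "\<dots> \<le> \<epsilon> * (v i * v j) + v i * (c / p)"
        using pos \<epsilon> by simp
      finally show ?thesis
        using True by simp
    next
      case False
      then have "v i / P i * (v j / P j) * ?cov \<le> v i / P i * (v j / P j) * (\<epsilon> * P i * P j)"
        using pos by (intro mult_left_mono) auto
      also have "\<dots> = \<epsilon> * (v i * v j)"
        using pos by simp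
      finally show ?thesis
        using False by simp
    qed
  qed
  also have "\<dots> = \<epsilon> * (sum v A)\<^sup>2 +
      (\<Sum>i\<in>A. v i * (c / p) * real (card {j \<in> A. \<epsilon> * P i * P j \<le> covariance M (\<zeta> i) (\<zeta> j)}))"
  proof -
    have "(\<Sum>i\<in>A. \<Sum>j\<in>A. \<epsilon> * (v i * v j)) = \<epsilon> * (sum v A)\<^sup>2"
      unfolding power2_eq_square sum_product by (simp only: sum_distrib_left)
    moreover have "(\<Sum>j\<in>A. if \<epsilon> * P i * P j \<le> covariance M (\<zeta> i) (\<zeta> j) then v i * (c / p) else 0)
        = v i * (c / p) * real (card {j \<in> A. \<epsilon> * P i * P j \<le> covariance M (\<zeta> i) (\<zeta> j)})" for i
      using A by (simp add: sum.inter_filter[symmetric])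
    ultimately show ?thesis
      by (simp only: sum.distrib)
  qed
  also have "\<dots> \<le> \<epsilon> * (sum v A)\<^sup>2 + (\<Sum>i\<in>A. v i * (c / p) * b)"
    using b v(1) c P(3) by (intro add_left_mono sum_mono mult_left_mono) auto
  also have "(\<Sum>i\<in>A. v i * (c / p) * b) = sum v A * (b * c / p)"
    unfolding sum_distrib_right by (intro sum.cong) auto
  finally show "(\<integral>\<omega>. (\<Sum>j\<in>A. (\<zeta> j \<omega> / P j - 1) * v j)\<^sup>2 \<partial>M) \<le> \<epsilon> * (sum v A)\<^sup>2 + sum v A * (b * c / p)" .
qed

section \<open>Second moments\<close>

lemma elog2_div_gtD:
  assumes "ereal a < elog2 x / ereal (real n)" "0 \<le> x" "0 < n"
  shows "2 powr (a * real n) < x"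
proof -
  have "x \<noteq> 0"
    using assms by (auto simp: elog2_def)
  then have "a < log 2 x / real n" "0 < x"
    using assms by (auto simp: elog2_def)
  then show ?thesis
    using assms by (simp add: less_log_iff pos_less_divide_eq)
qed

lemma elog2_div_ltD:
  assumes "elog2 x / ereal (real n) < ereal a" "0 \<le> x" "0 < n"
  shows "x < 2 powr (a * real n)"
proof (cases "x = 0")
  case False
  then have "log 2 x / real n < a" "0 < x"
    using assms by (auto simp: elog2_def)
  then show ?thesis
    using assms by (simp add: log_less_iff pos_divide_less_eq)
qed simp

lemma ennreal_geometric_suminf:
  assumes "0 \<le> c" "0 \<le> q" "q < 1"
  shows "(\<Sum>m. ennreal (c * q ^ m)) = ennreal (c / (1 - q))"
proof -
  have "(\<lambda>m. c * q ^ m) sums (c * (1 / (1 - q)))"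
    using assms by (intro sums_mult geometric_sums) auto
  then have "(\<lambda>m. ennreal (c * q ^ m)) sums ennreal (c * (1 / (1 - q)))"
    using assms by (subst sums_ennreal) auto
  then show ?thesis
    by (simp add: sums_iff)
qed

text \<open>The constant is existential because it grows with each reweighting; only the exponent
  \<open>s\<close> persists through the iteration.\<close>

definition frostman_bound :: "real \<Rightarrow> (nat \<Rightarrow> ('n::finite \<Rightarrow> int) \<Rightarrow> real) \<Rightarrow> bool" where
  "frostman_bound s \<mu> \<longleftrightarrow> (\<exists>C\<ge>0. \<forall>m. \<forall>k\<in>index_set m. \<mu> m k \<le> C * 2 powr - (real m * s))"

text \<open>In each square one factor is estimated by the Frostman bound and the other sums to the
  total mass, which leaves a geometric series of ratio \<open>2 powr (t - s)\<close>.\<close>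

lemma energy_finite:
  assumes \<mu>: "mass_distribution \<mu>" "frostman_bound s \<mu>" and ts: "t < s"
  shows "energy t \<mu> < top"
proof -
  note nn = mass_distribution_nonneg[OF \<mu>(1)]
  obtain C where C: "0 \<le> C" "\<And>m k. k \<in> index_set m \<Longrightarrow> \<mu> m k \<le> C * 2 powr - (real m * s)"
    using \<mu>(2) by (auto simp: frostman_bound_def)
  define q where "q = 2 powr (t - s)"
  have q: "0 \<le> q" "q < 1"
    using ts by (auto simp: q_def powr_less_one)
  have "(\<Sum>k\<in>index_set m. ennreal (2 powr (real m * t) * (\<mu> m k)\<^sup>2)) \<le> ennreal (\<mu> 0 (\<lambda>_. 0) * C * q ^ m)" for m
  proof -
    have "2 powr (real m * t) * (\<mu> m k)\<^sup>2 \<le> \<mu> m k * (C * q ^ m)" if "k \<in> index_set m" for k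
    proof -
      have "2 powr (real m * t) * (\<mu> m k)\<^sup>2 \<le> 2 powr (real m * t) * (\<mu> m k * (C * 2 powr - (real m * s)))"
        unfolding power2_eq_square using C(2)[OF that] nn by (intro mult_left_mono) auto
      also have "\<dots> = \<mu> m k * (C * (2 powr (real m * t) * 2 powr - (real m * s)))"
        by simp
      also have "2 powr (real m * t) * 2 powr - (real m * s) = q ^ m"
        by (simp add: q_def powr_add[symmetric] powr_realpow[symmetric] powr_powr algebra_simps)
      finally show ?thesis .
    qed
    then have "(\<Sum>k\<in>index_set m. ennreal (2 powr (real m * t) * (\<mu> m k)\<^sup>2)) \<le> (\<Sum>k\<in>index_set m. ennreal (\<mu> m k * (C * q ^ m)))"
      by (intro sum_mono ennreal_leI)
    also have "\<dots> = ennreal (\<Sum>k\<in>index_set m. \<mu> m k * (C * q ^ m))"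
      using nn C q by (intro sum_ennreal) auto
    also have "(\<Sum>k\<in>index_set m. \<mu> m k * (C * q ^ m)) = \<mu> 0 (\<lambda>_. 0) * C * q ^ m"
      by (simp add: sum_distrib_right[symmetric] total_mass[OF \<mu>(1)])
    finally show ?thesis .
  qed
  then have "energy t \<mu> \<le> (\<Sum>m. ennreal (\<mu> 0 (\<lambda>_. 0) * C * q ^ m))"
    unfolding energy_def by (intro suminf_le) auto
  also have "\<dots> < top"
    using q C nn by (subst ennreal_geometric_suminf) auto
  finally show ?thesis .
qed

locale limsup_random_fractal = prob_space M for M :: "'w measure" +
  fixes Z :: "nat \<Rightarrow> (real ^ 'n) set \<Rightarrow> 'w \<Rightarrow> real"
  assumes Z_measurable: "1 \<le> n \<Longrightarrow> k \<in> index_set n \<Longrightarrow> Z n (dyadic_cube n k) \<in> borel_measurable M"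
    and Z_range: "1 \<le> n \<Longrightarrow> k \<in> index_set n \<Longrightarrow> \<omega> \<in> space M \<Longrightarrow> Z n (dyadic_cube n k) \<omega> \<in> {0, 1}"
begin

definition P :: "nat \<Rightarrow> ('n \<Rightarrow> int) \<Rightarrow> real" where
  "P n k = cube_prob M Z n (dyadic_cube n k)"

definition retained :: "nat \<Rightarrow> 'w \<Rightarrow> ('n \<Rightarrow> int) set" where
  "retained n \<omega> = {k \<in> index_set n. Z n (dyadic_cube n k) \<omega> = 1}"

text \<open>The argument is a set of cells rather than \<omega>, as each order has only finitely
  many such sets. A cell of probability zero receives weight 0 by the convention for
  division.\<close>

definition inverse_prob :: "nat \<Rightarrow> ('n \<Rightarrow> int) set \<Rightarrow> ('n \<Rightarrow> int) \<Rightarrow> real" where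
  "inverse_prob n S k = indicator S k / P n k"

abbreviation thinned :: "nat \<Rightarrow> 'w \<Rightarrow> (nat \<Rightarrow> ('n \<Rightarrow> int) \<Rightarrow> real) \<Rightarrow> nat \<Rightarrow> ('n \<Rightarrow> int) \<Rightarrow> real" where
  "thinned n \<omega> \<equiv> reweight n (inverse_prob n (retained n \<omega>))"

lemma P_nonneg: "0 \<le> P n k"
  by (simp add: P_def cube_prob_def)

lemma inverse_prob_nonneg: "0 \<le> inverse_prob n S k"
  by (simp add: inverse_prob_def P_nonneg)

lemma indicator_retained:
  assumes "1 \<le> n" "k \<in> index_set n" "\<omega> \<in> space M"
  shows "indicator (retained n \<omega>) k = Z n (dyadic_cube n k) \<omega>"
  using Z_range[OF assms] assms by (auto simp: retained_def indicator_def)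

lemma expectation_Z:
  assumes "1 \<le> n" "k \<in> index_set n"
  shows "P n k = expectation (Z n (dyadic_cube n k))"
proof -
  let ?E = "{\<omega> \<in> space M. Z n (dyadic_cube n k) \<omega> = 1}"
  have "?E \<in> events"
    using Z_measurable[OF assms] by measurable
  moreover have "expectation (Z n (dyadic_cube n k)) = expectation (indicator ?E)"
    using Z_range[OF assms] by (intro Bochner_Integration.integral_cong) (auto simp: indicator_def)
  ultimately show ?thesis
    by (simp add: P_def cube_prob_def)
qed

lemma inverse_prob_measurable:
  assumes "1 \<le> n"
  shows "(\<lambda>\<omega>. inverse_prob n (retained n \<omega>) k) \<in> borel_measurable M"
proof (cases "k \<in> index_set n")
  case True
  have "(\<lambda>\<omega>. Z n (dyadic_cube n k) \<omega> / P n k) \<in> borel_measurable M"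
    using Z_measurable[OF assms True] by measurable
  then show ?thesis
    by (subst measurable_cong[where g = "\<lambda>\<omega>. Z n (dyadic_cube n k) \<omega> / P n k"])
       (auto simp: inverse_prob_def indicator_retained[OF assms True])
next
  case False
  then have "(\<lambda>\<omega>. inverse_prob n (retained n \<omega>) k) = (\<lambda>_. 0)"
    by (auto simp: inverse_prob_def retained_def)
  then show ?thesis
    by simp
qed

lemma thinned_measurable:
  assumes "1 \<le> n"
  shows "(\<lambda>\<omega>. thinned n \<omega> \<mu> m k) \<in> borel_measurable M"
  unfolding reweight_def using inverse_prob_measurable[OF assms] by measurable

lemma energy_deviation_measurable:
  assumes "1 \<le> n"
  shows "(\<lambda>\<omega>. energy t (\<lambda>m k. thinned n \<omega> \<mu> m k - \<mu> m k)) \<in> borel_measurable M"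
  unfolding energy_def using thinned_measurable[OF assms] by measurable

lemma correlated_count_bound:
  assumes j: "j \<in> index_set n" and A: "A \<subseteq> index_set n"
  shows "card {j' \<in> A. \<epsilon> * P n j * P n j' \<le> covariance M (Z n (dyadic_cube n j)) (Z n (dyadic_cube n j'))}
    \<le> correlated_count M Z n \<epsilon>"
proof -
  let ?N = "\<lambda>Q. card {Q' \<in> dyadic_cubes n. covariance M (Z n Q) (Z n Q') \<ge> \<epsilon> * cube_prob M Z n Q * cube_prob M Z n Q'}"
  let ?A = "{j' \<in> A. \<epsilon> * P n j * P n j' \<le> covariance M (Z n (dyadic_cube n j)) (Z n (dyadic_cube n j'))}"
  have "card ?A = card (dyadic_cube n ` ?A)"
    by (intro card_image[symmetric] inj_on_subset[OF inj_dyadic_cube]) auto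
  also have "\<dots> \<le> ?N (dyadic_cube n j)"
    using A by (intro card_mono) (auto simp: dyadic_cubes_eq P_def)
  also have "\<dots> \<le> correlated_count M Z n \<epsilon>"
    unfolding correlated_count_def using j by (intro Max_ge) (auto simp: dyadic_cubes_eq)
  finally show ?thesis .
qed

text \<open>For \<open>m \<le> n\<close> the deviation is a sum over the descendants of order
  \<open>n\<close>. For \<open>m > n\<close> the cell lies in a single cell of order
  \<open>n\<close>, and the only summand has size \<open>\<mu> m k\<close>. In both cases the
  summands are at most \<open>C * 2 powr - (max m n * s)\<close>.\<close>

lemma thinned_second_moment:
  assumes n: "1 \<le> n" and k: "k \<in> index_set m" and \<mu>: "mass_distribution \<mu>"
    and C: "0 \<le> C" "\<And>m k. k \<in> index_set m \<Longrightarrow> \<mu> m k \<le> C * 2 powr - (real m * s)"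
    and p: "0 < p" "\<And>j. j \<in> index_set n \<Longrightarrow> p \<le> P n j"
    and b: "1 \<le> b" "real (correlated_count M Z n \<epsilon>) \<le> b" and \<epsilon>: "0 \<le> \<epsilon>"
  shows "(\<integral>\<^sup>+\<omega>. ennreal ((thinned n \<omega> \<mu> m k - \<mu> m k)\<^sup>2) \<partial>M)
    \<le> ennreal (\<epsilon> * (\<mu> m k)\<^sup>2 + \<mu> m k * (b * (C * 2 powr - (real (max m n) * s)) / p))"
proof -
  note nn = mass_distribution_nonneg[OF \<mu>]
  have *: "(\<integral>\<^sup>+\<omega>. ennreal ((thinned n \<omega> \<mu> m k - \<mu> m k)\<^sup>2) \<partial>M)
      \<le> ennreal (\<epsilon> * (sum v A)\<^sup>2 + sum v A * (b * c / p))"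
    if A: "A \<subseteq> index_set n" and v: "\<And>j. j \<in> A \<Longrightarrow> 0 \<le> v j" "\<And>j. j \<in> A \<Longrightarrow> v j \<le> c" "0 \<le> c"
      and eq: "\<And>\<omega>. thinned n \<omega> \<mu> m k - \<mu> m k = (\<Sum>j\<in>A. (indicator (retained n \<omega>) j / P n j - 1) * v j)"
    for A v c
  proof -
    let ?\<zeta> = "\<lambda>j. Z n (dyadic_cube n j)"
    have fin: "finite A"
      using A by (rule finite_subset) simp
    have card: "real (card {j' \<in> A. \<epsilon> * P n j * P n j' \<le> covariance M (?\<zeta> j) (?\<zeta> j')}) \<le> b" if "j \<in> A" for j
    proof -
      have "card {j' \<in> A. \<epsilon> * P n j * P n j' \<le> covariance M (?\<zeta> j) (?\<zeta> j')} \<le> correlated_count M Z n \<epsilon>"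
        using A that by (intro correlated_count_bound) auto
      with b(2) show ?thesis
        by linarith
    qed
    have \<zeta>: "?\<zeta> j \<in> borel_measurable M" "P n j = expectation (?\<zeta> j)" "p \<le> P n j" if "j \<in> A" for j
      using A that Z_measurable[OF n] expectation_Z[OF n] p(2) by blast+
    have range: "?\<zeta> j \<omega> \<in> {0..1}" if "j \<in> A" "\<omega> \<in> space M" for j \<omega>
    proof -
      have "Z n (dyadic_cube n j) \<omega> \<in> {0, 1}"
        using A that by (intro Z_range[OF n]) auto
      then show ?thesis
        by auto
    qed
    note sm = second_moment[where M = M and \<zeta> = ?\<zeta> and P = "P n" and p = p and v = v and c = c and b = b and \<epsilon> = \<epsilon>,
        OF prob_space_axioms fin \<zeta>(1) range \<zeta>(2,3) p(1) card v \<epsilon>]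
    have int: "integrable M (\<lambda>\<omega>. (\<Sum>j\<in>A. (?\<zeta> j \<omega> / P n j - 1) * v j)\<^sup>2)"
      by (rule sm(1))
    have le: "expectation (\<lambda>\<omega>. (\<Sum>j\<in>A. (?\<zeta> j \<omega> / P n j - 1) * v j)\<^sup>2) \<le> \<epsilon> * (sum v A)\<^sup>2 + sum v A * (b * c / p)"
      by (rule sm(2))
    have "(\<integral>\<^sup>+\<omega>. ennreal ((thinned n \<omega> \<mu> m k - \<mu> m k)\<^sup>2) \<partial>M)
        = (\<integral>\<^sup>+\<omega>. ennreal ((\<Sum>j\<in>A. (?\<zeta> j \<omega> / P n j - 1) * v j)\<^sup>2) \<partial>M)"
      unfolding eq using A indicator_retained[OF n]
      by (intro nn_integral_cong arg_cong[where f = ennreal] arg_cong[where f = "\<lambda>x. x\<^sup>2"] sum.cong) auto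
    also have "\<dots> = ennreal (expectation (\<lambda>\<omega>. (\<Sum>j\<in>A. (?\<zeta> j \<omega> / P n j - 1) * v j)\<^sup>2))"
      using int by (rule nn_integral_eq_integral) simp
    also have "\<dots> \<le> ennreal (\<epsilon> * (sum v A)\<^sup>2 + sum v A * (b * c / p))"
      using le by (rule ennreal_leI)
    finally show ?thesis .
  qed
  show ?thesis
  proof (cases "m \<le> n")
    case True
    let ?A = "{j \<in> index_set n. ancestor (n - m) j = k}"
    have sum: "\<mu> m k = sum (\<mu> n) ?A"
      by (rule mass_distribution_descendants[OF \<mu> True k])
    have "thinned n \<omega> \<mu> m k - \<mu> m k = (\<Sum>j\<in>?A. (indicator (retained n \<omega>) j / P n j - 1) * \<mu> n j)" for \<omega>
      unfolding sum reweight_coarse[OF True k] sum_subtractf[symmetric]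
      by (intro sum.cong) (auto simp: inverse_prob_def algebra_simps)
    then show ?thesis
      using *[of ?A "\<mu> n" "C * 2 powr - (real n * s)"] C nn True by (simp add: sum[symmetric] max_absorb2)
  next
    case False
    then have a: "ancestor (m - n) k \<in> index_set n"
      using k by (intro ancestor_in_index_set) simp
    have "thinned n \<omega> \<mu> m k - \<mu> m k
        = (\<Sum>j\<in>{ancestor (m - n) k}. (indicator (retained n \<omega>) j / P n j - 1) * \<mu> m k)" for \<omega>
      using False by (simp add: reweight_def inverse_prob_def algebra_simps)
    then show ?thesis
      using *[of "{ancestor (m - n) k}" "\<lambda>_. \<mu> m k" "C * 2 powr - (real m * s)"] C nn k a False
      by (simp add: max_absorb1)
  qed
qed

text \<open>The \<epsilon> parts add up to \<epsilon> times the energy, and in the remainder one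
  factor \<open>\<mu> m k\<close> sums to the total mass. What is left must be summable in
  \<open>m\<close> and small in \<open>n\<close> at the same time: the intermediate exponent
  \<open>t'\<close> separates these into a geometric series of ratio
  \<open>2 powr - (t' - t)\<close> and the factor \<open>2 powr - (n * (s - t'))\<close>.\<close>

lemma thinned_energy_deviation:
  assumes n: "1 \<le> n" and \<mu>: "mass_distribution \<mu>"
    and C: "0 \<le> C" "\<And>m k. k \<in> index_set m \<Longrightarrow> \<mu> m k \<le> C * 2 powr - (real m * s)"
    and p: "0 < p" "\<And>j. j \<in> index_set n \<Longrightarrow> p \<le> P n j"
    and b: "1 \<le> b" "real (correlated_count M Z n \<epsilon>) \<le> b" and \<epsilon>: "0 \<le> \<epsilon>"
    and t: "t < t'" "t' \<le> s" "0 \<le> t'"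
  shows "(\<integral>\<^sup>+\<omega>. energy t (\<lambda>m k. thinned n \<omega> \<mu> m k - \<mu> m k) \<partial>M)
    \<le> ennreal \<epsilon> * energy t \<mu> +
      ennreal (\<mu> 0 (\<lambda>_. 0) * (b * C * 2 powr - (real n * (s - t')) / p) / (1 - 2 powr - (t' - t)))"
proof -
  note nn = mass_distribution_nonneg[OF \<mu>]
  define q where "q = 2 powr - (t' - t)"
  define B where "B = b * C * 2 powr - (real n * (s - t')) / p"
  have q: "0 \<le> q" "q < 1"
    using t by (auto simp: q_def powr_less_one)
  have B: "0 \<le> B"
    using C p b by (auto simp: B_def)
  have bound: "(\<integral>\<^sup>+\<omega>. ennreal (2 powr (real m * t) * (thinned n \<omega> \<mu> m k - \<mu> m k)\<^sup>2) \<partial>M)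
      \<le> ennreal \<epsilon> * ennreal (2 powr (real m * t) * (\<mu> m k)\<^sup>2) + ennreal (\<mu> m k * (B * q ^ m))"
    if k: "k \<in> index_set m" for m k
  proof -
    have exps: "2 powr (real m * t) * 2 powr - (real (max m n) * s) \<le> q ^ m * 2 powr - (real n * (s - t'))"
    proof -
      \<comment> \<open>The left side is largest at \<open>m = n\<close>: it does not decrease up to
        there because \<open>t' \<ge> 0\<close> and does not increase beyond because
        \<open>t' \<le> s\<close>.\<close>
      have "real m * t' - real (max m n) * s \<le> real n * t' - real n * s"
      proof (cases "m \<le> n")
        case True
        then show ?thesis
          using t by (simp add: max_absorb2 mult_right_mono)
      next
        case False
        then have "real m * (t' - s) \<le> real n * (t' - s)"
          using t by (intro mult_right_mono_neg) auto
        then show ?thesis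
          using False by (simp add: max_absorb1 algebra_simps)
      qed
      then have "real m * t + - (real (max m n) * s) \<le> real m * (- (t' - t)) + - (real n * (s - t'))"
        by (simp add: algebra_simps)
      then have "2 powr (real m * t + - (real (max m n) * s)) \<le> 2 powr (real m * (- (t' - t)) + - (real n * (s - t')))"
        by (intro powr_mono) auto
      then show ?thesis
        by (simp only: powr_add q_def powr_realpow[symmetric] powr_powr powr_gt_zero mult.commute[of "- (t' - t)"])
    qed
    have "(\<integral>\<^sup>+\<omega>. ennreal (2 powr (real m * t) * (thinned n \<omega> \<mu> m k - \<mu> m k)\<^sup>2) \<partial>M)
        = ennreal (2 powr (real m * t)) * (\<integral>\<^sup>+\<omega>. ennreal ((thinned n \<omega> \<mu> m k - \<mu> m k)\<^sup>2) \<partial>M)"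
      using thinned_measurable[OF n] by (subst nn_integral_cmult[symmetric]) (auto simp: ennreal_mult)
    also have "\<dots> \<le> ennreal (2 powr (real m * t)) *
        ennreal (\<epsilon> * (\<mu> m k)\<^sup>2 + \<mu> m k * (b * (C * 2 powr - (real (max m n) * s)) / p))"
      by (intro mult_left_mono thinned_second_moment[OF n k \<mu> C p b \<epsilon>]) auto
    also have "\<dots> = ennreal (2 powr (real m * t) *
        (\<epsilon> * (\<mu> m k)\<^sup>2 + \<mu> m k * (b * (C * 2 powr - (real (max m n) * s)) / p)))"
      using \<epsilon> nn b C p by (intro ennreal_mult[symmetric]) auto
    also have "2 powr (real m * t) * (\<epsilon> * (\<mu> m k)\<^sup>2 + \<mu> m k * (b * (C * 2 powr - (real (max m n) * s)) / p))
        = \<epsilon> * (2 powr (real m * t) * (\<mu> m k)\<^sup>2) +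
          \<mu> m k * (b * C / p) * (2 powr (real m * t) * 2 powr - (real (max m n) * s))"
      by (simp add: algebra_simps)
    also have "ennreal \<dots> \<le> ennreal (\<epsilon> * (2 powr (real m * t) * (\<mu> m k)\<^sup>2) + \<mu> m k * (b * C / p) * (q ^ m * 2 powr - (real n * (s - t'))))"
      using nn b C p exps by (intro ennreal_leI add_left_mono mult_left_mono) auto
    also have "\<mu> m k * (b * C / p) * (q ^ m * 2 powr - (real n * (s - t'))) = \<mu> m k * (B * q ^ m)"
      by (simp add: B_def)
    also have "ennreal (\<epsilon> * (2 powr (real m * t) * (\<mu> m k)\<^sup>2) + \<mu> m k * (B * q ^ m))
        = ennreal \<epsilon> * ennreal (2 powr (real m * t) * (\<mu> m k)\<^sup>2) + ennreal (\<mu> m k * (B * q ^ m))"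
      using \<epsilon> nn B q by (simp add: ennreal_plus ennreal_mult)
    finally show ?thesis .
  qed
  have "(\<integral>\<^sup>+\<omega>. energy t (\<lambda>m k. thinned n \<omega> \<mu> m k - \<mu> m k) \<partial>M)
      = (\<Sum>m. \<Sum>k\<in>index_set m. \<integral>\<^sup>+\<omega>. ennreal (2 powr (real m * t) * (thinned n \<omega> \<mu> m k - \<mu> m k)\<^sup>2) \<partial>M)"
    unfolding energy_def using thinned_measurable[OF n]
    by (subst nn_integral_suminf) (auto simp: nn_integral_sum simp del: sum_ennreal)
  also have "\<dots> \<le> (\<Sum>m. \<Sum>k\<in>index_set m. ennreal \<epsilon> * ennreal (2 powr (real m * t) * (\<mu> m k)\<^sup>2) + ennreal (\<mu> m k * (B * q ^ m)))"
    by (intro suminf_le sum_mono bound) auto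
  also have "\<dots> = (\<Sum>m. ennreal \<epsilon> * (\<Sum>k\<in>index_set m. ennreal (2 powr (real m * t) * (\<mu> m k)\<^sup>2)) + ennreal (\<mu> 0 (\<lambda>_. 0) * B * q ^ m))"
  proof (intro arg_cong[where f = suminf] ext)
    fix m
    have "(\<Sum>k\<in>index_set m. ennreal (\<mu> m k * (B * q ^ m))) = ennreal (\<Sum>k\<in>index_set m. \<mu> m k * (B * q ^ m))"
      using nn B q by (intro sum_ennreal) auto
    also have "(\<Sum>k\<in>index_set m. \<mu> m k * (B * q ^ m)) = \<mu> 0 (\<lambda>_. 0) * B * q ^ m"
      by (simp add: sum_distrib_right[symmetric] total_mass[OF \<mu>])
    finally show "(\<Sum>k\<in>index_set m. ennreal \<epsilon> * ennreal (2 powr (real m * t) * (\<mu> m k)\<^sup>2) + ennreal (\<mu> m k * (B * q ^ m)))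
        = ennreal \<epsilon> * (\<Sum>k\<in>index_set m. ennreal (2 powr (real m * t) * (\<mu> m k)\<^sup>2)) + ennreal (\<mu> 0 (\<lambda>_. 0) * B * q ^ m)"
      by (simp add: sum.distrib sum_distrib_left del: sum_ennreal)
  qed
  also have "\<dots> = ennreal \<epsilon> * energy t \<mu> + (\<Sum>m. ennreal (\<mu> 0 (\<lambda>_. 0) * B * q ^ m))"
    unfolding energy_def by (subst suminf_add[symmetric]) auto
  also have "(\<Sum>m. ennreal (\<mu> 0 (\<lambda>_. 0) * B * q ^ m)) = ennreal (\<mu> 0 (\<lambda>_. 0) * B / (1 - q))"
    using nn B q by (intro ennreal_geometric_suminf) auto
  finally show ?thesis
    by (simp add: B_def q_def)
qed

end

text \<open>The deviation at the root is one term of the energy of the difference, which settles the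
  mass. For the energy, \<open>(x + y)\<^sup>2 \<le> (1 + \<tau>) * x\<^sup>2 + (1 + 1 / \<tau>) *
  y\<^sup>2\<close> is summed over all cells. Strict bounds are reproduced with the same
  \<open>a\<close> and \<open>b\<close>, so the step can be repeated forever with a tolerance that
  depends on the current distribution.\<close>

lemma energy_perturbation:
  assumes \<mu>: "a < \<mu> 0 (\<lambda>_. 0)" "energy t \<mu> < ennreal b"
  obtains \<eta> where "0 < \<eta>"
    "\<And>\<nu>. energy t (\<lambda>m k. \<nu> m k - \<mu> m k) < ennreal \<eta> \<Longrightarrow> a < \<nu> 0 (\<lambda>_. 0) \<and> energy t \<nu> < ennreal b"
proof -
  obtain E where E: "energy t \<mu> = ennreal E" "0 \<le> E"
    using \<mu>(2) by (cases "energy t \<mu>") auto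
  have Eb: "E < b" and b: "0 < b"
    using \<mu>(2) E by (auto simp: ennreal_less_iff)
  \<comment> \<open>Chosen so that \<open>\<tau> * E\<close> uses at most half of the gap
    \<open>b - E\<close>; \<open>E + 1\<close> keeps the denominator positive when
    \<open>E = 0\<close>.\<close>
  define \<tau> where "\<tau> = (b - E) / (2 * (E + 1))"
  have \<tau>: "0 < \<tau>"
    using Eb E(2) by (simp add: \<tau>_def)
  have "(1 + \<tau>) * E \<le> E + (b - E) / 2"
  proof -
    have "\<tau> * E \<le> \<tau> * (E + 1)"
      using \<tau> by simp
    also have "\<dots> = (b - E) / 2"
      using E(2) by (simp add: \<tau>_def field_simps)
    finally show ?thesis
      by (simp add: algebra_simps)
  qed
  moreover have "E + (b - E) / 2 < b"
    using Eb by (simp add: field_simps)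
  ultimately have E2: "(1 + \<tau>) * E < b"
    by (rule order_le_less_trans)
  \<comment> \<open>The first entry protects the mass; the second makes the deviation term use at
    most half of the gap that \<tau> has left.\<close>
  define \<eta> where "\<eta> = min ((\<mu> 0 (\<lambda>_. 0) - a)\<^sup>2) ((b - (1 + \<tau>) * E) / (2 * (1 + 1 / \<tau>)))"
  have \<eta>: "0 < \<eta>"
    using \<mu>(1) E2 \<tau> by (auto simp: \<eta>_def add_pos_pos)
  show ?thesis
  proof (rule that[OF \<eta>], rule conjI)
    fix \<nu> :: "nat \<Rightarrow> ('a \<Rightarrow> int) \<Rightarrow> real"
    assume dev: "energy t (\<lambda>m k. \<nu> m k - \<mu> m k) < ennreal \<eta>"
    let ?z = "\<lambda>_. 0 :: int"
    have "(\<Sum>(m, k)\<in>{(0 :: nat, ?z)}. ennreal (2 powr (real m * t) * (\<nu> m k - \<mu> m k)\<^sup>2)) \<le> energy t (\<lambda>m k. \<nu> m k - \<mu> m k)"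
      by (rule sum_le_energy) (auto simp: index_set_0)
    then have "ennreal ((\<nu> 0 ?z - \<mu> 0 ?z)\<^sup>2) < ennreal \<eta>"
      using dev by simp
    then have "(\<nu> 0 ?z - \<mu> 0 ?z)\<^sup>2 < (\<mu> 0 ?z - a)\<^sup>2"
      using \<eta> by (simp add: ennreal_less_iff \<eta>_def)
    then have "\<bar>\<nu> 0 ?z - \<mu> 0 ?z\<bar> < \<mu> 0 ?z - a"
      using \<mu>(1) by (metis abs_le_square_iff abs_of_pos diff_gt_0_iff_gt not_less)
    then show "a < \<nu> 0 ?z"
      by linarith
    have sq: "(\<nu> m k)\<^sup>2 \<le> (1 + \<tau>) * (\<mu> m k)\<^sup>2 + (1 + 1 / \<tau>) * (\<nu> m k - \<mu> m k)\<^sup>2" for m k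
    proof -
      define x y where "x = \<mu> m k" and "y = \<nu> m k - \<mu> m k"
      have "0 \<le> (\<tau> * x - y)\<^sup>2 / \<tau>"
        using \<tau> by simp
      also have "\<dots> = \<tau> * x\<^sup>2 - 2 * x * y + y\<^sup>2 / \<tau>"
        using \<tau> by (simp add: power2_eq_square field_simps)
      finally have "(x + y)\<^sup>2 \<le> (1 + \<tau>) * x\<^sup>2 + (1 + 1 / \<tau>) * y\<^sup>2"
        by (simp add: power2_eq_square algebra_simps)
      then show ?thesis
        by (simp add: x_def y_def)
    qed
    have "energy t \<nu> \<le> (\<Sum>m. \<Sum>k\<in>index_set m. ennreal (1 + \<tau>) * ennreal (2 powr (real m * t) * (\<mu> m k)\<^sup>2) +
        ennreal (1 + 1 / \<tau>) * ennreal (2 powr (real m * t) * (\<nu> m k - \<mu> m k)\<^sup>2))"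
      unfolding energy_def
    proof (intro suminf_le sum_mono)
      fix m :: nat and k :: "'a \<Rightarrow> int"
      have "2 powr (real m * t) * (\<nu> m k)\<^sup>2 \<le> 2 powr (real m * t) * ((1 + \<tau>) * (\<mu> m k)\<^sup>2 + (1 + 1 / \<tau>) * (\<nu> m k - \<mu> m k)\<^sup>2)"
        by (intro mult_left_mono sq) simp
      also have "\<dots> = (1 + \<tau>) * (2 powr (real m * t) * (\<mu> m k)\<^sup>2) + (1 + 1 / \<tau>) * (2 powr (real m * t) * (\<nu> m k - \<mu> m k)\<^sup>2)"
        by (simp add: algebra_simps)
      finally show "ennreal (2 powr (real m * t) * (\<nu> m k)\<^sup>2) \<le> ennreal (1 + \<tau>) * ennreal (2 powr (real m * t) * (\<mu> m k)\<^sup>2) +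
        ennreal (1 + 1 / \<tau>) * ennreal (2 powr (real m * t) * (\<nu> m k - \<mu> m k)\<^sup>2)"
        using \<tau> by (subst ennreal_mult[symmetric], simp, simp)+ (simp add: ennreal_plus[symmetric] ennreal_leI del: ennreal_plus)
    qed auto
    also have "\<dots> = ennreal (1 + \<tau>) * energy t \<mu> + ennreal (1 + 1 / \<tau>) * energy t (\<lambda>m k. \<nu> m k - \<mu> m k)"
      unfolding energy_def
      by (simp add: sum.distrib sum_distrib_left[symmetric] suminf_add[symmetric] del: sum_ennreal ennreal_plus)
    also have "\<dots> \<le> ennreal (1 + \<tau>) * ennreal E + ennreal (1 + 1 / \<tau>) * ennreal \<eta>"
      using dev E(1) by (intro add_mono mult_left_mono) auto
    also have "\<dots> = ennreal ((1 + \<tau>) * E + (1 + 1 / \<tau>) * \<eta>)"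
      using \<tau> E(2) \<eta> by (simp add: ennreal_mult[symmetric] ennreal_plus[symmetric] del: ennreal_plus)
    also have "\<dots> < ennreal b"
    proof (rule ennreal_lessI[OF b])
      have "(1 + 1 / \<tau>) * \<eta> \<le> (1 + 1 / \<tau>) * ((b - (1 + \<tau>) * E) / (2 * (1 + 1 / \<tau>)))"
        using \<tau> by (intro mult_left_mono) (auto simp: \<eta>_def)
      also have "\<dots> = (b - (1 + \<tau>) * E) / 2"
      proof -
        have "1 + 1 / \<tau> \<noteq> 0"
          using \<tau> by (simp add: add_pos_pos less_imp_neq[symmetric])
        then show ?thesis
          by (metis mult.commute times_divide_eq_right mult_divide_mult_cancel_left)
      qed
      finally have "(1 + 1 / \<tau>) * \<eta> \<le> (b - (1 + \<tau>) * E) / 2" .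
      moreover have "x \<le> (b - c) / 2 \<Longrightarrow> c < b \<Longrightarrow> c + x < b" for x c :: real
        by simp
      ultimately show "(1 + \<tau>) * E + (1 + 1 / \<tau>) * \<eta> < b"
        using E2 by blast
    qed
    finally show "energy t \<nu> < ennreal b" .
  qed
qed

lemma frostman_bound_reweight:
  assumes \<mu>: "mass_distribution \<mu>" "frostman_bound s \<mu>" and w: "\<And>j. 0 \<le> w j" "\<And>j. j \<notin> index_set n \<Longrightarrow> w j = 0"
  shows "frostman_bound s (reweight n w \<mu>)"
proof -
  note nn = mass_distribution_nonneg[OF \<mu>(1)]
  obtain C where C: "0 \<le> C" "\<And>m k. k \<in> index_set m \<Longrightarrow> \<mu> m k \<le> C * 2 powr - (real m * s)"
    using \<mu>(2) by (auto simp: frostman_bound_def)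
  define W where "W = sum w (index_set n)"
  have W: "0 \<le> W"
    using w by (auto simp: W_def intro: sum_nonneg)
  have wW: "w j \<le> W" for j
  proof (cases "j \<in> index_set n")
    case True
    then show ?thesis
      unfolding W_def using w by (intro member_le_sum) auto
  next
    case False
    then show ?thesis
      using w W by simp
  qed
  have "reweight n w \<mu> m k \<le> (W * C) * 2 powr - (real m * s)" if "k \<in> index_set m" for m k
  proof -
    have "reweight n w \<mu> m k \<le> W * \<mu> m k"
      by (rule reweight_le[OF \<mu>(1) wW that])
    also have "\<dots> \<le> W * (C * 2 powr - (real m * s))"
      by (intro mult_left_mono C W that)
    finally show ?thesis
      by simp
  qed
  moreover have "0 \<le> W * C"
    using W C by simp
  ultimately show ?thesis
    unfolding frostman_bound_def by blast
qed

section \<open>Orders at which thinning changes a mass distribution little\<close>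

context limsup_random_fractal
begin

text \<open>As \<open>index2\<close> is defined by a limsup, the lower bound on the probabilities
  holds at infinitely many orders only, whereas the bound on correlated cubes holds at all large
  ones; the two can thus be met simultaneously.\<close>

lemma frequently_prob_ge:
  assumes "index2 M Z < ereal \<gamma>"
  shows "\<exists>\<^sub>F n in sequentially. 1 \<le> n \<and> (\<forall>j\<in>index_set n. 2 powr - (real n * \<gamma>) \<le> P n j)"
proof -
  let ?m = "\<lambda>n. MIN Q\<in>dyadic_cubes n. cube_prob M Z n Q"
  have lim: "ereal (- \<gamma>) < limsup (\<lambda>n. elog2 (?m n) / ereal (real n))"
    using assms unfolding index2_def by (simp add: ereal_uminus_less_reorder)
  have "\<exists>\<^sub>F n in sequentially. ereal (- \<gamma>) < elog2 (?m n) / ereal (real n)"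
  proof (rule ccontr)
    assume "\<not> ?thesis"
    then have "\<forall>\<^sub>F n in sequentially. elog2 (?m n) / ereal (real n) \<le> ereal (- \<gamma>)"
      by (simp add: not_frequently not_less)
    then have "limsup (\<lambda>n. elog2 (?m n) / ereal (real n)) \<le> ereal (- \<gamma>)"
      by (rule Limsup_bounded)
    with lim show False
      by simp
  qed
  then have "\<exists>\<^sub>F n in sequentially. ereal (- \<gamma>) < elog2 (?m n) / ereal (real n) \<and> 1 \<le> n"
    by (rule frequently_eventually_frequently) (rule eventually_ge_at_top)
  then show ?thesis
  proof (rule frequently_elim1, safe)
    fix n :: nat and j :: "'n \<Rightarrow> int"
    assume n: "1 \<le> n" and less: "ereal (- \<gamma>) < elog2 (?m n) / ereal (real n)" and j: "j \<in> index_set n"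
    have "0 \<le> ?m n"
      by (subst Min_ge_iff) (auto simp: finite_dyadic_cubes dyadic_cubes_nonempty cube_prob_def)
    then have "2 powr (- \<gamma> * real n) < ?m n"
      using n by (intro elog2_div_gtD[OF less]) auto
    also have "?m n \<le> P n j"
      unfolding P_def using j by (intro Min_le) (auto simp: finite_dyadic_cubes dyadic_cubes_eq)
    finally show "2 powr - (real n * \<gamma>) \<le> P n j"
      by (simp add: mult.commute)
  qed
qed

lemma index2_nonneg: "0 \<le> index2 M Z"
proof (rule ccontr)
  assume neg: "\<not> 0 \<le> index2 M Z"
  then have "index2 M Z < ereal 0"
    by (simp add: zero_ereal_def)
  then obtain g where g: "index2 M Z < g" "g < ereal 0"
    using dense by blast
  then obtain g' where g': "g = ereal g'"
    by (cases g) auto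
  then have "\<exists>\<^sub>F n in sequentially. 1 \<le> n \<and> (\<forall>j\<in>index_set n. 2 powr - (real n * g') \<le> P n j)"
    using g by (intro frequently_prob_ge) simp
  then obtain n where n: "1 \<le> n" "\<forall>j\<in>index_set n. 2 powr - (real n * g') \<le> P n j"
    by (auto dest: frequently_ex)
  have "(\<lambda>_. 0) \<in> index_set n"
    by (simp add: index_set_def)
  with n(2) have "2 powr - (real n * g') \<le> P n (\<lambda>_. 0)"
    by blast
  also have "\<dots> \<le> 1"
    by (simp add: P_def cube_prob_def)
  also have "1 < 2 powr - (real n * g')"
    using n(1) g g' by (simp add: mult_pos_neg)
  finally show False
    by simp
qed

lemma eventually_correlated_count_le:
  assumes "correlation_condition M Z 0" "0 < \<epsilon>" "0 < \<kappa>"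
  shows "\<forall>\<^sub>F n in sequentially. real (correlated_count M Z n \<epsilon>) \<le> 2 powr (real n * \<kappa>)"
proof -
  have "limsup (\<lambda>n. elog2 (real (correlated_count M Z n \<epsilon>)) / ereal (real n)) \<le> ereal 0"
    using assms(1,2) unfolding correlation_condition_def by blast
  also have "\<dots> < ereal \<kappa>"
    using assms(3) by simp
  finally have "\<forall>\<^sub>F n in sequentially. elog2 (real (correlated_count M Z n \<epsilon>)) / ereal (real n) < ereal \<kappa>"
    by (rule Limsup_lessD)
  then show ?thesis
    using eventually_gt_at_top[of 0]
  proof eventually_elim
    case (elim n)
    then show ?case
      using elog2_div_ltD[of "real (correlated_count M Z n \<epsilon>)" n \<kappa>] by (simp add: mult.commute)
  qed
qed

text \<open>The event that every deviation from order \<open>N\<close> on is at least \<eta> is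
  contained in the corresponding event for any single such order. Markov's inequality at one
  well-chosen order makes its probability at most \<delta>, for every \<delta>.\<close>

lemma infinitely_often_small_deviation:
  assumes corr: "correlation_condition M Z 0" and ind: "index2 M Z < ereal (s - t)" and t: "0 < t"
    and \<mu>: "mass_distribution \<mu>" "frostman_bound s \<mu>" and \<eta>: "0 < \<eta>"
  shows "AE \<omega> in M. \<exists>n\<ge>N. 1 \<le> n \<and> energy t (\<lambda>m k. thinned n \<omega> \<mu> m k - \<mu> m k) < ennreal \<eta>"
proof -
  note nn = mass_distribution_nonneg[OF \<mu>(1)]
  obtain \<gamma>' where \<gamma>': "index2 M Z < \<gamma>'" "\<gamma>' < ereal (s - t)"
    using dense[OF ind] by blast
  obtain \<gamma> where \<gamma>: "\<gamma>' = ereal \<gamma>"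
    using \<gamma>' index2_nonneg by (cases \<gamma>') auto
  have \<gamma>0: "0 < \<gamma>" "\<gamma> < s - t"
    using \<gamma>' \<gamma> order_le_less_trans[OF index2_nonneg, of \<gamma>'] by auto
  \<comment> \<open>The gap \<open>s - t - \<gamma>\<close> is split into thirds: one raises
    \<open>t\<close> to \<open>t'\<close>, one absorbs the correlated cubes, and the last remains as
    the rate of decay in \<open>n\<close>.\<close>
  define \<kappa> where "\<kappa> = (s - t - \<gamma>) / 3"
  define t' where "t' = t + \<kappa>"
  have \<kappa>: "0 < \<kappa>" and t': "t < t'" "t' \<le> s" "0 \<le> t'" and exps: "s - t' - \<gamma> - \<kappa> = \<kappa>"
    using \<gamma>0 t by (auto simp: \<kappa>_def t'_def field_simps)
  obtain C where C: "0 \<le> C" "\<And>m k. k \<in> index_set m \<Longrightarrow> \<mu> m k \<le> C * 2 powr - (real m * s)"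
    using \<mu>(2) by (auto simp: frostman_bound_def)
  obtain E where E: "energy t \<mu> = ennreal E" "0 \<le> E"
    using energy_finite[OF \<mu>, of t] \<gamma>0 by (cases "energy t \<mu>") auto
  define D where "D n \<omega> = energy t (\<lambda>m k. thinned n \<omega> \<mu> m k - \<mu> m k)" for n \<omega>
  define B where "B = {\<omega> \<in> space M. \<forall>n\<in>{n. N \<le> n \<and> 1 \<le> n}. ennreal \<eta> \<le> D n \<omega>}"
  have D_meas: "D n \<in> borel_measurable M" if "1 \<le> n" for n
    unfolding D_def by (rule energy_deviation_measurable[OF that])
  have B_meas: "B \<in> events"
  proof -
    have "{\<omega> \<in> space M. ennreal \<eta> \<le> D n \<omega>} \<in> events" if "1 \<le> n" for n
      using D_meas[OF that] by measurable
    then show ?thesis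
      unfolding B_def by (intro sets.sets_Collect_countable_All') auto
  qed
  define R where "R = \<mu> 0 (\<lambda>_. 0) * C / (1 - 2 powr - (t' - t))"
  have "2 powr - (t' - t) < 1"
    using t' by (simp add: powr_less_one)
  then have R: "0 \<le> R"
    using nn C by (auto simp: R_def)
  have small: "emeasure M B \<le> 0 + ennreal \<delta>" if \<delta>: "0 < \<delta>" for \<delta>
  proof -
    \<comment> \<open>Half of the budget \<open>\<delta> * \<eta>\<close> goes to the uncorrelated
      part \<open>\<epsilon> * E\<close>, the other half to the term decaying in \<open>n\<close>;
      \<open>E + 1\<close> avoids a zero denominator.\<close>
    define \<epsilon> where "\<epsilon> = \<delta> * \<eta> / (2 * (E + 1))"
    have \<epsilon>: "0 < \<epsilon>"
      using \<delta> \<eta> E by (simp add: \<epsilon>_def)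
    have "2 powr - \<kappa> < 1"
      using \<kappa> by (simp add: powr_less_one)
    then have "(\<lambda>n. R * (2 powr - \<kappa>) ^ n) \<longlonglongrightarrow> R * 0"
      by (intro tendsto_mult tendsto_const LIMSEQ_power_zero) auto
    then have "\<forall>\<^sub>F n in sequentially. R * (2 powr - \<kappa>) ^ n < \<delta> * \<eta> / 2"
      using \<delta> \<eta> by (intro order_tendstoD(2)) auto
    moreover have "\<forall>\<^sub>F n in sequentially. real (correlated_count M Z n \<epsilon>) \<le> 2 powr (real n * \<kappa>)"
      by (rule eventually_correlated_count_le[OF corr \<epsilon> \<kappa>])
    ultimately have "\<forall>\<^sub>F n in sequentially. R * (2 powr - \<kappa>) ^ n < \<delta> * \<eta> / 2 \<and>
        real (correlated_count M Z n \<epsilon>) \<le> 2 powr (real n * \<kappa>) \<and> N \<le> n"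
      by (intro eventually_conj eventually_ge_at_top)
    then have "\<exists>\<^sub>F n in sequentially. (1 \<le> n \<and> (\<forall>j\<in>index_set n. 2 powr - (real n * \<gamma>) \<le> P n j)) \<and>
        R * (2 powr - \<kappa>) ^ n < \<delta> * \<eta> / 2 \<and> real (correlated_count M Z n \<epsilon>) \<le> 2 powr (real n * \<kappa>) \<and> N \<le> n"
      using \<gamma>'(1) unfolding \<gamma> by (intro frequently_eventually_frequently frequently_prob_ge)
    then obtain n where n: "1 \<le> n" "\<And>j. j \<in> index_set n \<Longrightarrow> 2 powr - (real n * \<gamma>) \<le> P n j"
        "R * (2 powr - \<kappa>) ^ n < \<delta> * \<eta> / 2" "real (correlated_count M Z n \<epsilon>) \<le> 2 powr (real n * \<kappa>)" "N \<le> n"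
      by (auto dest: frequently_ex)
    have "(\<integral>\<^sup>+\<omega>. D n \<omega> \<partial>M) \<le> ennreal \<epsilon> * energy t \<mu> +
        ennreal (\<mu> 0 (\<lambda>_. 0) * (2 powr (real n * \<kappa>) * C * 2 powr - (real n * (s - t')) / 2 powr - (real n * \<gamma>)) / (1 - 2 powr - (t' - t)))"
      unfolding D_def using \<kappa> \<epsilon>
      by (intro thinned_energy_deviation[OF n(1) \<mu>(1) C _ n(2) _ n(4) _ t']) (auto simp: ge_one_powr_ge_zero)
    also have "\<mu> 0 (\<lambda>_. 0) * (2 powr (real n * \<kappa>) * C * 2 powr - (real n * (s - t')) / 2 powr - (real n * \<gamma>)) / (1 - 2 powr - (t' - t))
        = R * (2 powr (real n * \<kappa>) * 2 powr - (real n * (s - t')) / 2 powr - (real n * \<gamma>))"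
      by (simp add: R_def ac_simps)
    also have "2 powr (real n * \<kappa>) * 2 powr - (real n * (s - t')) / 2 powr - (real n * \<gamma>) = (2 powr - \<kappa>) ^ n"
    proof -
      have "2 powr (real n * \<kappa>) * 2 powr - (real n * (s - t')) / 2 powr - (real n * \<gamma>)
          = 2 powr (real n * \<kappa> + - (real n * (s - t')) - - (real n * \<gamma>))"
        by (simp only: powr_add powr_diff)
      also have "real n * \<kappa> + - (real n * (s - t')) - - (real n * \<gamma>) = - \<kappa> * real n"
        using arg_cong[OF exps, of "\<lambda>x. real n * x"] by (simp add: algebra_simps)
      also have "2 powr (- \<kappa> * real n) = (2 powr - \<kappa>) ^ n"
        by (subst powr_realpow[symmetric]) (simp_all add: powr_powr)
      finally show ?thesis .
    qed
    also have "ennreal \<epsilon> * energy t \<mu> + ennreal (R * (2 powr - \<kappa>) ^ n) = ennreal (\<epsilon> * E + R * (2 powr - \<kappa>) ^ n)"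
      using \<epsilon> E R by (simp add: ennreal_mult ennreal_plus)
    also have "\<dots> \<le> ennreal (\<delta> * \<eta>)"
    proof (rule ennreal_leI)
      have "\<epsilon> * E \<le> \<epsilon> * (E + 1)"
        using \<epsilon> by simp
      also have "\<dots> = \<delta> * \<eta> / 2"
      proof -
        have "x / (2 * y) * y = x / 2" if "0 < y" for x y :: real
          using that by simp
        from this[of "E + 1" "\<delta> * \<eta>"] E(2) show ?thesis
          unfolding \<epsilon>_def by linarith
      qed
      finally show "\<epsilon> * E + R * (2 powr - \<kappa>) ^ n \<le> \<delta> * \<eta>"
        using n(3) by linarith
    qed
    finally have exp: "(\<integral>\<^sup>+\<omega>. D n \<omega> \<partial>M) \<le> ennreal (\<delta> * \<eta>)" .
    have "ennreal \<eta> * emeasure M B = (\<integral>\<^sup>+\<omega>. ennreal \<eta> * indicator B \<omega> \<partial>M)"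
      using B_meas by (simp add: nn_integral_cmult_indicator)
    also have "\<dots> \<le> (\<integral>\<^sup>+\<omega>. D n \<omega> \<partial>M)"
      using n(1,5) by (intro nn_integral_mono) (auto simp: B_def indicator_def)
    also have "\<dots> \<le> ennreal \<eta> * ennreal \<delta>"
      using exp \<eta> \<delta> by (simp add: ennreal_mult[symmetric] mult.commute)
    finally show ?thesis
      using \<eta> by (simp add: ennreal_mult_le_mult_iff)
  qed
  have "emeasure M B \<le> 0"
    by (rule ennreal_le_epsilon) (rule small)
  then have "B \<in> null_sets M"
    using B_meas by auto
  then show ?thesis
  proof (rule AE_I')
    show "{\<omega> \<in> space M. \<not> (\<exists>n\<ge>N. 1 \<le> n \<and> energy t (\<lambda>m k. thinned n \<omega> \<mu> m k - \<mu> m k) < ennreal \<eta>)} \<subseteq> B"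
      by (auto simp: B_def D_def not_less)
  qed
qed

end

section \<open>Dimension of the limsup set from below\<close>

lemma closed_level_set: "closed (level_set Z n \<omega>)"
  unfolding level_set_def
  by (intro closed_Union finite_subset[OF _ finite_dyadic_cubes]) (auto simp: dyadic_cubes_eq dyadic_cube_def)

context limsup_random_fractal
begin

text \<open>Here \<open>S\<close> ranges over all sets of cells, not only over the retained ones, so
  the family does not depend on \<omega> and one almost sure statement can be made about all its
  members.\<close>

primrec generation :: "(nat \<Rightarrow> ('n \<Rightarrow> int) \<Rightarrow> real) \<Rightarrow> nat \<Rightarrow> (nat \<Rightarrow> ('n \<Rightarrow> int) \<Rightarrow> real) set" where
  "generation \<mu> 0 = {\<mu>}"
| "generation \<mu> (Suc i) = (\<Union>\<nu>\<in>generation \<mu> i. \<Union>n. (\<lambda>S. reweight n (inverse_prob n S) \<nu>) ` Pow (index_set n))"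

lemma countable_generation: "countable (generation \<mu> i)"
proof (induction i)
  case (Suc i)
  have "countable (Pow (index_set n :: ('n \<Rightarrow> int) set))" for n
    by (intro countable_finite) simp
  then show ?case
    using Suc unfolding generation.simps by (intro countable_UN countable_image) auto
qed simp

lemma thinned_in_generation: "\<nu> \<in> generation \<mu> i \<Longrightarrow> thinned n \<omega> \<nu> \<in> generation \<mu> (Suc i)"
  by (auto simp: retained_def)

lemma generation_mass_distribution:
  assumes "mass_distribution \<mu>" "frostman_bound s \<mu>" "\<nu> \<in> generation \<mu> i"
  shows "mass_distribution \<nu> \<and> frostman_bound s \<nu>"
  using assms(3)
proof (induction i arbitrary: \<nu>)
  case 0
  then show ?case
    using assms by simp
next
  case (Suc i)
  then obtain \<nu>' n S where \<nu>': "\<nu>' \<in> generation \<mu> i" "S \<subseteq> index_set n" "\<nu> = reweight n (inverse_prob n S) \<nu>'"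
    by auto
  show ?case
  proof -
    have "inverse_prob n S j = 0" if "j \<notin> index_set n" for j
      using that \<nu>'(2) by (auto simp: inverse_prob_def indicator_def)
    with Suc.IH[OF \<nu>'(1)] inverse_prob_nonneg show ?thesis
      unfolding \<nu>'(3) by (auto intro!: mass_distribution_reweight frostman_bound_reweight)
  qed
qed

text \<open>The quantifiers over \<open>E\<close> and \<open>r\<close> stand inside the almost sure
  statement. A single null set then serves every superset and every order up to \<open>t\<close>,
  including order 0, where the conclusion says that the intersection is nonempty.\<close>

lemma hausdorff_measure_limsup_fractal_nonzero:
  assumes corr: "correlation_condition M Z 0" and ind: "index2 M Z < ereal (s - t)" and t: "0 < t"
    and K: "compact K" "K \<subseteq> cbox 0 1"
    and \<mu>: "mass_distribution \<mu>" "frostman_bound s \<mu>" "carried_by \<mu> K" "0 < \<mu> 0 (\<lambda>_. 0)"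
  shows "AE \<omega> in M. \<forall>E r. limsup_fractal Z \<omega> \<inter> K \<subseteq> E \<longrightarrow> 0 \<le> r \<longrightarrow> r \<le> t \<longrightarrow> hausdorff_measure r E \<noteq> 0"
proof -
  define Fam where "Fam = (\<Union>i. generation \<mu> i)"
  have Fam: "mass_distribution \<nu>" "frostman_bound s \<nu>" if "\<nu> \<in> Fam" for \<nu>
    using that generation_mass_distribution[OF \<mu>(1,2)] by (auto simp: Fam_def)
  have "countable Fam"
    unfolding Fam_def by (intro countable_UN countable_generation) auto
  then have "AE \<omega> in M. \<forall>\<nu>\<in>Fam. \<forall>N l. \<exists>n\<ge>N. 1 \<le> n \<and>
      energy t (\<lambda>m k. thinned n \<omega> \<nu> m k - \<nu> m k) < ennreal (1 / real (Suc l))"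
    using infinitely_often_small_deviation[OF corr ind t] Fam by (simp add: AE_ball_countable AE_all_countable)
  then show ?thesis
  proof (rule eventually_mono, intro allI impI)
    fix \<omega> r and E :: "(real ^ 'n) set"
    assume small: "\<forall>\<nu>\<in>Fam. \<forall>N l. \<exists>n\<ge>N. 1 \<le> n \<and>
      energy t (\<lambda>m k. thinned n \<omega> \<nu> m k - \<nu> m k) < ennreal (1 / real (Suc l))"
      and E: "limsup_fractal Z \<omega> \<inter> K \<subseteq> E" and r: "0 \<le> r" "r \<le> t"
    \<comment> \<open>Half of the initial mass, and below the initial energy plus one, leave the
      strict room that \<open>energy_perturbation\<close> requires.\<close>
    define a where "a = \<mu> 0 (\<lambda>_. 0) / 2"
    have a: "0 < a" "a < \<mu> 0 (\<lambda>_. 0)"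
      using \<mu>(4) by (auto simp: a_def)
    have "t < s"
      using t order_le_less_trans[OF index2_nonneg ind] by simp
    then have "energy t \<mu> < top"
      by (rule energy_finite[OF \<mu>(1,2)])
    then obtain e where "energy t \<mu> = ennreal e" "0 \<le> e"
      by (cases "energy t \<mu>") auto
    then have b: "energy t \<mu> < ennreal (e + 1)"
      by (simp add: ennreal_less_iff)
    \<comment> \<open>A state is a distribution, its compact carrier and the last order used. The
      order is kept only to make the chosen orders increase strictly, so that a point in all
      carriers lies in infinitely many level sets.\<close>
    define inv where "inv = (\<lambda>(\<nu>, X, n :: nat). \<nu> \<in> Fam \<and> a < \<nu> 0 (\<lambda>_. 0) \<and> energy t \<nu> < ennreal (e + 1) \<and>
      carried_by \<nu> X \<and> compact X \<and> X \<subseteq> K)"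
    define next_state where "next_state = (\<lambda>(\<nu> :: nat \<Rightarrow> ('n \<Rightarrow> int) \<Rightarrow> real, X, n :: nat)
        (\<nu>' :: nat \<Rightarrow> ('n \<Rightarrow> int) \<Rightarrow> real, X', n'). n < n' \<and> X' = X \<inter> level_set Z n' \<omega>)"
    have "\<exists>f. \<forall>k. inv (f k) \<and> next_state (f k) (f (Suc k))"
    proof (rule dependent_nat_choice)
      have "\<mu> \<in> Fam"
        unfolding Fam_def by (rule UN_I[of 0]) auto
      then have "inv (\<mu>, K, 0)"
        using a b K(1) \<mu> by (simp add: inv_def)
      then show "\<exists>x. inv x"
        by blast
    next
      fix x k assume x: "inv x"
      obtain \<nu> X n where xeq: "x = (\<nu>, X, n)"
        by (cases x) auto
      have \<nu>: "\<nu> \<in> Fam" "a < \<nu> 0 (\<lambda>_. 0)" "energy t \<nu> < ennreal (e + 1)" "carried_by \<nu> X" "compact X" "X \<subseteq> K"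
        using x by (auto simp: inv_def xeq)
      obtain \<eta> where \<eta>: "0 < \<eta>" "\<And>\<nu>'. energy t (\<lambda>m k. \<nu>' m k - \<nu> m k) < ennreal \<eta> \<Longrightarrow>
          a < \<nu>' 0 (\<lambda>_. 0) \<and> energy t \<nu>' < ennreal (e + 1)"
        using energy_perturbation[OF \<nu>(2,3)] by blast
      obtain l where l: "1 / real (Suc l) < \<eta>"
        using nat_approx_posE[OF \<eta>(1)] by blast
      obtain n' where n': "Suc n \<le> n'" "energy t (\<lambda>m k. thinned n' \<omega> \<nu> m k - \<nu> m k) < ennreal (1 / real (Suc l))"
        using small \<nu>(1) by blast
      have "energy t (\<lambda>m k. thinned n' \<omega> \<nu> m k - \<nu> m k) < ennreal \<eta>"
        using n'(2) l by (meson ennreal_leI less_imp_le order_less_le_trans)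
      then have "a < thinned n' \<omega> \<nu> 0 (\<lambda>_. 0) \<and> energy t (thinned n' \<omega> \<nu>) < ennreal (e + 1)"
        by (rule \<eta>(2))
      moreover have "thinned n' \<omega> \<nu> \<in> Fam"
        using \<nu>(1) thinned_in_generation unfolding Fam_def by blast
      moreover have "carried_by (thinned n' \<omega> \<nu>) (X \<inter> level_set Z n' \<omega>)"
      proof (rule carried_by_reweight[OF Fam(1)[OF \<nu>(1)] \<nu>(4)])
        fix j assume "j \<in> index_set n'" "inverse_prob n' (retained n' \<omega>) j \<noteq> 0"
        then have "j \<in> index_set n'" "Z n' (dyadic_cube n' j) \<omega> = 1"
          by (auto simp: inverse_prob_def retained_def indicator_def split: if_splits)
        then show "dyadic_cube n' j \<subseteq> level_set Z n' \<omega>"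
          by (auto simp: level_set_def dyadic_cubes_eq)
      qed (use \<nu>(6) K(2) inverse_prob_nonneg in auto)
      moreover have "compact (X \<inter> level_set Z n' \<omega>)"
        using \<nu>(5) closed_level_set by (rule compact_Int_closed)
      ultimately have "inv (thinned n' \<omega> \<nu>, X \<inter> level_set Z n' \<omega>, n')"
        using \<nu>(6) by (auto simp: inv_def)
      moreover have "next_state x (thinned n' \<omega> \<nu>, X \<inter> level_set Z n' \<omega>, n')"
        using n'(1) by (simp add: next_state_def xeq)
      ultimately show "\<exists>y. inv y \<and> next_state x y"
        by blast
    qed
    then obtain f where f: "\<And>k. inv (f k)" "\<And>k. next_state (f k) (f (Suc k))"
      by blast
    define \<nu> where "\<nu> k = fst (f k)" for k
    define X where "X k = fst (snd (f k))" for k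
    define n where "n k = snd (snd (f k))" for k
    have inv: "\<nu> k \<in> Fam" "a < \<nu> k 0 (\<lambda>_. 0)" "energy t (\<nu> k) < ennreal (e + 1)" "carried_by (\<nu> k) (X k)"
      "compact (X k)" "X k \<subseteq> K" for k
      using f(1)[of k] by (auto simp: inv_def \<nu>_def X_def split: prod.splits)
    have nxt: "n k < n (Suc k)" "X (Suc k) = X k \<inter> level_set Z (n (Suc k)) \<omega>" for k
      using f(2)[of k] by (auto simp: next_state_def n_def X_def split: prod.splits)
    have n_ge: "k \<le> n k" for k
    proof (induction k)
      case (Suc k)
      then show ?case
        using nxt(1)[of k] by simp
    qed simp
    have "(\<Inter>k. X k) \<subseteq> limsup_fractal Z \<omega> \<inter> K"
    proof
      fix x assume x: "x \<in> (\<Inter>k. X k)"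
      have "\<exists>i\<ge>k. x \<in> level_set Z i \<omega>" for k
      proof -
        have "x \<in> X (Suc k)"
          using x by blast
        then have "x \<in> level_set Z (n (Suc k)) \<omega>"
          using nxt(2) by blast
        moreover have "k \<le> n (Suc k)"
          using n_ge[of "Suc k"] by simp
        ultimately show ?thesis
          by blast
      qed
      then have "x \<in> limsup_fractal Z \<omega>"
        by (auto simp: limsup_fractal_def)
      moreover have "x \<in> K"
        using x inv(6)[of 0] by blast
      ultimately show "x \<in> limsup_fractal Z \<omega> \<inter> K"
        by blast
    qed
    with E have sub: "(\<Inter>k. X k) \<subseteq> E"
      by blast
    show "hausdorff_measure r E \<noteq> 0"
    proof (rule hausdorff_measure_Inter_nonzero[where X = X and \<mu> = \<nu> and a = a and b = "e + 1" and t = t])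
      show "X (Suc k) \<subseteq> X k" for k
        using nxt(2) by blast
      show "X k \<subseteq> cbox 0 1" for k
        using inv(6)[of k] K(2) by blast
    qed (use inv Fam a r t sub in auto)
  qed
qed

end

section \<open>Covers of the limsup set\<close>

text \<open>The hypothesis of \<open>hausdorff_measure_eq_0I\<close> as a predicate, which makes
  countable unions a matter of joining covers. For \<open>s = 0\<close> every cube weighs 1, so the
  predicate then forces \<open>E\<close> to be empty.\<close>

definition dyadic_null :: "real \<Rightarrow> (real ^ 'n) set \<Rightarrow> bool" where
  "dyadic_null s E \<longleftrightarrow> (\<forall>N. \<forall>e>0. \<exists>C. (\<forall>(m, k)\<in>C. N \<le> m) \<and> E \<subseteq> (\<Union>(m, k)\<in>C. dyadic_cube m k) \<and>
     emeasure (node_measure s) C < ennreal e)"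

lemma dyadic_null_hausdorff_measure: "0 \<le> s \<Longrightarrow> dyadic_null s E \<Longrightarrow> hausdorff_measure s E = 0"
  unfolding dyadic_null_def by (rule hausdorff_measure_eq_0I) blast+

lemma dyadic_null_subset: "dyadic_null s E \<Longrightarrow> E' \<subseteq> E \<Longrightarrow> dyadic_null s E'"
  unfolding dyadic_null_def by (meson order_trans)

lemma dyadic_null_UN:
  fixes E :: "nat \<Rightarrow> (real ^ 'n) set"
  assumes "\<And>i. dyadic_null s (E i)"
  shows "dyadic_null s (\<Union>i. E i)"
  unfolding dyadic_null_def
proof (intro allI impI)
  fix N :: nat and e :: real
  assume e: "0 < e"
  have "\<exists>C. (\<forall>(m, k)\<in>C. N \<le> m) \<and> E i \<subseteq> (\<Union>(m, k)\<in>C. dyadic_cube m k) \<and>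
      emeasure (node_measure s) C < ennreal (e / 2 * (1 / 2) ^ Suc i)" for i
    using assms[of i] e unfolding dyadic_null_def by simp
  then obtain C where C: "\<And>i m k. (m, k) \<in> C i \<Longrightarrow> N \<le> m" "\<And>i. E i \<subseteq> (\<Union>(m, k)\<in>C i. dyadic_cube m k)"
      "\<And>i. emeasure (node_measure s) (C i) < ennreal (e / 2 * (1 / 2) ^ Suc i)"
    by (metis (no_types, lifting) case_prodD)
  have "emeasure (node_measure s) (\<Union>i. C i) \<le> (\<Sum>i. emeasure (node_measure s) (C i))"
    by (rule emeasure_subadditive_countably) auto
  also have "\<dots> \<le> (\<Sum>i. ennreal (e / 4 * (1 / 2) ^ i))"
    using C(3) by (intro suminf_le) (auto intro: less_imp_le)
  also have "\<dots> = ennreal (e / 2)"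
    using e by (subst ennreal_geometric_suminf) auto
  also have "\<dots> < ennreal e"
    using e by (simp add: ennreal_less_iff)
  finally have "emeasure (node_measure s) (\<Union>i. C i) < ennreal e" .
  moreover have "(\<Union>i. E i) \<subseteq> (\<Union>(m, k)\<in>(\<Union>i. C i). dyadic_cube m k)"
    using C(2) by blast
  moreover have "\<forall>(m, k)\<in>(\<Union>i. C i). N \<le> m"
    using C(1) by blast
  ultimately show "\<exists>C. (\<forall>(m, k)\<in>C. N \<le> m) \<and> (\<Union>i. E i) \<subseteq> (\<Union>(m, k)\<in>C. dyadic_cube m k) \<and>
      emeasure (node_measure s) C < ennreal e"
    by blast
qed

definition hit_cubes :: "nat \<Rightarrow> (real ^ 'n) set \<Rightarrow> ('n \<Rightarrow> int) set" where
  "hit_cubes n U = {k \<in> index_set n. dyadic_cube n k \<inter> U \<noteq> {}}"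

lemma finite_hit_cubes [simp]: "finite (hit_cubes n U)"
  by (simp add: hit_cubes_def)

text \<open>In some coordinate the indices differ by a nonzero multiple of 4, which leaves a gap of
  3 sides. Closed balls whose radius is one side, centred anywhere in the two cubes, are therefore
  disjoint.\<close>

lemma dyadic_cube_separated:
  assumes x: "x \<in> dyadic_cube n k" and y: "y \<in> dyadic_cube n l" and kl: "k \<noteq> l" "\<And>i. k i mod 4 = l i mod 4"
  shows "3 / 2 ^ n \<le> dist x y"
proof -
  obtain i where i: "k i \<noteq> l i"
    using kl(1) by auto
  have "4 dvd (k i - l i)"
    using kl(2)[of i] by (simp add: mod_eq_dvd_iff)
  then have "4 \<le> \<bar>k i - l i\<bar>"
    using i dvd_imp_le_int[of "k i - l i" 4] by simp
  then have d: "4 \<le> \<bar>real_of_int (k i) - of_int (l i)\<bar>"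
    by linarith
  have "of_int (k i) \<le> 2 ^ n * x $ i" "2 ^ n * x $ i \<le> of_int (k i) + 1"
    "of_int (l i) \<le> 2 ^ n * y $ i" "2 ^ n * y $ i \<le> of_int (l i) + 1"
    using x y by (auto simp: dyadic_cube_def mem_box_cart field_simps)
  with d have "3 \<le> \<bar>2 ^ n * x $ i - 2 ^ n * y $ i\<bar>"
    by linarith
  also have "\<dots> = 2 ^ n * \<bar>x $ i - y $ i\<bar>"
    by (simp add: right_diff_distrib[symmetric] abs_mult)
  finally have "3 / 2 ^ n \<le> \<bar>(x - y) $ i\<bar>"
    by (simp add: field_simps)
  also have "\<dots> \<le> dist x y"
    unfolding dist_norm by (rule component_le_norm_cart)
  finally show ?thesis .
qed

text \<open>Cubes whose indices agree modulo 4 are far enough apart to yield a packing.\<close>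

lemma packing_premeasure_hit_cubes:
  fixes U :: "(real ^ 'n) set"
  assumes fin: "packing_premeasure t U < top" and t: "0 \<le> t"
  obtains C where "0 \<le> C" "\<forall>\<^sub>F n in sequentially. real (card (hit_cubes n U)) \<le> C * 2 powr (real n * t)"
proof -
  obtain \<delta> where \<delta>: "0 < \<delta>" "(SUP F \<in> packings \<delta> U. \<Sum>\<^sub>\<infinity>(x, r)\<in>F. ennreal ((2 * r) powr t)) < top"
    using fin unfolding packing_premeasure_def INF_less_iff by auto
  then obtain C where C: "(SUP F \<in> packings \<delta> U. \<Sum>\<^sub>\<infinity>(x, r)\<in>F. ennreal ((2 * r) powr t)) = ennreal C" "0 \<le> C"
    by (cases "SUP F \<in> packings \<delta> U. \<Sum>\<^sub>\<infinity>(x, r)\<in>F. ennreal ((2 * r) powr t)") auto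
  have bound: "real (card (hit_cubes n U)) \<le> (4 ^ CARD('n) * C) * 2 powr (real n * t)" if n: "1 / 2 ^ n \<le> \<delta>" for n
  proof -
    \<comment> \<open>Each of the \<open>4 ^ CARD('n)\<close> residue classes gives its own packing,
      whence the factor in the bound. Centres are taken inside \<open>U\<close>, as packings of
      \<open>U\<close> demand.\<close>
    define T where "T \<rho> = {k \<in> hit_cubes n U. \<forall>i. k i mod 4 = \<rho> i}" for \<rho> :: "'n \<Rightarrow> int"
    have "\<forall>k\<in>hit_cubes n U. \<exists>x. x \<in> dyadic_cube n k \<inter> U"
      by (auto simp: hit_cubes_def)
    then obtain c where c: "\<And>k. k \<in> hit_cubes n U \<Longrightarrow> c k \<in> dyadic_cube n k \<inter> U"
      by metis
    have cardT: "real (card (T \<rho>)) \<le> C * 2 powr (real n * t)" for \<rho>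
    proof -
      define F where "F = (\<lambda>k. (c k, 1 / 2 ^ n :: real)) ` T \<rho>"
      have fT: "finite (T \<rho>)"
        by (simp add: T_def)
      have sep: "3 / 2 ^ n \<le> dist (c k) (c l)" if "k \<in> T \<rho>" "l \<in> T \<rho>" "k \<noteq> l" for k l
        using that c[of k] c[of l] by (intro dyadic_cube_separated[of _ n k _ l]) (auto simp: T_def)
      have inj: "inj_on (\<lambda>k. (c k, 1 / 2 ^ n :: real)) (T \<rho>)"
      proof (rule inj_onI, rule ccontr)
        fix k l assume "k \<in> T \<rho>" "l \<in> T \<rho>" "(c k, 1 / 2 ^ n :: real) = (c l, 1 / 2 ^ n)" "k \<noteq> l"
        then have "3 / 2 ^ n \<le> (0::real)"
          using sep[of k l] by simp
        moreover have "0 < 3 / (2 ^ n :: real)"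
          by simp
        ultimately show False
          by linarith
      qed
      have "disjoint_family_on (\<lambda>(x, r). cball x r) F"
        unfolding disjoint_family_on_def F_def
      proof (intro ballI impI)
        fix a b assume ab: "a \<in> (\<lambda>k. (c k, 1 / 2 ^ n :: real)) ` T \<rho>" "b \<in> (\<lambda>k. (c k, 1 / 2 ^ n)) ` T \<rho>" "a \<noteq> b"
        then obtain k l where kl: "k \<in> T \<rho>" "l \<in> T \<rho>" "a = (c k, 1 / 2 ^ n)" "b = (c l, 1 / 2 ^ n)" "k \<noteq> l"
          by auto
        have "(1 / 2 ^ n + 1 / 2 ^ n :: real) < 3 / 2 ^ n"
          by (simp add: field_simps)
        also have "\<dots> \<le> dist (c k) (c l)"
          using kl by (intro sep)
        finally have "cball (c k) (1 / 2 ^ n) \<inter> cball (c l) (1 / 2 ^ n) = {}"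
          by (rule disjoint_cballI)
        then show "(case a of (x, r) \<Rightarrow> cball x r) \<inter> (case b of (x, r) \<Rightarrow> cball x r) = {}"
          using kl by simp
      qed
      then have "F \<in> packings \<delta> U"
        using fT c n by (auto simp: packings_def F_def T_def intro!: countable_finite)
      then have "(\<Sum>\<^sub>\<infinity>(x, r)\<in>F. ennreal ((2 * r) powr t)) \<le> ennreal C"
        unfolding C(1)[symmetric] by (rule SUP_upper)
      moreover have "(\<Sum>\<^sub>\<infinity>(x, r)\<in>F. ennreal ((2 * r) powr t)) = (\<Sum>(x, r)\<in>F. ennreal ((2 * r) powr t))"
        using fT by (intro infsum_finite) (simp add: F_def)
      moreover have "\<dots> = (\<Sum>k\<in>T \<rho>. ennreal ((2 * (1 / 2 ^ n)) powr t))"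
        unfolding F_def using inj by (subst sum.reindex) auto
      moreover have "\<dots> = ennreal (real (card (T \<rho>)) * (2 * (1 / 2 ^ n)) powr t)"
        by (simp add: ennreal_mult' ennreal_of_nat_eq_real_of_nat)
      ultimately have "real (card (T \<rho>)) * (2 * (1 / 2 ^ n)) powr t \<le> C"
        using C(2) by (simp add: ennreal_le_iff)
      moreover have "2 powr - (real n * t) \<le> (2 * (1 / 2 ^ n)) powr t"
      proof -
        have "2 powr - (real n * t) = (1 / 2 ^ n) powr t"
          by (simp add: powr_divide powr_minus_divide powr_realpow[symmetric] powr_powr)
        also have "\<dots> \<le> (2 * (1 / 2 ^ n)) powr t"
          using t by (intro powr_mono2) (auto simp: divide_right_mono)
        finally show ?thesis .
      qed
      ultimately have "real (card (T \<rho>)) * 2 powr - (real n * t) \<le> C"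
        by (meson mult_left_mono of_nat_0_le_iff order_trans)
      then show ?thesis
        by (simp add: powr_minus_divide pos_divide_le_eq)
    qed
    let ?R = "PiE UNIV (\<lambda>_::'n. {0..<4::int})"
    have "hit_cubes n U \<subseteq> (\<Union>\<rho>\<in>?R. T \<rho>)"
    proof
      fix k assume "k \<in> hit_cubes n U"
      then have "k \<in> T (\<lambda>i. k i mod 4)"
        by (simp add: T_def)
      moreover have "(\<lambda>i. k i mod 4) \<in> ?R"
        by (simp add: PiE_UNIV_domain)
      ultimately show "k \<in> (\<Union>\<rho>\<in>?R. T \<rho>)"
        by blast
    qed
    then have "card (hit_cubes n U) \<le> card (\<Union>\<rho>\<in>?R. T \<rho>)"
      by (intro card_mono finite_UN_I finite_PiE) (auto simp: T_def)
    also have "\<dots> \<le> (\<Sum>\<rho>\<in>?R. card (T \<rho>))"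
      by (intro card_UN_le finite_PiE) auto
    finally have "real (card (hit_cubes n U)) \<le> (\<Sum>\<rho>\<in>?R. real (card (T \<rho>)))"
      by (simp only: of_nat_sum[symmetric] of_nat_le_iff)
    also have "\<dots> \<le> (\<Sum>\<rho>\<in>?R. C * 2 powr (real n * t))"
      by (intro sum_mono cardT)
    also have "\<dots> = (4 ^ CARD('n) * C) * 2 powr (real n * t)"
      by (simp add: card_PiE)
    finally show ?thesis .
  qed
  obtain N where "1 / \<delta> < 2 ^ N"
    using real_arch_pow[of 2 "1 / \<delta>"] by auto
  then have "1 / 2 ^ n \<le> \<delta>" if "n \<ge> N" for n
  proof -
    have "1 / 2 ^ n \<le> 1 / (2 ^ N :: real)"
      using that by (intro divide_left_mono) auto
    also have "\<dots> \<le> \<delta>"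
      using \<open>1 / \<delta> < 2 ^ N\<close> \<delta>(1) by (simp add: field_simps)
    finally show ?thesis .
  qed
  then have "\<forall>\<^sub>F n in sequentially. real (card (hit_cubes n U)) \<le> (4 ^ CARD('n) * C) * 2 powr (real n * t)"
    unfolding eventually_sequentially using bound by blast
  then show ?thesis
    using C(2) by (intro that[of "4 ^ CARD('n) * C"]) auto
qed

section \<open>First moment bounds for the retained cubes that meet a set\<close>

context limsup_random_fractal
begin

lemma eventually_prob_le:
  assumes "ereal c < index1 M Z"
  shows "\<forall>\<^sub>F n in sequentially. \<forall>j\<in>index_set n. P n j \<le> 2 powr - (real n * c)"
proof -
  let ?m = "\<lambda>n. MAX Q\<in>dyadic_cubes n. cube_prob M Z n Q"
  have "limsup (\<lambda>n. elog2 (?m n) / ereal (real n)) < ereal (- c)"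
    using assms unfolding index1_def by (metis ereal_less_uminus_reorder uminus_ereal.simps(1))
  then have "\<forall>\<^sub>F n in sequentially. elog2 (?m n) / ereal (real n) < ereal (- c)"
    by (rule Limsup_lessD)
  then show ?thesis
    using eventually_gt_at_top[of 0]
  proof eventually_elim
    case (elim n)
    have P_le: "P n j \<le> ?m n" if "j \<in> index_set n" for j
      unfolding P_def using that by (intro Max_ge) (auto simp: finite_dyadic_cubes dyadic_cubes_eq)
    moreover have "(\<lambda>_. 0) \<in> index_set n"
      by (simp add: index_set_def)
    ultimately have "0 \<le> ?m n"
      using P_nonneg order_trans by blast
    then have "?m n < 2 powr (- c * real n)"
      using elim by (intro elog2_div_ltD) auto
    then show ?case
      using P_le by (force simp: mult.commute)
  qed
qed

text \<open>A first moment argument in the manner of Borel--Cantelli: with \<open>c > t - s\<close>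
  below \<open>index1\<close>, the expected weight at order \<open>n\<close> is at most
  \<open>C * 2 powr (n * (t - s - c))\<close>. The total weight is then almost surely finite, so the
  cubes of order at least \<open>N\<close>, which cover the intersection, have weight tending to
  0.\<close>

lemma dyadic_null_limsup_fractal:
  assumes s: "0 \<le> s" and ind: "ereal (t - s) < index1 M Z" and C: "0 \<le> C"
    and U: "\<forall>\<^sub>F n in sequentially. real (card (hit_cubes n U)) \<le> C * 2 powr (real n * t)"
  shows "AE \<omega> in M. dyadic_null s (limsup_fractal Z \<omega> \<inter> U)"
proof -
  obtain c where c: "ereal (t - s) < ereal c" "ereal c < index1 M Z"
    using ereal_dense2[OF ind] by blast
  have "\<forall>\<^sub>F n in sequentially. (\<forall>j\<in>index_set n. P n j \<le> 2 powr - (real n * c)) \<and>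
      real (card (hit_cubes n U)) \<le> C * 2 powr (real n * t) \<and> 1 \<le> n"
    using eventually_prob_le[OF c(2)] U eventually_ge_at_top by (intro eventually_conj)
  then obtain N0 where N0: "\<And>n j. N0 \<le> n \<Longrightarrow> j \<in> index_set n \<Longrightarrow> P n j \<le> 2 powr - (real n * c)"
      "\<And>n. N0 \<le> n \<Longrightarrow> real (card (hit_cubes n U)) \<le> C * 2 powr (real n * t)" "\<And>n. N0 \<le> n \<Longrightarrow> 1 \<le> n"
    unfolding eventually_sequentially by blast
  define L where "L n \<omega> = (if N0 \<le> n then {n} \<times> (hit_cubes n U \<inter> retained n \<omega>) else {})" for n \<omega>
  define W where "W n \<omega> = emeasure (node_measure s) (L n \<omega>)" for n \<omega>
  define q where "q = 2 powr (t - s - c)"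
  have q: "0 \<le> q" "q < 1"
    using c(1) by (auto simp: q_def powr_less_one)
  have W_eq: "W n \<omega> = (if N0 \<le> n then \<Sum>k\<in>hit_cubes n U. ennreal (2 powr - (real n * s)) * ennreal (Z n (dyadic_cube n k) \<omega>) else 0)"
    if "\<omega> \<in> space M" for n \<omega>
  proof (cases "N0 \<le> n")
    case True
    have "W n \<omega> = (\<Sum>(m, k)\<in>{n} \<times> (hit_cubes n U \<inter> retained n \<omega>). ennreal (2 powr - (real m * s)))"
      using True unfolding W_def L_def by (simp add: emeasure_node_measure_finite del: sum_ennreal)
    also have "\<dots> = (\<Sum>k\<in>hit_cubes n U \<inter> retained n \<omega>. ennreal (2 powr - (real n * s)))"
      by (subst sum.cartesian_product[symmetric]) simp
    also have "\<dots> = (\<Sum>k\<in>hit_cubes n U. if k \<in> retained n \<omega> then ennreal (2 powr - (real n * s)) else 0)"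
      by (rule sum.inter_restrict) simp
    also have "\<dots> = (\<Sum>k\<in>hit_cubes n U. ennreal (2 powr - (real n * s)) * ennreal (Z n (dyadic_cube n k) \<omega>))"
    proof (rule sum.cong[OF refl])
      fix k assume "k \<in> hit_cubes n U"
      then have "k \<in> index_set n"
        by (simp add: hit_cubes_def)
      then show "(if k \<in> retained n \<omega> then ennreal (2 powr - (real n * s)) else 0)
          = ennreal (2 powr - (real n * s)) * ennreal (Z n (dyadic_cube n k) \<omega>)"
        using indicator_retained[OF N0(3)[OF True] _ that, of k] by (auto simp: indicator_def split: if_splits)
    qed
    finally show ?thesis
      using True by simp
  qed (simp add: W_def L_def)
  have meas: "(\<lambda>\<omega>. \<Sum>k\<in>hit_cubes n U. ennreal (2 powr - (real n * s)) * ennreal (Z n (dyadic_cube n k) \<omega>)) \<in> borel_measurable M"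
    if "N0 \<le> n" for n
  proof (intro borel_measurable_sum borel_measurable_times_ennreal measurable_const)
    fix k assume "k \<in> hit_cubes n U"
    then have "Z n (dyadic_cube n k) \<in> borel_measurable M"
      using N0(3)[OF that] by (intro Z_measurable) (auto simp: hit_cubes_def)
    then show "(\<lambda>\<omega>. ennreal (Z n (dyadic_cube n k) \<omega>)) \<in> borel_measurable M"
      by measurable
  qed auto
  have W_meas: "W n \<in> borel_measurable M" for n
  proof (cases "N0 \<le> n")
    case True
    let ?g = "\<lambda>\<omega>. \<Sum>k\<in>hit_cubes n U. ennreal (2 powr - (real n * s)) * ennreal (Z n (dyadic_cube n k) \<omega>)"
    have "W n \<in> borel_measurable M \<longleftrightarrow> ?g \<in> borel_measurable M"
    proof (rule measurable_cong)
      fix \<omega> assume "\<omega> \<in> space M"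
      from W_eq[OF this, of n] True show "W n \<omega> = ?g \<omega>"
        by (simp only: if_True)
    qed
    with meas[OF True] show ?thesis
      by blast
  next
    case False
    then have "W n = (\<lambda>_. 0)"
      by (simp add: W_def L_def fun_eq_iff)
    then show ?thesis
      by simp
  qed
  have W_int: "(\<integral>\<^sup>+\<omega>. W n \<omega> \<partial>M) \<le> ennreal (C * q ^ n)" for n
  proof (cases "N0 \<le> n")
    case True
    have *: "(\<integral>\<^sup>+\<omega>. ennreal (Z n (dyadic_cube n k) \<omega>) \<partial>M) \<le> ennreal (2 powr - (real n * c))" if "k \<in> hit_cubes n U" for k
    proof -
      have k: "k \<in> index_set n"
        using that by (simp add: hit_cubes_def)
      note n = N0(3)[OF True]
      have nn: "AE \<omega> in M. 0 \<le> Z n (dyadic_cube n k) \<omega>"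
        by (intro AE_I2) (use Z_range[OF n k] in force)
      have "integrable M (Z n (dyadic_cube n k))"
        by (rule integrable_const_bound[of _ 1]) (use Z_range[OF n k] Z_measurable[OF n k] in \<open>force intro!: AE_I2\<close>)+
      then have "(\<integral>\<^sup>+\<omega>. ennreal (Z n (dyadic_cube n k) \<omega>) \<partial>M) = ennreal (P n k)"
        using nn by (simp add: nn_integral_eq_integral expectation_Z[OF n k])
      then show ?thesis
        using N0(1)[OF True k] by (simp add: ennreal_leI)
    qed
    have "(\<integral>\<^sup>+\<omega>. W n \<omega> \<partial>M) = (\<integral>\<^sup>+\<omega>. (\<Sum>k\<in>hit_cubes n U. ennreal (2 powr - (real n * s)) * ennreal (Z n (dyadic_cube n k) \<omega>)) \<partial>M)"
    proof (rule nn_integral_cong)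
      fix \<omega> assume "\<omega> \<in> space M"
      from W_eq[OF this, of n] True
      show "W n \<omega> = (\<Sum>k\<in>hit_cubes n U. ennreal (2 powr - (real n * s)) * ennreal (Z n (dyadic_cube n k) \<omega>))"
        by (simp only: if_True)
    qed
    also have "\<dots> = (\<Sum>k\<in>hit_cubes n U. ennreal (2 powr - (real n * s)) * (\<integral>\<^sup>+\<omega>. ennreal (Z n (dyadic_cube n k) \<omega>) \<partial>M))"
    proof -
      have m: "(\<lambda>\<omega>. ennreal (Z n (dyadic_cube n k) \<omega>)) \<in> borel_measurable M" if "k \<in> hit_cubes n U" for k
        using Z_measurable[OF N0(3)[OF True], of k] that unfolding hit_cubes_def by simp
      then show ?thesis
        by (subst nn_integral_sum) (auto intro!: sum.cong nn_integral_cmult)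
    qed
    also have "\<dots> \<le> (\<Sum>k\<in>hit_cubes n U. ennreal (2 powr - (real n * s)) * ennreal (2 powr - (real n * c)))"
      by (intro sum_mono mult_left_mono *) auto
    also have "\<dots> = ennreal (real (card (hit_cubes n U)) * (2 powr - (real n * s) * 2 powr - (real n * c)))"
      by (simp add: ennreal_mult' ennreal_of_nat_eq_real_of_nat del: sum_ennreal)
    also have "\<dots> \<le> ennreal ((C * 2 powr (real n * t)) * (2 powr - (real n * s) * 2 powr - (real n * c)))"
      using N0(2)[OF True] by (intro ennreal_leI mult_right_mono) auto
    also have "(C * 2 powr (real n * t)) * (2 powr - (real n * s) * 2 powr - (real n * c)) = C * q ^ n"
    proof -
      have "q ^ n = 2 powr (real n * t + (- (real n * s) + - (real n * c)))"
        unfolding q_def by (subst powr_realpow[symmetric]) (simp_all add: powr_powr algebra_simps)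
      then show ?thesis
        by (simp only: powr_add mult.assoc)
    qed
    finally show ?thesis .
  qed (simp add: W_def L_def)
  have "(\<integral>\<^sup>+\<omega>. (\<Sum>n. W n \<omega>) \<partial>M) = (\<Sum>n. \<integral>\<^sup>+\<omega>. W n \<omega> \<partial>M)"
    using W_meas by (rule nn_integral_suminf)
  also have "\<dots> \<le> (\<Sum>n. ennreal (C * q ^ n))"
    by (intro suminf_le W_int) auto
  also have "\<dots> < \<infinity>"
    using C q by (subst ennreal_geometric_suminf) auto
  finally have "AE \<omega> in M. (\<Sum>n. W n \<omega>) \<noteq> \<infinity>"
    using W_meas by (intro nn_integral_PInf_AE) auto
  then show ?thesis
  proof (rule eventually_mono)
    fix \<omega> assume finW: "(\<Sum>n. W n \<omega>) \<noteq> \<infinity>"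
    define D where "D N = (\<Union>n\<in>{N..}. L n \<omega>)" for N
    have "emeasure (node_measure s) (D 0) \<le> (\<Sum>n. W n \<omega>)"
      unfolding D_def W_def by (simp add: emeasure_subadditive_countably)
    moreover have "emeasure (node_measure s) (D N) \<le> emeasure (node_measure s) (D 0)" for N
      by (rule emeasure_node_measure_mono) (auto simp: D_def)
    ultimately have "emeasure (node_measure s) (D N) < \<infinity>" for N
      using finW by (metis infinity_ennreal_def less_top order_le_less_trans)
    then have "emeasure (node_measure s) (D N) \<noteq> \<infinity>" for N
      using less_top[of "emeasure (node_measure s) (D N)"] by simp
    then have "(\<lambda>N. emeasure (node_measure s) (D N)) \<longlonglongrightarrow> emeasure (node_measure s) (\<Inter>N. D N)"
    proof (intro Lim_emeasure_decseq)
      show "decseq D"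
        unfolding D_def by (intro antimonoI UN_mono) auto
    qed auto
    moreover have "(\<Inter>N. D N) = {}"
    proof -
      have "(m, k) \<notin> D (Suc m)" for m k
        by (auto simp: D_def L_def)
      then show ?thesis
        by auto
    qed
    ultimately have lim: "(\<lambda>N. emeasure (node_measure s) (D N)) \<longlonglongrightarrow> 0"
      by simp
    show "dyadic_null s (limsup_fractal Z \<omega> \<inter> U)"
      unfolding dyadic_null_def
    proof (intro allI impI)
      fix N :: nat and e :: real
      assume "0 < e"
      then have "\<forall>\<^sub>F N in sequentially. emeasure (node_measure s) (D N) < ennreal e"
        using lim by (intro order_tendstoD(2)[OF lim]) simp
      then obtain N1 where N1: "\<And>n. N1 \<le> n \<Longrightarrow> emeasure (node_measure s) (D n) < ennreal e"
        unfolding eventually_sequentially by blast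
      \<comment> \<open>At least 1, where the intersection in \<open>limsup_fractal\<close> starts;
        at least \<open>N0\<close>, so that \<open>L\<close> is not cut off; at least
        \<open>N\<close> for the orders and \<open>N1\<close> for the weight.\<close>
      define N' where "N' = max 1 (max N (max N0 N1))"
      have "limsup_fractal Z \<omega> \<inter> U \<subseteq> (\<Union>(m, k)\<in>D N'. dyadic_cube m k)"
      proof
        fix x assume x: "x \<in> limsup_fractal Z \<omega> \<inter> U"
        have "N' \<in> {1..}"
          by (simp add: N'_def)
        then have "x \<in> (\<Union>n\<in>{N'..}. level_set Z n \<omega>)"
          using x unfolding limsup_fractal_def by blast
        then obtain n where n: "N' \<le> n" "x \<in> level_set Z n \<omega>"
          by auto
        then obtain k where k: "k \<in> index_set n" "Z n (dyadic_cube n k) \<omega> = 1" "x \<in> dyadic_cube n k"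
          by (auto simp: level_set_def dyadic_cubes_eq)
        have "(n, k) \<in> L n \<omega>"
          using k n(1) x by (auto simp: L_def N'_def hit_cubes_def retained_def)
        then have "(n, k) \<in> D N'"
          using n(1) by (auto simp: D_def)
        with k(3) show "x \<in> (\<Union>(m, k)\<in>D N'. dyadic_cube m k)"
          by blast
      qed
      moreover have "\<forall>(m, k)\<in>D N'. N \<le> m"
        by (auto simp: D_def L_def N'_def split: if_splits)
      moreover have "emeasure (node_measure s) (D N') < ennreal e"
        by (rule N1) (simp add: N'_def)
      ultimately show "\<exists>C. (\<forall>(m, k)\<in>C. N \<le> m) \<and> limsup_fractal Z \<omega> \<inter> U \<subseteq> (\<Union>(m, k)\<in>C. dyadic_cube m k) \<and>
          emeasure (node_measure s) C < ennreal e"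
        by blast
    qed
  qed
qed

text \<open>Zero packing measure splits \<open>G\<close> into countably many pieces of finite
  packing premeasure. The cube count is available on each piece, not on \<open>G\<close>, so nullity
  is proved piecewise and reassembled.\<close>

lemma dyadic_null_limsup_fractal_packing:
  assumes t: "0 \<le> t" "packing_measure t G = 0" and s: "0 \<le> s" and ind: "ereal (t - s) < index1 M Z"
  shows "AE \<omega> in M. hausdorff_measure s (limsup_fractal Z \<omega> \<inter> G) = 0"
proof -
  have "packing_measure t G < 1"
    using t(2) by simp
  then obtain U :: "nat \<Rightarrow> (real ^ 'n) set" where U: "G \<subseteq> (\<Union>i. U i)" "(\<Sum>i. packing_premeasure t (U i)) < 1"
    unfolding packing_measure_def INF_less_iff by auto
  have "packing_premeasure t (U i) < top" for i
  proof -
    have "packing_premeasure t (U i) \<le> (\<Sum>i. packing_premeasure t (U i))"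
      using sum_le_suminf[of "\<lambda>i. packing_premeasure t (U i)" "{i}"] by simp
    also have "\<dots> < 1"
      by (rule U(2))
    also have "1 < (top :: ennreal)"
      by simp
    finally show ?thesis .
  qed
  then have "AE \<omega> in M. dyadic_null s (limsup_fractal Z \<omega> \<inter> U i)" for i
    by (rule packing_premeasure_hit_cubes[OF _ t(1), of "U i"]) (rule dyadic_null_limsup_fractal[OF s ind])
  then have "AE \<omega> in M. \<forall>i. dyadic_null s (limsup_fractal Z \<omega> \<inter> U i)"
    by (simp add: AE_all_countable)
  then show ?thesis
  proof (rule eventually_mono)
    fix \<omega> assume "\<forall>i. dyadic_null s (limsup_fractal Z \<omega> \<inter> U i)"
    then have "dyadic_null s (\<Union>i. limsup_fractal Z \<omega> \<inter> U i)"
      by (intro dyadic_null_UN) blast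
    then have "dyadic_null s (limsup_fractal Z \<omega> \<inter> G)"
      by (rule dyadic_null_subset) (use U(1) in auto)
    then show "hausdorff_measure s (limsup_fractal Z \<omega> \<inter> G) = 0"
      by (rule dyadic_null_hausdorff_measure[OF s])
  qed
qed

end

section \<open>Hitting probabilities and dimensions\<close>

text \<open>Order 0 counts nonempty covering sets. This fact and
  \<open>hausdorff_measure_empty\<close> turn hitting and missing into statements about Hausdorff
  measure of order 0.\<close>

lemma hausdorff_measure_0_eq_0: "hausdorff_measure 0 E = 0 \<Longrightarrow> E = {}"
proof (rule ccontr)
  assume zero: "hausdorff_measure 0 E = 0" and "E \<noteq> {}"
  then obtain x where x: "x \<in> E"
    by auto
  have "hausdorff_premeasure 0 1 E \<le> hausdorff_measure 0 E"
    unfolding hausdorff_measure_def by (rule SUP_upper) simp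
  with zero have "hausdorff_premeasure 0 1 E < 1"
    by simp
  then obtain U :: "nat \<Rightarrow> 'a set" where U: "E \<subseteq> (\<Union>i. U i)" "(\<Sum>i. diam_pow 0 (U i)) < 1"
    unfolding hausdorff_premeasure_def INF_less_iff by auto
  then obtain i where "x \<in> U i"
    using x by auto
  then have "1 = diam_pow 0 (U i)"
    by (auto simp: diam_pow_def)
  also have "\<dots> \<le> (\<Sum>i. diam_pow 0 (U i))"
    using sum_le_suminf[of "\<lambda>i. diam_pow 0 (U i)" "{i}"] by simp
  finally show False
    using U(2) by simp
qed

lemma hausdorff_measure_empty: "hausdorff_measure s ({} :: 'a::metric_space set) = 0"
proof -
  have "hausdorff_premeasure s \<delta> ({} :: 'a set) \<le> (\<Sum>i::nat. diam_pow s ({} :: 'a set))" if "0 < \<delta>" for \<delta>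
    unfolding hausdorff_premeasure_def by (rule INF_lower) (use that in auto)
  then show ?thesis
    unfolding hausdorff_measure_def by (intro antisym SUP_least) (auto simp: diam_pow_empty)
qed

lemma hausdorff_dim_nonneg: "0 \<le> hausdorff_dim E"
  unfolding hausdorff_dim_def by (rule Inf_greatest) auto

lemma hausdorff_dim_le: "0 \<le> s \<Longrightarrow> hausdorff_measure s E = 0 \<Longrightarrow> hausdorff_dim E \<le> ereal s"
  unfolding hausdorff_dim_def by (rule Inf_lower) auto

lemma hausdorff_dim_ge:
  assumes "\<And>r. 0 \<le> r \<Longrightarrow> r \<le> q \<Longrightarrow> hausdorff_measure r E \<noteq> 0"
  shows "ereal q \<le> hausdorff_dim E"
  unfolding hausdorff_dim_def
proof (rule Inf_greatest)
  fix x assume "x \<in> ereal ` {s. 0 \<le> s \<and> hausdorff_measure s E = 0}"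
  then obtain s where s: "x = ereal s" "0 \<le> s" "hausdorff_measure s E = 0"
    by auto
  with assms[of s] show "ereal q \<le> x"
    by (cases "s \<le> q") auto
qed

text \<open>A bound such as \<open>packing_dim G - index1 M Z\<close> may be infinite and need not
  be attained by the estimates. Rational thresholds keep the estimates finite and the number of
  exceptional sets countable.\<close>

lemma AE_le_of_rat:
  fixes f :: "'a \<Rightarrow> ereal"
  assumes "\<And>q::rat. y < ereal (of_rat q) \<Longrightarrow> AE x in M. f x \<le> ereal (of_rat q)"
  shows "AE x in M. f x \<le> y"
proof -
  have "AE x in M. \<forall>q::rat. y < ereal (of_rat q) \<longrightarrow> f x \<le> ereal (of_rat q)"
    unfolding AE_all_countable using assms by (auto intro: AE_I2)
  then show ?thesis
  proof (rule eventually_mono)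
    fix x assume *: "\<forall>q::rat. y < ereal (of_rat q) \<longrightarrow> f x \<le> ereal (of_rat q)"
    show "f x \<le> y"
    proof (rule ccontr)
      assume "\<not> f x \<le> y"
      then obtain q :: rat where "y < ereal (of_rat q)" "ereal (of_rat q) < f x"
        using ereal_dense3[of y "f x"] by (auto simp: not_le)
      with * show False
        by (meson not_less)
    qed
  qed
qed

lemma AE_ge_of_rat:
  fixes f :: "'a \<Rightarrow> ereal"
  assumes "\<And>q::rat. ereal (of_rat q) < y \<Longrightarrow> AE x in M. ereal (of_rat q) \<le> f x"
  shows "AE x in M. y \<le> f x"
proof -
  have "AE x in M. \<forall>q::rat. ereal (of_rat q) < y \<longrightarrow> ereal (of_rat q) \<le> f x"
    unfolding AE_all_countable using assms by (auto intro: AE_I2)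
  then show ?thesis
  proof (rule eventually_mono)
    fix x assume *: "\<forall>q::rat. ereal (of_rat q) < y \<longrightarrow> ereal (of_rat q) \<le> f x"
    show "y \<le> f x"
    proof (rule ccontr)
      assume "\<not> y \<le> f x"
      then obtain q :: rat where "f x < ereal (of_rat q)" "ereal (of_rat q) < y"
        using ereal_dense3[of "f x" y] by (auto simp: not_le)
      with * show False
        by (meson not_less)
    qed
  qed
qed

lemma null_event_completion:
  assumes "AE \<omega> in M. \<omega> \<notin> B" "B \<subseteq> space M"
  shows "B \<in> null_sets (completion M)"
proof -
  obtain N where "{\<omega> \<in> space M. \<not> \<omega> \<notin> B} \<subseteq> N" "N \<in> null_sets M"
    using assms(1) unfolding eventually_ae_filter by auto
  moreover have "{\<omega> \<in> space M. \<not> \<omega> \<notin> B} = B"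
    using assms(2) by auto
  ultimately show ?thesis
    by (metis null_sets_completionI null_sets_completion_subset)
qed

lemma (in prob_space) sure_event_completion:
  assumes "AE \<omega> in M. \<omega> \<in> B" "B \<subseteq> space M"
  shows "B \<in> sets (completion M) \<and> measure (completion M) B = 1"
proof -
  interpret c: prob_space "completion M"
    by (rule prob_space_completion)
  have "space M - B \<in> null_sets (completion M)"
    using assms(1) by (intro null_event_completion) auto
  then have sets: "space M - B \<in> sets (completion M)" and zero: "measure (completion M) (space M - B) = 0"
    by (auto simp: null_sets_def measure_def)
  have "space M - (space M - B) = B"
    using assms(2) by auto
  with c.prob_compl[OF sets] sets.compl_sets[OF sets] zero show ?thesis
    by simp
qed

lemma limsup_fractal_subset: "limsup_fractal Z \<omega> \<subseteq> cbox 0 1"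
proof
  fix x assume "x \<in> limsup_fractal Z \<omega>"
  then have "x \<in> (\<Union>n\<in>{1..}. level_set Z n \<omega>)"
    unfolding limsup_fractal_def by blast
  then show "x \<in> cbox 0 1"
    using dyadic_cube_subset by (auto simp: level_set_def dyadic_cubes_eq)
qed

text \<open>Lebesgue measure on the cells. It gives the bound for the whole limsup set directly,
  without computing the Hausdorff dimension of the unit cube.\<close>

definition uniform_mass :: "nat \<Rightarrow> ('n::finite \<Rightarrow> int) \<Rightarrow> real" where
  "uniform_mass m k = 2 powr - (real m * real CARD('n))"

lemma mass_distribution_uniform: "mass_distribution (uniform_mass :: nat \<Rightarrow> ('n::finite \<Rightarrow> int) \<Rightarrow> real)"
  unfolding mass_distribution_def
proof (intro conjI allI ballI)
  show "0 \<le> uniform_mass m k" for m and k :: "'n \<Rightarrow> int"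
    by (simp add: uniform_mass_def)
  fix m and k :: "'n \<Rightarrow> int"
  assume k: "k \<in> index_set m"
  have "children m k = PiE UNIV (\<lambda>i. {2 * k i, 2 * k i + 1})"
  proof (intro set_eqI iffI)
    fix j assume "j \<in> children m k"
    then have "j i div 2 = k i" for i
      by (auto simp: children_def ancestor_def)
    moreover have "a div 2 = b \<Longrightarrow> a = 2 * b \<or> a = 2 * b + 1" for a b :: int
      by presburger
    ultimately have "j i = 2 * k i \<or> j i = 2 * k i + 1" for i
      by blast
    then show "j \<in> PiE UNIV (\<lambda>i. {2 * k i, 2 * k i + 1})"
      by (simp add: PiE_UNIV_domain)
  next
    fix j assume "j \<in> PiE UNIV (\<lambda>i. {2 * k i, 2 * k i + 1})"
    then have j: "j i = 2 * k i \<or> j i = 2 * k i + 1" for i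
      by (auto simp: PiE_UNIV_domain)
    have "j i div 2 = k i" for i
      using j[of i] by auto
    moreover have "0 \<le> j i \<and> j i < 2 ^ Suc m" for i
    proof -
      have "0 \<le> k i" "k i < 2 ^ m"
        using k by (auto simp: index_set_def)
      with j[of i] show ?thesis
        unfolding power_Suc by linarith
    qed
    ultimately show "j \<in> children m k"
      by (auto simp: children_def ancestor_def index_set_def)
  qed
  then have "card (children m k) = 2 ^ CARD('n)"
    by (simp add: card_PiE numeral_2_eq_2)
  then have "sum (uniform_mass (Suc m)) (children m k) = 2 ^ CARD('n) * 2 powr - (real (Suc m) * real CARD('n))"
    by (simp add: uniform_mass_def)
  also have "\<dots> = 2 powr (real CARD('n) + - (real (Suc m) * real CARD('n)))"
    by (subst powr_add, subst powr_realpow) simp_all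
  also have "real CARD('n) + - (real (Suc m) * real CARD('n)) = - (real m * real CARD('n))"
    by (simp add: algebra_simps)
  finally show "uniform_mass m k = sum (uniform_mass (Suc m)) (children m k)"
    by (simp add: uniform_mass_def)
qed

lemma carried_by_uniform: "carried_by uniform_mass (cbox 0 1 :: (real ^ 'n) set)"
  unfolding carried_by_def
proof (intro allI ballI impI)
  fix m and k :: "'n \<Rightarrow> int"
  assume k: "k \<in> index_set m"
  let ?x = "(\<chi> i. of_int (k i) / 2 ^ m) :: real ^ 'n"
  have x: "?x \<in> dyadic_cube m k"
    by (simp add: dyadic_cube_def mem_box_cart divide_right_mono)
  have "k i \<le> 2 ^ m - 1" for i
    using k by (simp add: index_set_def)
  then have "cube_index m ?x = k"
    by (auto simp: cube_index_def fun_eq_iff min_def)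
  with x dyadic_cube_subset[OF k] show "\<exists>x\<in>cbox 0 1. cube_index m x = k"
    by blast
qed

text \<open>All \<open>2 ^ (m * CARD('n))\<close> cells of one order, taken with exponent
  \<open>CARD('n) + 1\<close>, weigh \<open>(1 / 2) ^ m\<close>. Finiteness excludes
  \<open>\<infinity> - \<infinity>\<close> when \<open>index2\<close> is subtracted from the
  dimension.\<close>

lemma hausdorff_dim_finite:
  fixes E :: "(real ^ 'n) set"
  assumes "E \<subseteq> cbox 0 1"
  shows "hausdorff_dim E < \<infinity>"
proof -
  let ?s = "real CARD('n) + 1"
  have "dyadic_null ?s E"
    unfolding dyadic_null_def
  proof (intro allI impI)
    fix N :: nat and e :: real
    assume "0 < e"
    then obtain m0 where m0: "(1 / 2) ^ m0 < e"
      using real_arch_pow_inv[of e "1 / 2"] by auto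
    define m where "m = max N m0"
    let ?C = "{m} \<times> (index_set m :: ('n \<Rightarrow> int) set)"
    have "emeasure (node_measure ?s) ?C = (\<Sum>(l, k)\<in>?C. ennreal (2 powr - (real l * ?s)))"
      by (rule emeasure_node_measure_finite) simp
    also have "\<dots> = (\<Sum>k\<in>(index_set m :: ('n \<Rightarrow> int) set). ennreal (2 powr - (real m * ?s)))"
      by (subst sum.cartesian_product[symmetric]) simp
    also have "\<dots> = ennreal (2 ^ (m * CARD('n)) * 2 powr - (real m * ?s))"
      by (simp add: card_index_set ennreal_mult' ennreal_power[symmetric])
    also have "2 ^ (m * CARD('n)) * 2 powr - (real m * ?s) = (1 / 2) ^ m"
      by (simp add: powr_realpow[symmetric] powr_add[symmetric] powr_minus_divide powr_divide algebra_simps)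
    also have "ennreal ((1 / 2) ^ m) < ennreal e"
    proof -
      have "(1 / 2 :: real) ^ m \<le> (1 / 2) ^ m0"
        by (rule power_decreasing) (auto simp: m_def)
      with m0 have "(1 / 2) ^ m < e"
        by linarith
      then show ?thesis
        using \<open>0 < e\<close> by (intro ennreal_lessI)
    qed
    finally have "emeasure (node_measure ?s) ?C < ennreal e" .
    moreover have "E \<subseteq> (\<Union>(l, k)\<in>?C. dyadic_cube l k)"
    proof
      fix x assume "x \<in> E"
      then have x: "x \<in> cbox 0 1"
        using assms by blast
      then have "(m, cube_index m x) \<in> ?C"
        using cube_index_in_index_set by simp
      then show "x \<in> (\<Union>(l, k)\<in>?C. dyadic_cube l k)"
        using in_dyadic_cube_cube_index[OF x, of m] by blast
    qed
    ultimately show "\<exists>C. (\<forall>(l, k)\<in>C. N \<le> l) \<and> E \<subseteq> (\<Union>(l, k)\<in>C. dyadic_cube l k) \<and>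
        emeasure (node_measure ?s) C < ennreal e"
      by (intro exI[of _ ?C]) (auto simp: m_def)
  qed
  then have "hausdorff_dim E \<le> ereal ?s"
    by (intro hausdorff_dim_le dyadic_null_hausdorff_measure) auto
  then show ?thesis
    by (rule order_le_less_trans) simp
qed

section \<open>From almost sure measure bounds to dimensions and hitting events\<close>

context limsup_random_fractal
begin

text \<open>An exponent \<open>s\<close> strictly between \<open>q + index2 M Z\<close> and
  \<open>hausdorff_dim G\<close> serves both ends: below the dimension it yields positive content, a
  compact subset and a Frostman distribution, and \<open>s - q > index2 M Z\<close> is what the
  random construction requires.\<close>

lemma hausdorff_dim_lower_bound:
  assumes corr: "correlation_condition M Z 0" and G: "analytic_set G" "G \<subseteq> cbox 0 1"
    and q: "0 < q" "ereal q < hausdorff_dim G - index2 M Z"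
  shows "AE \<omega> in M. \<forall>r. 0 \<le> r \<longrightarrow> r \<le> q \<longrightarrow> hausdorff_measure r (limsup_fractal Z \<omega> \<inter> G) \<noteq> 0"
proof -
  have "ereal q + index2 M Z < hausdorff_dim G"
    using q(2) index2_nonneg hausdorff_dim_nonneg[of G] hausdorff_dim_finite[OF G(2)]
    by (cases "index2 M Z"; cases "hausdorff_dim G") auto
  then obtain s where s: "ereal q + index2 M Z < ereal s" "ereal s < hausdorff_dim G"
    using ereal_dense2 by blast
  have ind: "index2 M Z < ereal (s - q)"
    using s(1) index2_nonneg by (cases "index2 M Z") auto
  then have "ereal 0 < ereal (s - q)"
    using index2_nonneg by (metis order_le_less_trans zero_ereal_def)
  then have s0: "0 < s"
    using q(1) by simp
  have "hausdorff_measure s G \<noteq> 0"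
    using hausdorff_dim_le[of s G] s(2) s0 by (auto simp: not_less[symmetric])
  then have "0 < net_content s G"
    by (rule net_content_pos[OF s0 G(2)])
  then obtain K where K: "compact K" "K \<subseteq> G" "0 < net_content s K"
    by (rule analytic_compact_subset[OF G])
  then have K1: "K \<subseteq> cbox 0 1"
    using G(2) by blast
  obtain \<mu> where \<mu>: "mass_distribution \<mu>" "carried_by \<mu> K" "0 < \<mu> 0 (\<lambda>_. 0)"
      "\<And>m k. \<mu> m k \<le> 2 powr - (real m * s)"
    using frostman[OF K1 K(3)] by blast
  have "frostman_bound s \<mu>"
    unfolding frostman_bound_def using \<mu>(4) by (intro exI[of _ 1]) auto
  then have "AE \<omega> in M. \<forall>E r. limsup_fractal Z \<omega> \<inter> K \<subseteq> E \<longrightarrow> 0 \<le> r \<longrightarrow> r \<le> q \<longrightarrow> hausdorff_measure r E \<noteq> 0"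
    using \<mu> by (intro hausdorff_measure_limsup_fractal_nonzero[OF corr ind q(1) K(1) K1]) auto
  then show ?thesis
    by (rule eventually_mono) (use K(2) in blast)
qed

lemma hausdorff_dim_limsup_fractal_ge:
  assumes corr: "correlation_condition M Z 0" and G: "analytic_set G" "G \<subseteq> cbox 0 1"
  shows "AE \<omega> in M. max 0 (hausdorff_dim G - index2 M Z) \<le> hausdorff_dim (limsup_fractal Z \<omega> \<inter> G)"
proof (rule AE_ge_of_rat)
  fix q :: rat
  assume q: "ereal (of_rat q) < max 0 (hausdorff_dim G - index2 M Z)"
  show "AE \<omega> in M. ereal (of_rat q) \<le> hausdorff_dim (limsup_fractal Z \<omega> \<inter> G)"
  proof (cases "0 < real_of_rat q")
    case True
    then have "ereal (of_rat q) < hausdorff_dim G - index2 M Z"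
      using q by (auto simp: less_max_iff_disj)
    from hausdorff_dim_lower_bound[OF corr G True this] show ?thesis
      by (rule eventually_mono) (intro hausdorff_dim_ge, blast)
  next
    case False
    then have "ereal (of_rat q) \<le> 0"
      by simp
    then show ?thesis
      by (intro AE_I2) (rule order_trans[OF _ hausdorff_dim_nonneg])
  qed
qed

lemma hausdorff_dim_limsup_fractal_le:
  "AE \<omega> in M. hausdorff_dim (limsup_fractal Z \<omega> \<inter> G) \<le> max 0 (packing_dim G - index1 M Z)"
proof (rule AE_le_of_rat)
  fix q :: rat
  define s where "s = real_of_rat q"
  assume "max 0 (packing_dim G - index1 M Z) < ereal (of_rat q)"
  then have s: "0 \<le> s" "packing_dim G - index1 M Z < ereal s"
    by (auto simp: s_def)
  then have "packing_dim G < ereal s + index1 M Z"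
    by (cases "packing_dim G"; cases "index1 M Z") auto
  then obtain t where t: "0 \<le> t" "packing_measure t G = 0" "ereal t < ereal s + index1 M Z"
    unfolding packing_dim_def Inf_less_iff by auto
  have "ereal (t - s) < index1 M Z"
    using t(3) by (cases "index1 M Z") auto
  from dyadic_null_limsup_fractal_packing[OF t(1,2) s(1) this]
  show "AE \<omega> in M. hausdorff_dim (limsup_fractal Z \<omega> \<inter> G) \<le> ereal (of_rat q)"
    by (rule eventually_mono) (auto simp: s_def[symmetric] intro: hausdorff_dim_le s)
qed

text \<open>The case \<open>s = 0\<close> of the covering bound, whose condition then reads
  \<open>t < index1 M Z\<close>.\<close>

lemma hitting_event_null:
  assumes "packing_dim G < index1 M Z"
  shows "hitting_event M Z G \<in> null_sets (completion M)"
proof (rule null_event_completion)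
  obtain t where t: "0 \<le> t" "packing_measure t G = 0" "ereal t < index1 M Z"
    using assms unfolding packing_dim_def Inf_less_iff by auto
  have "AE \<omega> in M. hausdorff_measure 0 (limsup_fractal Z \<omega> \<inter> G) = 0"
    using t by (intro dyadic_null_limsup_fractal_packing[OF t(1,2)]) auto
  then show "AE \<omega> in M. \<omega> \<notin> hitting_event M Z G"
    by (rule eventually_mono) (auto simp: hitting_event_def dest: hausdorff_measure_0_eq_0)
qed (auto simp: hitting_event_def)

text \<open>The strict inequality leaves a positive \<open>q\<close> in the gap, and the lower bound
  at order \<open>r = 0\<close> shows that the intersection is nonempty.\<close>

lemma hitting_event_sure:
  assumes corr: "correlation_condition M Z 0" and G: "analytic_set G" "G \<subseteq> cbox 0 1"
    and dim: "index2 M Z < hausdorff_dim G"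
  shows "hitting_event M Z G \<in> sets (completion M) \<and> measure (completion M) (hitting_event M Z G) = 1"
proof (rule sure_event_completion)
  have "0 < hausdorff_dim G - index2 M Z"
    using dim index2_nonneg by (cases "index2 M Z"; cases "hausdorff_dim G") auto
  then obtain q where q: "0 < ereal q" "ereal q < hausdorff_dim G - index2 M Z"
    using ereal_dense2 by blast
  then have "0 < q"
    by simp
  from hausdorff_dim_lower_bound[OF corr G this q(2)] AE_space
  show "AE \<omega> in M. \<omega> \<in> hitting_event M Z G"
  proof eventually_elim
    case (elim \<omega>)
    then have "hausdorff_measure 0 (limsup_fractal Z \<omega> \<inter> G) \<noteq> 0"
      using \<open>0 < q\<close> by auto
    then have "limsup_fractal Z \<omega> \<inter> G \<noteq> {}"
      using hausdorff_measure_empty by metis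
    with elim show ?case
      by (simp add: hitting_event_def)
  qed
qed (auto simp: hitting_event_def)

text \<open>For the unit cube both ingredients are explicit: it meets at most all
  \<open>2 ^ (n * CARD('n))\<close> cubes of order \<open>n\<close>, and \<open>uniform_mass\<close>
  has Frostman exponent \<open>CARD('n)\<close>.\<close>

lemma hausdorff_dim_limsup_fractal_eq:
  assumes corr: "correlation_condition M Z 0" and eq: "index1 M Z = index2 M Z"
  shows "AE \<omega> in M. hausdorff_dim (limsup_fractal Z \<omega>) = max 0 (ereal (real CARD('n)) - index1 M Z)"
proof -
  let ?d = "real CARD('n)"
  have cube: "limsup_fractal Z \<omega> \<inter> cbox 0 1 = limsup_fractal Z \<omega>" for \<omega>
    using limsup_fractal_subset[of Z \<omega>] by blast
  have "AE \<omega> in M. hausdorff_dim (limsup_fractal Z \<omega>) \<le> max 0 (ereal ?d - index1 M Z)"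
  proof (rule AE_le_of_rat)
    fix q :: rat
    define s where "s = real_of_rat q"
    assume "max 0 (ereal ?d - index1 M Z) < ereal (of_rat q)"
    then have s: "0 \<le> s" "ereal ?d - index1 M Z < ereal s"
      by (auto simp: s_def)
    then have ind: "ereal (?d - s) < index1 M Z"
      by (cases "index1 M Z") auto
    have "real (card (hit_cubes n (cbox 0 1 :: (real ^ 'n) set))) \<le> 1 * 2 powr (real n * ?d)" for n
    proof -
      have "card (hit_cubes n (cbox 0 1 :: (real ^ 'n) set)) \<le> card (index_set n :: ('n \<Rightarrow> int) set)"
        by (rule card_mono) (auto simp: hit_cubes_def)
      then have "real (card (hit_cubes n (cbox 0 1 :: (real ^ 'n) set))) \<le> 2 ^ (n * CARD('n))"
        unfolding card_index_set by (metis of_nat_le_iff of_nat_numeral of_nat_power)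
      also have "\<dots> = 2 powr (real n * ?d)"
        by (simp add: powr_realpow[symmetric])
      finally show ?thesis
        by simp
    qed
    then have "AE \<omega> in M. dyadic_null s (limsup_fractal Z \<omega> \<inter> cbox 0 1)"
      by (intro dyadic_null_limsup_fractal[OF s(1) ind, of 1]) auto
    then show "AE \<omega> in M. hausdorff_dim (limsup_fractal Z \<omega>) \<le> ereal (of_rat q)"
      unfolding cube s_def[symmetric]
      by (rule eventually_mono) (intro hausdorff_dim_le dyadic_null_hausdorff_measure s)
  qed
  moreover have "AE \<omega> in M. max 0 (ereal ?d - index1 M Z) \<le> hausdorff_dim (limsup_fractal Z \<omega>)"
  proof (rule AE_ge_of_rat)
    fix q :: rat
    define t where "t = real_of_rat q"
    assume q: "ereal (of_rat q) < max 0 (ereal ?d - index1 M Z)"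
    show "AE \<omega> in M. ereal (of_rat q) \<le> hausdorff_dim (limsup_fractal Z \<omega>)"
    proof (cases "0 < t")
      case True
      then have "ereal t < ereal ?d - index2 M Z"
        using q by (auto simp: t_def less_max_iff_disj eq)
      then have ind: "index2 M Z < ereal (?d - t)"
        using index2_nonneg by (cases "index2 M Z") auto
      have "frostman_bound ?d (uniform_mass :: nat \<Rightarrow> ('n \<Rightarrow> int) \<Rightarrow> real)"
        unfolding frostman_bound_def by (intro exI[of _ 1]) (auto simp: uniform_mass_def)
      moreover have "0 < uniform_mass 0 ((\<lambda>_. 0) :: 'n \<Rightarrow> int)"
        by (simp add: uniform_mass_def)
      ultimately have "AE \<omega> in M. \<forall>E r. limsup_fractal Z \<omega> \<inter> cbox 0 1 \<subseteq> E \<longrightarrow> 0 \<le> r \<longrightarrow> r \<le> t \<longrightarrow> hausdorff_measure r E \<noteq> 0"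
        by (rule hausdorff_measure_limsup_fractal_nonzero[OF corr ind True compact_cbox order_refl
            mass_distribution_uniform _ carried_by_uniform])
      then show ?thesis
        unfolding t_def[symmetric] cube
        by (rule eventually_mono) (blast intro: hausdorff_dim_ge)
    next
      case False
      then have "ereal (of_rat q) \<le> 0"
        by (simp add: t_def)
      then show ?thesis
        by (intro AE_I2) (rule order_trans[OF _ hausdorff_dim_nonneg])
    qed
  qed
  ultimately show ?thesis
    by eventually_elim (rule antisym)
qed

end

theorem corollary1p1:
  fixes M :: "'w measure"
    and Z :: "nat \<Rightarrow> (real ^ 'n) set \<Rightarrow> 'w \<Rightarrow> real"
  assumes "limsup_fractal_family M Z"
    and "correlation_condition M Z 0"
  shows
    "(\<forall>G :: (real ^ 'n) set. analytic_set G \<and> G \<subseteq> cbox 0 1 \<longrightarrow>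
        (packing_dim G < index1 M Z \<longrightarrow>
           hitting_event M Z G \<in> sets (completion M) \<and>
           measure (completion M) (hitting_event M Z G) = 0) \<and>
        (hausdorff_dim G > index2 M Z \<longrightarrow>
           hitting_event M Z G \<in> sets (completion M) \<and>
           measure (completion M) (hitting_event M Z G) = 1) \<and>
        (AE \<omega> in M.
           max 0 (hausdorff_dim G - index2 M Z) \<le> hausdorff_dim (limsup_fractal Z \<omega> \<inter> G) \<and>
           hausdorff_dim (limsup_fractal Z \<omega> \<inter> G) \<le> max 0 (packing_dim G - index1 M Z))) \<and>
     (index1 M Z = index2 M Z \<longrightarrow>
        (AE \<omega> in M.
           hausdorff_dim (limsup_fractal Z \<omega>) = max 0 (ereal (real CARD('n)) - index1 M Z)))"
proof -
  interpret prob_space M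
    using assms(1) by (simp add: limsup_fractal_family_def)
  interpret limsup_random_fractal M Z
    by unfold_locales (use assms(1) in \<open>auto simp: limsup_fractal_family_def dyadic_cubes_eq\<close>)
  have null: "hitting_event M Z G \<in> sets (completion M) \<and> measure (completion M) (hitting_event M Z G) = 0"
    if "packing_dim G < index1 M Z" for G
    using hitting_event_null[OF that] by (auto simp: null_sets_def measure_def)
  have dims: "AE \<omega> in M.
      max 0 (hausdorff_dim G - index2 M Z) \<le> hausdorff_dim (limsup_fractal Z \<omega> \<inter> G) \<and>
      hausdorff_dim (limsup_fractal Z \<omega> \<inter> G) \<le> max 0 (packing_dim G - index1 M Z)"
    if "analytic_set G" "G \<subseteq> cbox 0 1" for G
    using hausdorff_dim_limsup_fractal_ge[OF assms(2) that] hausdorff_dim_limsup_fractal_le[of G]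
    by eventually_elim (rule conjI)
  show ?thesis
  proof (intro conjI allI impI)
    fix G :: "(real ^ 'n) set"
    assume G: "analytic_set G \<and> G \<subseteq> cbox 0 1"
    show "hitting_event M Z G \<in> sets (completion M)" "measure (completion M) (hitting_event M Z G) = 0"
      if "packing_dim G < index1 M Z"
      using null[OF that] by simp_all
    show "hitting_event M Z G \<in> sets (completion M)" "measure (completion M) (hitting_event M Z G) = 1"
      if "index2 M Z < hausdorff_dim G"
      using hitting_event_sure[OF assms(2) _ _ that] G by simp_all
    show "AE \<omega> in M.
        max 0 (hausdorff_dim G - index2 M Z) \<le> hausdorff_dim (limsup_fractal Z \<omega> \<inter> G) \<and>
        hausdorff_dim (limsup_fractal Z \<omega> \<inter> G) \<le> max 0 (packing_dim G - index1 M Z)"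
      using dims[of G] G by blast
  next
    assume "index1 M Z = index2 M Z"
    then show "AE \<omega> in M. hausdorff_dim (limsup_fractal Z \<omega>) = max 0 (ereal (real CARD('n)) - index1 M Z)"
      by (rule hausdorff_dim_limsup_fractal_eq[OF assms(2)])
  qed
qed

end
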